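(* Assume that the flow $\phi$ of $\partial_t u=A_0u+A_1(u)$ and the flows $\phi_0$ of $\partial_t u=A_0u$ and $\phi_1$ of $\partial_t u=A_1(u)$ are compatible with a sequence $\{\mathsf H_k\}_{k\ge 0}$ of Hilbert spaces with $\mathsf H_0=\mathsf H$ and $\mathsf H_{k+1}\hookrightarrow\mathsf H_k$. Let $q\in\mathbb N$ and let $\gamma=(\gamma_1,\dots,\gamma_s)\in\mathbb R^s$ satisfy $$\sum_{m=1}^s\gamma_m=1,\qquad \sum_{m=1}^s m^{-k}\gamma_m=0\quad\text{for }1\le k\le q-1 .$$ Let $\Phi(h)=\sum_{m=1}^s\gamma_m\Phi_m^{\pm}(h/m)$ (one fixed choice of sign, either $+$ or $-$, for all $m$). Then for every $u\in\mathsf H_q$, $$\frac{\partial^k\Phi}{\partial h^k}(0,u)=\frac{\partial^k\phi}{\partial h^k}(0,u),\qquad k=0,\dots,q.$$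
   Context: $\mathsf H$ is a Hilbert space, $A_0$ is a closed densely defined linear operator on $D(A_0)\subset\mathsf H$ generating a quasicontraction semigroup ($\|e^{tA_0}u\|\le e^{\kappa_0t}\|u\|$), and $A_1:\mathsf H\to\mathsf H$ is a smooth map with $A_1(0)=0$. Flows are solution maps $(t,u_0)\mapsto u(t)$ in the usual (mild) sense; a flow $\varphi$ satisfies $\varphi(0)=I$ and $\varphi(t+t')=\varphi(t)\circ\varphi(t')$. In particular $\phi_0(t)=e^{tA_0}$. Notation: $\varphi(h)=\varphi(h,\cdot)$. Define $\Phi^+(h)=\phi_1(h)\circ\phi_0(h)$, $\Phi^-(h)=\phi_0(h)\circ\phi_1(h)$, $\Phi_1^\pm=\Phi^\pm$ and $\Phi_m^\pm(h)=\Phi^\pm(h)\circ\Phi_{m-1}^\pm(h)$ for $m\ge2$. Compatibility: $\varphi\in C([0,h_* )\times\mathsf H_0,\mathsf H_0)$ is compatible with $\{\mathsf H_k\}_{k\ge0}$ if for all $k,l\ge0$, $\varphi\in C^{k,\infty}([0,h_* )\times\mathsf H_{k+l},\mathsf H_l)$, i.e. the restriction of $\varphi$ to $[0,h_* )\times\mathsf H_{k+l}$ takes values in $\mathsf H_l$ and is $k$ times continuously differentiable in $h$ and infinitely differentiable in $u$: all mixed derivatives $\partial_h^jD_u^i\varphi(h,u)[v_1,\dots,v_i]$ ($0\le j\le k$, $i\ge0$) exist in $\mathsf H_l$ and are jointly continuous in $(h,u,v_1,\dots,v_i)\in[0,h_* )\times\mathsf H_{k+l}^{1+i}$. Derivatives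 at $h=0$ are one-sided. *)

theory Defs
  imports "HOL-Analysis.Analysis"
begin

section \<open>Hilbert spaces carried by subsets\<close>

text \<open>
  The spaces of the scale are subspaces of one ambient space, the embeddings being the inclusions.
  A member of the scale is given by a carrier \<open>S\<close> and an inner product \<open>g\<close>, whose values outside
  \<open>S\<close> are irrelevant. All spaces are real; a complex Hilbert space is covered by restricting the
  scalars, with the real part of its inner product.
\<close>

definition ip_norm :: "('a \<Rightarrow> 'a \<Rightarrow> real) \<Rightarrow> 'a \<Rightarrow> real" where
  "ip_norm g u = sqrt (g u u)"

text \<open>
  The value 0 outside the carrier is there because the locale \<open>Metric_space\<close> asks for
  nonnegativity and symmetry of the distance on the whole type.
\<close>

definition ip_dist :: "'a::real_vector set \<Rightarrow> ('a \<Rightarrow> 'a \<Rightarrow> real) \<Rightarrow> 'a \<Rightarrow> 'a \<Rightarrow> real" where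
  "ip_dist S g u v = (if u \<in> S \<and> v \<in> S then ip_norm g (u - v) else 0)"

definition ip_top :: "'a::real_vector set \<Rightarrow> ('a \<Rightarrow> 'a \<Rightarrow> real) \<Rightarrow> 'a topology" where
  "ip_top S g = Metric_space.mtopology S (ip_dist S g)"

definition hilbert_on :: "'a::real_vector set \<Rightarrow> ('a \<Rightarrow> 'a \<Rightarrow> real) \<Rightarrow> bool" where
  "hilbert_on S g \<longleftrightarrow>
     subspace S \<and>
     (\<forall>u\<in>S. \<forall>v\<in>S. g u v = g v u) \<and>
     (\<forall>u\<in>S. \<forall>v\<in>S. \<forall>w\<in>S. g (u + v) w = g u w + g v w) \<and>
     (\<forall>u\<in>S. \<forall>v\<in>S. \<forall>c. g (c *\<^sub>R u) v = c * g u v) \<and>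
     (\<forall>u\<in>S. u \<noteq> 0 \<longrightarrow> 0 < g u u) \<and>
     Metric_space.mcomplete S (ip_dist S g)"

definition hilbert_scale ::
  "(nat \<Rightarrow> 'a::real_inner set) \<Rightarrow> (nat \<Rightarrow> 'a \<Rightarrow> 'a \<Rightarrow> real) \<Rightarrow> bool" where
  "hilbert_scale Hs ip \<longleftrightarrow>
     Hs 0 = UNIV \<and> ip 0 = inner \<and>
     (\<forall>k. hilbert_on (Hs k) (ip k)) \<and>
     (\<forall>k. Hs (Suc k) \<subseteq> Hs k \<and>
          (\<exists>C. \<forall>u\<in>Hs (Suc k). ip_norm (ip k) u \<le> C * ip_norm (ip (Suc k)) u))"

section \<open>Smooth maps and compatibility\<close>

definition frechet_at ::
  "'a::real_vector set \<Rightarrow> ('a \<Rightarrow> 'a \<Rightarrow> real) \<Rightarrow> 'a set \<Rightarrow> ('a \<Rightarrow> 'a \<Rightarrow> real) \<Rightarrow>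
   ('a \<Rightarrow> 'a) \<Rightarrow> ('a \<Rightarrow> 'a) \<Rightarrow> 'a \<Rightarrow> bool" where
  "frechet_at S g T g' f f' u \<longleftrightarrow>
     (\<forall>v\<in>S. f' v \<in> T) \<and>
     (\<forall>v\<in>S. \<forall>w\<in>S. f' (v + w) = f' v + f' w) \<and>
     (\<forall>v\<in>S. \<forall>c. f' (c *\<^sub>R v) = c *\<^sub>R f' v) \<and>
     (\<exists>C. \<forall>v\<in>S. ip_norm g' (f' v) \<le> C * ip_norm g v) \<and>
     ((\<lambda>w. ip_norm g' (f w - f u - f' (w - u)) / ip_norm g (w - u)) \<longlongrightarrow> 0)
       (atin (ip_top S g) u)"

text \<open>
  The class of maps from \<open>[0, hs) \<times> S\<close> to \<open>T\<close> that are \<open>k\<close> times continuously differentiable in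
  \<open>h\<close> and infinitely differentiable in \<open>u\<close>. The value \<open>D j i h u v\<close> is the mixed derivative
  \<open>\<partial>\<^sub>h\<^sup>j D\<^sub>u\<^sup>i \<phi>(h,u)[v 0, \<dots>, v (i - 1)]\<close>; the directions form a point of the product of
  \<open>i\<close> copies of \<open>S\<close>, which for \<open>i = 0\<close> has \<open>\<lambda>_. undefined\<close> as its only element.
  The \<open>h\<close>-derivatives are limits of difference quotients within \<open>[0, hs)\<close>, hence one-sided at 0.
\<close>

definition Ck_inf ::
  "nat \<Rightarrow> real \<Rightarrow> 'a::real_vector set \<Rightarrow> ('a \<Rightarrow> 'a \<Rightarrow> real) \<Rightarrow> 'a set \<Rightarrow> ('a \<Rightarrow> 'a \<Rightarrow> real) \<Rightarrow>
   (real \<Rightarrow> 'a \<Rightarrow> 'a) \<Rightarrow> bool" where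
  "Ck_inf k hs S g T g' \<phi> \<longleftrightarrow>
     (\<exists>D :: nat \<Rightarrow> nat \<Rightarrow> real \<Rightarrow> 'a \<Rightarrow> (nat \<Rightarrow> 'a) \<Rightarrow> 'a.
        (\<forall>h\<in>{0..<hs}. \<forall>u\<in>S. D 0 0 h u (\<lambda>_. undefined) = \<phi> h u) \<and>
        (\<forall>i. \<forall>h\<in>{0..<hs}. \<forall>u\<in>S. \<forall>v \<in> {..<i} \<rightarrow>\<^sub>E S.
           frechet_at S g T g' (\<lambda>w. D 0 i h w v) (\<lambda>w. D 0 (Suc i) h u (v(i := w))) u) \<and>
        (\<forall>i. \<forall>j<k. \<forall>h\<in>{0..<hs}. \<forall>u\<in>S. \<forall>v \<in> {..<i} \<rightarrow>\<^sub>E S.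
           limitin (ip_top T g') (\<lambda>h'. (D j i h' u v - D j i h u v) /\<^sub>R (h' - h))
             (D (Suc j) i h u v) (at h within {0..<hs})) \<and>
        (\<forall>i. \<forall>j\<le>k.
           continuous_map
             (prod_topology (top_of_set {0..<hs})
               (prod_topology (ip_top S g) (product_topology (\<lambda>_. ip_top S g) {..<i})))
             (ip_top T g')
             (\<lambda>(h, u, v). D j i h u v)))"

definition compatible ::
  "real \<Rightarrow> (nat \<Rightarrow> 'a::real_vector set) \<Rightarrow> (nat \<Rightarrow> 'a \<Rightarrow> 'a \<Rightarrow> real) \<Rightarrow>
   (real \<Rightarrow> 'a \<Rightarrow> 'a) \<Rightarrow> bool" where
  "compatible hs Hs ip \<phi> \<longleftrightarrow>
     (\<forall>k l. Ck_inf k hs (Hs (k + l)) (ip (k + l)) (Hs l) (ip l) \<phi>)"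

text \<open>
  \<open>D i u v\<close> is the \<open>i\<close>-th derivative at \<open>u\<close> in the directions \<open>v 0, \<dots>, v (i - 1)\<close>. The
  remaining entries of \<open>v\<close> play no role, as follows from the first and third clauses.
\<close>

definition smooth_map :: "('a::real_normed_vector \<Rightarrow> 'b::real_normed_vector) \<Rightarrow> bool" where
  "smooth_map F \<longleftrightarrow>
     (\<exists>D :: nat \<Rightarrow> 'a \<Rightarrow> (nat \<Rightarrow> 'a) \<Rightarrow> 'b.
        (\<forall>u v. D 0 u v = F u) \<and>
        (\<forall>i. continuous_on UNIV (\<lambda>(u, v). D i u v)) \<and>
        (\<forall>i u v. ((\<lambda>w. D i w v) has_derivative (\<lambda>w. D (Suc i) u (v(i := w)))) (at u)))"

section \<open>Semigroups and flows\<close>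

definition c0_semigroup :: "(real \<Rightarrow> 'a::real_normed_vector \<Rightarrow> 'a) \<Rightarrow> bool" where
  "c0_semigroup S \<longleftrightarrow>
     (\<forall>t\<ge>0. bounded_linear (S t)) \<and>
     S 0 = id \<and>
     (\<forall>s\<ge>0. \<forall>t\<ge>0. S (s + t) = S s \<circ> S t) \<and>
     (\<forall>u. ((\<lambda>t. S t u) \<longlongrightarrow> u) (at_right 0))"

definition is_generator ::
  "'a::real_normed_vector set \<Rightarrow> ('a \<Rightarrow> 'a) \<Rightarrow> (real \<Rightarrow> 'a \<Rightarrow> 'a) \<Rightarrow> bool" where
  "is_generator D A S \<longleftrightarrow>
     D = {u. \<exists>v. ((\<lambda>t. (S t u - u) /\<^sub>R t) \<longlongrightarrow> v) (at_right 0)} \<and>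
     (\<forall>u\<in>D. ((\<lambda>t. (S t u - u) /\<^sub>R t) \<longlongrightarrow> A u) (at_right 0))"

definition closed_densely_defined ::
  "'a::real_normed_vector set \<Rightarrow> ('a \<Rightarrow> 'a) \<Rightarrow> bool" where
  "closed_densely_defined D A \<longleftrightarrow>
     subspace D \<and>
     (\<forall>u\<in>D. \<forall>v\<in>D. A (u + v) = A u + A v) \<and>
     (\<forall>u\<in>D. \<forall>c. A (c *\<^sub>R u) = c *\<^sub>R A u) \<and>
     closed {(u, A u) |u. u \<in> D} \<and>
     closure D = UNIV"

text \<open>
  \<open>\<phi>\<close> is the flow on \<open>[0, hs)\<close> of \<open>\<partial>\<^sub>t u = A u + F u\<close> in the mild sense, where \<open>S t\<close> is the
  semigroup generated by \<open>A\<close>: the Duhamel formula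
  \<open>\<phi>(t,u) = S(t) u + \<integral>\<^sub>0\<^sup>t S(t - s) F(\<phi>(s,u)) ds\<close> holds.
\<close>

definition mild_flow ::
  "real \<Rightarrow> (real \<Rightarrow> 'a::banach \<Rightarrow> 'a) \<Rightarrow> ('a \<Rightarrow> 'a) \<Rightarrow> (real \<Rightarrow> 'a \<Rightarrow> 'a) \<Rightarrow> bool" where
  "mild_flow hs S F \<phi> \<longleftrightarrow>
     (\<forall>u. continuous_on {0..<hs} (\<lambda>t. \<phi> t u)) \<and>
     (\<forall>u. \<forall>t\<in>{0..<hs}.
        ((\<lambda>s. S (t - s) (F (\<phi> s u))) has_integral (\<phi> t u - S t u)) {0..t}) \<and>
     \<phi> 0 = id \<and>
     (\<forall>t\<ge>0. \<forall>t'\<ge>0. t + t' < hs \<longrightarrow> \<phi> (t + t') = \<phi> t \<circ> \<phi> t')"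

section \<open>Splitting methods and derivatives in \<open>h\<close>\<close>

definition split_plus :: "(real \<Rightarrow> 'a \<Rightarrow> 'a) \<Rightarrow> (real \<Rightarrow> 'a \<Rightarrow> 'a) \<Rightarrow> real \<Rightarrow> 'a \<Rightarrow> 'a" where
  "split_plus \<phi>0 \<phi>1 h = \<phi>1 h \<circ> \<phi>0 h"

definition split_minus :: "(real \<Rightarrow> 'a \<Rightarrow> 'a) \<Rightarrow> (real \<Rightarrow> 'a \<Rightarrow> 'a) \<Rightarrow> real \<Rightarrow> 'a \<Rightarrow> 'a" where
  "split_minus \<phi>0 \<phi>1 h = \<phi>0 h \<circ> \<phi>1 h"

definition affine_method ::
  "nat \<Rightarrow> (nat \<Rightarrow> real) \<Rightarrow> (real \<Rightarrow> 'a \<Rightarrow> 'a) \<Rightarrow> real \<Rightarrow> 'a::real_vector \<Rightarrow> 'a" where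
  "affine_method s \<gamma> \<Psi> h u = (\<Sum>m = 1..s. \<gamma> m *\<^sub>R (\<Psi> (h / real m) ^^ m) u)"

text \<open>
  Derivatives of order \<open>k\<close> on \<open>[0, hs)\<close>, one-sided at 0. The values of \<open>h_deriv\<close> are meaningful
  up to order \<open>n\<close> when \<open>h_differentiable hs n f\<close> holds.
\<close>

primrec h_deriv ::
  "real \<Rightarrow> nat \<Rightarrow> (real \<Rightarrow> 'a::real_normed_vector) \<Rightarrow> real \<Rightarrow> 'a" where
  "h_deriv hs 0 f = f"
| "h_deriv hs (Suc k) f = (\<lambda>h. vector_derivative (h_deriv hs k f) (at h within {0..<hs}))"

definition h_differentiable :: "real \<Rightarrow> nat \<Rightarrow> (real \<Rightarrow> 'a::real_normed_vector) \<Rightarrow> bool" where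
  "h_differentiable hs n f \<longleftrightarrow>
     (\<forall>k<n. \<forall>h\<in>{0..<hs}. h_deriv hs k f differentiable (at h within {0..<hs}))"

end

theory Submission
  imports Defs
begin

text \<open>
  For fixed \<open>u\<close>, the \<open>k\<close>-th \<open>h\<close>-derivative at 0 of \<open>\<Psi>(h)\<^sup>m u\<close> is a polynomial in \<open>m\<close> of degree at most
  \<open>k\<close>. Indeed \<open>\<Psi>(h)\<^sup>m\<^sup>+\<^sup>1 u\<close> is the diagonal of \<open>\<Psi>(y)\<^sup>m (\<Psi>(x) u)\<close>, so the Leibniz rule expresses the
  first difference in \<open>m\<close> by \<open>x\<close>-derivatives of lower order coefficients along \<open>\<Psi>(x) u\<close>. Following
  the top difference, the \<open>k\<close>-th one is \<open>k!\<close> times \<open>\<partial>\<^sub>h\<^sup>k \<phi>(0, u)\<close>: this only uses that \<open>\<Psi>(x) u\<close> and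
  \<open>\<phi>(x, u)\<close> have the same first derivative at 0, which follows from the Duhamel formula. After rescaling
  \<open>h\<close> to \<open>h / m\<close> the coefficient is \<open>\<partial>\<^sub>h\<^sup>k \<phi>(0, u)\<close> plus a combination of \<open>m\<^sup>-\<^sup>1, \<dots>, m\<^sup>1\<^sup>-\<^sup>k\<close>, and the
  conditions on \<open>\<gamma>\<close> remove the latter.

  The regularity needed for the Leibniz rule is that of two-parameter families with values in the scale
  that lose one space per derivative; it is preserved by composition with compatible families.
\<close>

section \<open>Limits and derivatives in the spaces of the scale\<close>

text \<open>Two obstacles shape the proof. Compatibility gives \<open>u\<close>-derivatives only of
  \<phi> itself and then \<open>h\<close>-derivatives of those, whereas the chain rule
  differentiates every mixed derivative in both variables; the exchange is a Schwarz theorem for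
  curves in a Hilbert space. And the mixed derivatives come from a separate existential for each
  pair of levels, so they must first be identified with one another.

  The top difference is reached without expanding anything in \<open>A0\<close> and
  \<open>A1\<close>. In the \<open>k\<close>-th difference only those Leibniz terms survive that
  take a single \<open>x\<close>-derivative at each stage. What remains is \<open>k!\<close> times
  the \<open>k\<close>-fold iterate, starting from the identity, of: precompose with \<Psi>(x) and
  differentiate at \<open>x = 0\<close>. That derivative sees only the tangent of the inner curve,
  so \<phi>(x) may replace \<Psi>(x), and by the flow property the iterates become the time
  derivatives of \<phi> at 0.\<close>

definition ip_lim ::
  "'a::real_vector set \<Rightarrow> ('a \<Rightarrow> 'a \<Rightarrow> real) \<Rightarrow> ('b \<Rightarrow> 'a) \<Rightarrow> 'a \<Rightarrow> 'b filter \<Rightarrow> bool" where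
  "ip_lim S g f a F \<longleftrightarrow>
     a \<in> S \<and> (\<forall>\<^sub>F x in F. f x \<in> S) \<and> ((\<lambda>x. ip_norm g (f x - a)) \<longlongrightarrow> 0) F"

text \<open>Only the difference quotients are required to lie in \<open>S\<close>: a constant
  outside \<open>S\<close> has derivative 0. Membership of the curve itself is therefore a separate
  hypothesis wherever it matters.\<close>

definition ip_deriv ::
  "'a::real_vector set \<Rightarrow> ('a \<Rightarrow> 'a \<Rightarrow> real) \<Rightarrow> (real \<Rightarrow> 'a) \<Rightarrow> 'a \<Rightarrow> real \<Rightarrow> real set \<Rightarrow> bool" where
  "ip_deriv S g f f' x X \<longleftrightarrow> ip_lim S g (\<lambda>y. (f y - f x) /\<^sub>R (y - x)) f' (at x within X)"

section \<open>Norm and inner product on a subspace\<close>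

locale hilbert_carrier =
  fixes S :: "'a::real_vector set" and g :: "'a \<Rightarrow> 'a \<Rightarrow> real"
  assumes hilbert: "hilbert_on S g"
begin

lemma subspace: "subspace S"
  using hilbert unfolding hilbert_on_def by blast

lemma ip_commute: "u \<in> S \<Longrightarrow> v \<in> S \<Longrightarrow> g u v = g v u"
  using hilbert unfolding hilbert_on_def by blast

lemma ip_add_left: "u \<in> S \<Longrightarrow> v \<in> S \<Longrightarrow> w \<in> S \<Longrightarrow> g (u + v) w = g u w + g v w"
  using hilbert unfolding hilbert_on_def by blast

lemma ip_scale_left: "u \<in> S \<Longrightarrow> v \<in> S \<Longrightarrow> g (c *\<^sub>R u) v = c * g u v"
  using hilbert unfolding hilbert_on_def by blast

lemma ip_pos: "u \<in> S \<Longrightarrow> u \<noteq> 0 \<Longrightarrow> 0 < g u u"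
  using hilbert unfolding hilbert_on_def by blast

lemmas mem_0 [simp] = subspace_0[OF subspace]
  and mem_add [intro] = subspace_add[OF subspace]
  and mem_diff [intro] = subspace_diff[OF subspace]
  and mem_scale [intro] = subspace_scale[OF subspace]

lemma ip_zero_left [simp]: "v \<in> S \<Longrightarrow> g 0 v = 0"
  using ip_scale_left[of 0 v 0] by simp

lemma ip_diff_left: "u \<in> S \<Longrightarrow> v \<in> S \<Longrightarrow> w \<in> S \<Longrightarrow> g (u - v) w = g u w - g v w"
  using ip_add_left[of "u - v" v w] by (auto simp: mem_diff)

lemma ip_add_right: "u \<in> S \<Longrightarrow> v \<in> S \<Longrightarrow> w \<in> S \<Longrightarrow> g w (u + v) = g w u + g w v"
  by (metis ip_add_left ip_commute mem_add)

lemma ip_nonneg: "u \<in> S \<Longrightarrow> 0 \<le> g u u"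
  using ip_pos[of u] by (cases "u = 0") auto

abbreviation nrm :: "'a \<Rightarrow> real" where "nrm \<equiv> ip_norm g"

lemma nrm_nonneg: "u \<in> S \<Longrightarrow> 0 \<le> nrm u"
  by (simp add: ip_norm_def ip_nonneg)

lemma nrm_sq: "u \<in> S \<Longrightarrow> (nrm u)\<^sup>2 = g u u"
  by (simp add: ip_norm_def ip_nonneg)

lemma nrm_zero [simp]: "nrm 0 = 0"
  by (simp add: ip_norm_def)

lemma nrm_eq_0: "u \<in> S \<Longrightarrow> nrm u = 0 \<longleftrightarrow> u = 0"
  using ip_pos[of u] by (cases "u = 0") (auto simp: ip_norm_def)

lemma nrm_scale: "u \<in> S \<Longrightarrow> nrm (c *\<^sub>R u) = \<bar>c\<bar> * nrm u"
proof -
  assume u: "u \<in> S"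
  have "g (c *\<^sub>R u) (c *\<^sub>R u) = c\<^sup>2 * g u u"
    using u by (simp add: ip_scale_left ip_commute[of u "c *\<^sub>R u"] mem_scale power2_eq_square)
  then show ?thesis by (simp add: ip_norm_def real_sqrt_mult)
qed

lemma nrm_minus_commute: "u \<in> S \<Longrightarrow> v \<in> S \<Longrightarrow> nrm (u - v) = nrm (v - u)"
  using nrm_scale[of "u - v" "-1"] by (auto simp: mem_diff)

lemma Cauchy_Schwarz:
  assumes u: "u \<in> S" and v: "v \<in> S"
  shows "\<bar>g u v\<bar> \<le> nrm u * nrm v"
proof (cases "v = 0")
  case True
  then show ?thesis using u v ip_commute[of u 0] by simp
next
  case False
  then have pos: "0 < g v v" using v ip_pos by blast
  \<comment> \<open>\<open>w\<close> is the component of \<open>u\<close> orthogonal to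
    \<open>v\<close>; the inequality is \<open>0 \<le> g w w\<close> multiplied by
    \<open>g v v\<close>.\<close>
  define w where "w = u - (g u v / g v v) *\<^sub>R v"
  have sv: "(g u v / g v v) *\<^sub>R v \<in> S" using v by blast
  have w: "w \<in> S" unfolding w_def using u sv by blast
  have wv: "g w v = 0" unfolding w_def using u v sv pos by (simp add: ip_diff_left ip_scale_left)
  have "g w w = g u w - (g u v / g v v) * g v w"
    unfolding w_def using u v sv w
    by (subst (1) ip_diff_left) (auto simp: ip_scale_left w_def mem_diff)
  also have "\<dots> = g u w" using wv ip_commute[OF v w] by simp
  also have "\<dots> = g w u" using ip_commute[OF u w] .
  also have "\<dots> = g u u - (g u v / g v v) * g v u"
    unfolding w_def using u v sv by (simp add: ip_diff_left ip_scale_left)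
  finally have "0 \<le> g u u - (g u v / g v v) * g u v"
    using ip_nonneg[OF w] ip_commute[OF u v] by simp
  then have "g u v * g u v \<le> g u u * g v v" using pos by (simp add: field_simps)
  then have "(g u v)\<^sup>2 \<le> (nrm u * nrm v)\<^sup>2"
    using u v by (simp add: power_mult_distrib nrm_sq power2_eq_square[of "g u v"])
  then show ?thesis
    using u v by (simp add: abs_le_square_iff[symmetric] nrm_nonneg abs_of_nonneg)
qed

lemma nrm_triangle:
  assumes u: "u \<in> S" and v: "v \<in> S"
  shows "nrm (u + v) \<le> nrm u + nrm v"
proof -
  have uv: "u + v \<in> S" using u v by blast
  have "(nrm (u + v))\<^sup>2 = g u (u + v) + g v (u + v)"
    using u v uv by (simp add: nrm_sq ip_add_left)
  also have "\<dots> = g u u + 2 * g u v + g v v"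
    using ip_commute[OF v u] u v by (simp add: ip_add_right)
  also have "\<dots> \<le> (nrm u)\<^sup>2 + 2 * (nrm u * nrm v) + (nrm v)\<^sup>2"
    using Cauchy_Schwarz[OF u v] u v by (simp add: nrm_sq)
  also have "\<dots> = (nrm u + nrm v)\<^sup>2" by (simp add: power2_sum)
  finally show ?thesis
    by (rule power2_le_imp_le) (use u v in \<open>simp add: nrm_nonneg\<close>)
qed

lemma Metric_space_ip_dist: "Metric_space S (ip_dist S g)"
proof
  show "0 \<le> ip_dist S g x y" for x y
    by (auto simp: ip_dist_def nrm_nonneg mem_diff)
  show "ip_dist S g x y = ip_dist S g y x" for x y
    by (auto simp: ip_dist_def nrm_minus_commute)
  show "ip_dist S g x y = 0 \<longleftrightarrow> x = y" if "x \<in> S" "y \<in> S" for x y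
    using that nrm_eq_0[of "x - y"] by (auto simp: ip_dist_def mem_diff)
  show "ip_dist S g x z \<le> ip_dist S g x y + ip_dist S g y z" if "x \<in> S" "y \<in> S" "z \<in> S" for x y z
    using that nrm_triangle[of "x - y" "y - z"] by (auto simp: ip_dist_def mem_diff)
qed

sublocale M: Metric_space S "ip_dist S g"
  by (rule Metric_space_ip_dist)

section \<open>Limits along filters\<close>

abbreviation tends :: "('b \<Rightarrow> 'a) \<Rightarrow> 'a \<Rightarrow> 'b filter \<Rightarrow> bool" where
  "tends \<equiv> ip_lim S g"

text \<open>Passage from the topological wording of \<open>Ck_inf\<close> to filters. Along the
  filter both points eventually lie in \<open>S\<close>, where the default value in
  \<open>ip_dist\<close> does not interfere.\<close>

lemma limitin_ip_top: "limitin (ip_top S g) f a F \<longleftrightarrow> tends f a F"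
proof -
  have "((\<lambda>x. ip_dist S g (f x) a) \<longlongrightarrow> 0) F \<longleftrightarrow> ((\<lambda>x. nrm (f x - a)) \<longlongrightarrow> 0) F"
    if "a \<in> S" "\<forall>\<^sub>F x in F. f x \<in> S"
    by (rule tendsto_cong) (use that in \<open>auto simp: ip_dist_def elim: eventually_mono\<close>)
  then show ?thesis
    unfolding ip_top_def M.limitin_metric_dist_null ip_lim_def by blast
qed

lemma topspace_ip_top [simp]: "topspace (ip_top S g) = S"
  by (simp add: ip_top_def)

lemma tends_const: "a \<in> S \<Longrightarrow> tends (\<lambda>_. a) a F"
  by (simp add: ip_lim_def)

lemma tends_dominated:
  assumes "a \<in> S" "\<forall>\<^sub>F x in F. f x \<in> S"
    and "\<forall>\<^sub>F x in F. nrm (f x - a) \<le> e x" "(e \<longlongrightarrow> 0) F"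
  shows "tends f a F"
proof -
  have "((\<lambda>x. nrm (f x - a)) \<longlongrightarrow> 0) F"
  proof (rule tendsto_sandwich[OF _ assms(3) tendsto_const assms(4)])
    show "\<forall>\<^sub>F x in F. 0 \<le> nrm (f x - a)"
      using assms(2) by eventually_elim (use assms(1) nrm_nonneg in blast)
  qed
  then show ?thesis using assms by (simp add: ip_lim_def)
qed

lemma tends_add:
  assumes "tends f a F" "tends f' b F"
  shows "tends (\<lambda>x. f x + f' x) (a + b) F"
proof (rule tends_dominated[where e = "\<lambda>x. nrm (f x - a) + nrm (f' x - b)"])
  have S: "a \<in> S" "b \<in> S" "\<forall>\<^sub>F x in F. f x \<in> S" "\<forall>\<^sub>F x in F. f' x \<in> S"
    using assms by (auto simp: ip_lim_def)
  show "a + b \<in> S" using S by blast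
  show "\<forall>\<^sub>F x in F. f x + f' x \<in> S"
    using S(3,4) by eventually_elim blast
  show "\<forall>\<^sub>F x in F. nrm (f x + f' x - (a + b)) \<le> nrm (f x - a) + nrm (f' x - b)"
    using S(3,4)
  proof eventually_elim
    case (elim x)
    then show ?case
      using nrm_triangle[of "f x - a" "f' x - b"] S(1,2) by (auto simp: algebra_simps mem_diff)
  qed
  show "((\<lambda>x. nrm (f x - a) + nrm (f' x - b)) \<longlongrightarrow> 0) F"
    using assms tendsto_add[of "\<lambda>x. nrm (f x - a)" 0 F "\<lambda>x. nrm (f' x - b)" 0]
    by (simp add: ip_lim_def)
qed

lemma tends_scaleR:
  assumes c: "(c \<longlongrightarrow> k) F" and f: "tends f a F"
  shows "tends (\<lambda>x. c x *\<^sub>R f x) (k *\<^sub>R a) F"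
proof (rule tends_dominated[where e = "\<lambda>x. \<bar>c x\<bar> * nrm (f x - a) + \<bar>c x - k\<bar> * nrm a"])
  have S: "a \<in> S" "\<forall>\<^sub>F x in F. f x \<in> S" and l: "((\<lambda>x. nrm (f x - a)) \<longlongrightarrow> 0) F"
    using f by (auto simp: ip_lim_def)
  show "k *\<^sub>R a \<in> S" using S by blast
  show "\<forall>\<^sub>F x in F. c x *\<^sub>R f x \<in> S"
    using S(2) by eventually_elim blast
  show "\<forall>\<^sub>F x in F. nrm (c x *\<^sub>R f x - k *\<^sub>R a) \<le> \<bar>c x\<bar> * nrm (f x - a) + \<bar>c x - k\<bar> * nrm a"
    using S(2)
  proof eventually_elim
    case (elim x)
    have "nrm (c x *\<^sub>R f x - k *\<^sub>R a) = nrm (c x *\<^sub>R (f x - a) + (c x - k) *\<^sub>R a)"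
      by (simp add: algebra_simps)
    also have "\<dots> \<le> nrm (c x *\<^sub>R (f x - a)) + nrm ((c x - k) *\<^sub>R a)"
      using elim S(1) by (intro nrm_triangle) blast+
    also have "\<dots> = \<bar>c x\<bar> * nrm (f x - a) + \<bar>c x - k\<bar> * nrm a"
      using elim S(1) by (simp add: nrm_scale mem_diff)
    finally show ?case .
  qed
  have "\<bar>k\<bar> * 0 + \<bar>k - k\<bar> * nrm a = 0" by simp
  then show "((\<lambda>x. \<bar>c x\<bar> * nrm (f x - a) + \<bar>c x - k\<bar> * nrm a) \<longlongrightarrow> 0) F"
    using tendsto_add[OF tendsto_mult[OF tendsto_rabs[OF c] l]
        tendsto_mult[OF tendsto_rabs[OF tendsto_diff[OF c tendsto_const[of k]]] tendsto_const[of "nrm a"]]]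
    by (simp only:)
qed

lemma tends_diff:
  assumes "tends f a F" "tends f' b F"
  shows "tends (\<lambda>x. f x - f' x) (a - b) F"
proof -
  have "tends (\<lambda>x. f x + (-1) *\<^sub>R f' x) (a + (-1) *\<^sub>R b) F"
    by (rule tends_add[OF assms(1) tends_scaleR[OF tendsto_const assms(2)]])
  then show ?thesis by (simp only: scaleR_minus_left scaleR_one add_uminus_conv_diff)
qed

lemma tends_sum:
  assumes "\<And>i. i \<in> I \<Longrightarrow> tends (f i) (a i) F"
  shows "tends (\<lambda>x. \<Sum>i\<in>I. f i x) (\<Sum>i\<in>I. a i) F"
  using assms
proof (induction I rule: infinite_finite_induct)
  case (insert i I)
  have "tends (\<lambda>x. f i x + (\<Sum>i\<in>I. f i x)) (a i + (\<Sum>i\<in>I. a i)) F"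
    by (rule tends_add) (use insert in blast)+
  then show ?case by (simp only: sum.insert[OF insert(1,2)])
qed (simp_all add: tends_const)

lemma tends_cong:
  assumes "\<forall>\<^sub>F x in F. f x = f' x"
  shows "tends f a F \<longleftrightarrow> tends f' a F"
proof -
  have "tends h a F" if "tends k a F" "\<forall>\<^sub>F x in F. k x = h x" for h k
  proof -
    have "\<forall>\<^sub>F x in F. h x \<in> S"
      using that unfolding ip_lim_def by (auto elim: eventually_elim2)
    moreover have "((\<lambda>x. nrm (h x - a)) \<longlongrightarrow> 0) F"
      by (rule Lim_transform_eventually[where f = "\<lambda>x. nrm (k x - a)"])
        (use that in \<open>auto simp: ip_lim_def elim: eventually_mono\<close>)
    ultimately show ?thesis using that by (simp add: ip_lim_def)
  qed
  from this[of f f'] this[of f' f] show ?thesis using assms by (auto simp: eq_commute)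
qed

lemma tends_nrm:
  assumes "tends f a F"
  shows "((\<lambda>x. nrm (f x)) \<longlongrightarrow> nrm a) F"
proof (rule LIM_zero_cancel, rule tendsto_rabs_zero_cancel)
  have S: "a \<in> S" "\<forall>\<^sub>F x in F. f x \<in> S" and l: "((\<lambda>x. nrm (f x - a)) \<longlongrightarrow> 0) F"
    using assms by (auto simp: ip_lim_def)
  show "((\<lambda>x. \<bar>nrm (f x) - nrm a\<bar>) \<longlongrightarrow> 0) F"
  proof (rule tendsto_sandwich[OF _ _ tendsto_const l])
    show "\<forall>\<^sub>F x in F. \<bar>nrm (f x) - nrm a\<bar> \<le> nrm (f x - a)"
      using S(2)
    proof eventually_elim
      case (elim x)
      then show ?case
        using nrm_triangle[of "f x - a" a] nrm_triangle[of "a - f x" "f x"] S(1)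
          nrm_minus_commute[of a "f x"]
        by (auto simp: mem_diff)
    qed
  qed simp
qed

lemma tends_compose:
  "tends f a F \<Longrightarrow> filterlim k F G \<Longrightarrow> tends (\<lambda>x. f (k x)) a G"
  unfolding ip_lim_def
  by (auto intro: eventually_compose_filterlim filterlim_compose)

lemma tends_mono: "tends f a F \<Longrightarrow> F' \<le> F \<Longrightarrow> tends f a F'"
  using tends_compose[of f a F "\<lambda>x. x" F'] by (simp add: filterlim_def)

lemma tends_ip:
  assumes f: "tends f a F" and e: "e \<in> S"
  shows "((\<lambda>x. g (f x) e) \<longlongrightarrow> g a e) F"
proof (rule LIM_zero_cancel, rule tendsto_rabs_zero_cancel)
  have S: "a \<in> S" "\<forall>\<^sub>F x in F. f x \<in> S" and l: "((\<lambda>x. nrm (f x - a)) \<longlongrightarrow> 0) F"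
    using f by (auto simp: ip_lim_def)
  have l': "((\<lambda>x. nrm (f x - a) * nrm e) \<longlongrightarrow> 0) F"
    using tendsto_mult_left_zero[OF l] .
  show "((\<lambda>x. \<bar>g (f x) e - g a e\<bar>) \<longlongrightarrow> 0) F"
  proof (rule tendsto_sandwich[OF _ _ tendsto_const l'])
    show "\<forall>\<^sub>F x in F. \<bar>g (f x) e - g a e\<bar> \<le> nrm (f x - a) * nrm e"
      using S(2)
    proof eventually_elim
      case (elim x)
      then show ?case
        using Cauchy_Schwarz[of "f x - a" e] S(1) e by (simp add: ip_diff_left mem_diff)
    qed
  qed simp
qed

section \<open>Derivatives of curves, mean value inequality, exchange of derivatives\<close>

abbreviation deriv :: "(real \<Rightarrow> 'a) \<Rightarrow> 'a \<Rightarrow> real \<Rightarrow> real set \<Rightarrow> bool" where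
  "deriv \<equiv> ip_deriv S g"

lemma deriv_const: "a \<in> S \<Longrightarrow> deriv (\<lambda>_. a) 0 x X"
  by (simp add: ip_deriv_def tends_const)

lemma deriv_add:
  "deriv f a x X \<Longrightarrow> deriv f' b x X \<Longrightarrow> deriv (\<lambda>x. f x + f' x) (a + b) x X"
  unfolding ip_deriv_def by (drule (1) tends_add) (simp add: algebra_simps)

lemma deriv_scaleR: "deriv f a x X \<Longrightarrow> deriv (\<lambda>x. k *\<^sub>R f x) (k *\<^sub>R a) x X"
  unfolding ip_deriv_def by (drule tends_scaleR[OF tendsto_const[of k]]) (simp add: algebra_simps)

lemma deriv_diff:
  "deriv f a x X \<Longrightarrow> deriv f' b x X \<Longrightarrow> deriv (\<lambda>x. f x - f' x) (a - b) x X"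
  unfolding ip_deriv_def by (drule (1) tends_diff) (simp add: algebra_simps)

lemma deriv_subset: "deriv f a x X \<Longrightarrow> Y \<subseteq> X \<Longrightarrow> deriv f a x Y"
  unfolding ip_deriv_def by (erule tends_mono) (rule at_le)

lemma deriv_cong:
  assumes "\<And>y. y \<in> X \<Longrightarrow> f y = f' y" "x \<in> X"
  shows "deriv f a x X \<longleftrightarrow> deriv f' a x X"
  unfolding ip_deriv_def
  by (rule tends_cong) (use assms in \<open>auto simp: eventually_at_filter\<close>)

lemma deriv_mem: "deriv f a x X \<Longrightarrow> a \<in> S"
  by (simp add: ip_deriv_def ip_lim_def)

lemma deriv_ip:
  assumes d: "deriv f a x X" and f: "\<And>y. y \<in> X \<Longrightarrow> f y \<in> S" and x: "x \<in> X" and e: "e \<in> S"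
  shows "((\<lambda>y. g (f y) e) has_field_derivative g a e) (at x within X)"
  unfolding has_field_derivative_iff
proof (rule Lim_transform_eventually)
  show "((\<lambda>y. g ((f y - f x) /\<^sub>R (y - x)) e) \<longlongrightarrow> g a e) (at x within X)"
    using tends_ip d e unfolding ip_deriv_def by blast
  show "\<forall>\<^sub>F y in at x within X. g ((f y - f x) /\<^sub>R (y - x)) e = (g (f y) e - g (f x) e) / (y - x)"
    unfolding eventually_at_filter
    by (rule always_eventually)
      (use f x e in \<open>auto simp: ip_scale_left ip_diff_left mem_diff divide_inverse mult.commute\<close>)
qed

text \<open>Testing against \<open>e = f b - f a - (b - a) L\<close> reduces this to the real mean value theorem.\<close>

lemma mean_value_le:
  assumes ab: "a < b"
    and d: "\<And>x. x \<in> {a..b} \<Longrightarrow> deriv f (f' x) x {a..b}"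
    and f: "\<And>x. x \<in> {a..b} \<Longrightarrow> f x \<in> S" and L: "L \<in> S"
  shows "\<exists>\<xi>\<in>{a..b}. nrm (f b - f a - (b - a) *\<^sub>R L) \<le> (b - a) * nrm (f' \<xi> - L)"
proof -
  define e where "e = f b - f a - (b - a) *\<^sub>R L"
  have S: "f a \<in> S" "f b \<in> S" "(b - a) *\<^sub>R L \<in> S" using f ab L by auto
  then have e: "e \<in> S" unfolding e_def by blast
  have "\<exists>x\<in>{a<..<b}. g (f b) e - g (f a) e = (b - a) * g (f' x) e"
  proof -
    have "\<exists>x\<in>{a<..<b}. g (f b) e - g (f a) e = (\<lambda>y. g (f' x) e * y) (b - a)"
      by (rule mvt_simple[OF ab])
        (use deriv_ip[OF d f _ e] in \<open>auto simp: has_field_derivative_def\<close>)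
    then show ?thesis by (simp add: mult.commute)
  qed
  then obtain x where x: "x \<in> {a..b}" and eq: "g (f b) e - g (f a) e = (b - a) * g (f' x) e"
    using greaterThanLessThan_subseteq_atLeastAtMost_iff[of a b a b] by blast
  have f'x: "f' x \<in> S" using d[OF x] by (simp add: ip_deriv_def ip_lim_def)
  have "(nrm e)\<^sup>2 = g (f b - f a - (b - a) *\<^sub>R L) e" using e by (simp add: nrm_sq e_def)
  also have "\<dots> = g (f b) e - g (f a) e - (b - a) * g L e"
    using S e L by (simp add: ip_diff_left ip_scale_left mem_diff)
  also have "\<dots> = (b - a) * g (f' x - L) e"
    using eq f'x L e by (simp add: ip_diff_left algebra_simps)
  also have "\<dots> \<le> (b - a) * (nrm (f' x - L) * nrm e)"
    using Cauchy_Schwarz[of "f' x - L" e] f'x L e ab by (intro mult_left_mono) (auto simp: mem_diff)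
  finally have "nrm e * nrm e \<le> ((b - a) * nrm (f' x - L)) * nrm e"
    by (simp add: power2_eq_square mult.assoc)
  then have "nrm e \<le> (b - a) * nrm (f' x - L)"
  proof (cases "nrm e = 0")
    case True
    then show ?thesis using ab nrm_nonneg[of "f' x - L"] f'x L by (auto simp: mem_diff)
  next
    case False
    then have "0 < nrm e" using nrm_nonneg[OF e] by simp
    then show ?thesis using \<open>nrm e * nrm e \<le> _\<close> mult_le_cancel_right by fastforce
  qed
  then show ?thesis using x unfolding e_def by blast
qed

text \<open>\<open>L\<close> is a comparison vector: chosen as the limit of \<open>f'\<close> it
  makes the right side small, so the inequality yields difference quotients converging to
  \<open>L\<close>. The bound on the distance of \<xi> from \<open>a\<close> lets \<xi> tend to
  \<open>a\<close> when \<open>b\<close> does, and \<open>b\<close> may lie on either side of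
  \<open>a\<close>.\<close>

lemma mean_value:
  assumes d: "\<And>x. x \<in> X \<Longrightarrow> deriv f (f' x) x X"
    and f: "\<And>x. x \<in> X \<Longrightarrow> f x \<in> S" and L: "L \<in> S"
    and X: "convex X" "a \<in> X" "b \<in> X"
  shows "\<exists>\<xi>\<in>X. \<bar>\<xi> - a\<bar> \<le> \<bar>b - a\<bar> \<and> nrm (f b - f a - (b - a) *\<^sub>R L) \<le> \<bar>b - a\<bar> * nrm (f' \<xi> - L)"
proof -
  have sub: "{x..y} \<subseteq> X" if "x \<in> X" "y \<in> X" for x y
    using that X(1) convex_contains_segment[of X] closed_segment_eq_real_ivl[of x y]
    by (metis atLeastatMost_empty_iff2 empty_subsetI)
  consider "a < b" | "a = b" | "b < a" by linarith
  then show ?thesis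
  proof cases
    case 1
    have "\<exists>\<xi>\<in>{a..b}. nrm (f b - f a - (b - a) *\<^sub>R L) \<le> (b - a) * nrm (f' \<xi> - L)"
      by (intro mean_value_le 1 L deriv_subset[OF d] f) (use sub[OF X(2,3)] in blast)+
    then obtain \<xi> where "\<xi> \<in> {a..b}" "nrm (f b - f a - (b - a) *\<^sub>R L) \<le> (b - a) * nrm (f' \<xi> - L)"
      by blast
    then show ?thesis using sub[OF X(2,3)] 1 by (intro bexI[of _ \<xi>]) auto
  next
    case 2
    then show ?thesis using X(2) by auto
  next
    case 3
    have "\<exists>\<xi>\<in>{b..a}. nrm (f a - f b - (a - b) *\<^sub>R L) \<le> (a - b) * nrm (f' \<xi> - L)"
      by (intro mean_value_le 3 L deriv_subset[OF d] f) (use sub[OF X(3,2)] in blast)+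
    moreover have "nrm (f a - f b - (a - b) *\<^sub>R L) = nrm (f b - f a - (b - a) *\<^sub>R L)"
    proof -
      have "f a - f b - (a - b) *\<^sub>R L = (-1) *\<^sub>R (f b - f a - (b - a) *\<^sub>R L)"
        by (simp add: algebra_simps)
      also have "nrm \<dots> = \<bar>-1\<bar> * nrm (f b - f a - (b - a) *\<^sub>R L)"
        by (rule nrm_scale) (use f X(2,3) L in blast)
      finally show ?thesis by simp
    qed
    ultimately obtain \<xi> where "\<xi> \<in> {b..a}" "nrm (f b - f a - (b - a) *\<^sub>R L) \<le> (a - b) * nrm (f' \<xi> - L)"
      by auto
    then show ?thesis using sub[OF X(3,2)] 3 by (intro bexI[of _ \<xi>]) auto
  qed
qed

text \<open>Schwarz theorem. The second difference of \<open>f\<close> is compared with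
  \<open>(s - s0) (h - h0) fsh h0 s0\<close> by the mean value inequality, first in \<open>s\<close>
  and then in \<open>h\<close>. Dividing by \<open>h - h0\<close> and letting \<open>h\<close> tend
  to \<open>h0\<close> at fixed \<open>s\<close> turns it into an increment of \<open>fh\<close>.
  Since the limit in \<open>h\<close> comes first, the estimate must be uniform in \<open>h\<close>;
  continuity of \<open>fsh\<close> at the one point provides that.\<close>

lemma mixed_deriv:
  assumes X: "convex X" "h0 \<in> X" "at h0 within X \<noteq> bot" and Y: "convex Y" "s0 \<in> Y"
    and f: "\<And>h s. h \<in> X \<Longrightarrow> s \<in> Y \<Longrightarrow> f h s \<in> S"
    and fh: "\<And>s. s \<in> Y \<Longrightarrow> deriv (\<lambda>h. f h s) (fh s) h0 X"
    and fs: "\<And>h s. h \<in> X \<Longrightarrow> s \<in> Y \<Longrightarrow> deriv (\<lambda>s. f h s) (fs h s) s Y"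
    and fsh: "\<And>h s. h \<in> X \<Longrightarrow> s \<in> Y \<Longrightarrow> deriv (\<lambda>h. fs h s) (fsh h s) h X"
    and cont: "tends (\<lambda>(h, s). fsh h s) (fsh h0 s0) (at (h0, s0) within X \<times> Y)"
  shows "deriv fh (fsh h0 s0) s0 Y"
proof -
  let ?L = "fsh h0 s0"
  have L: "?L \<in> S" using cont by (simp add: ip_lim_def)
  have fsS: "fs h s \<in> S" if "h \<in> X" "s \<in> Y" for h s using fs[OF that] by (simp add: ip_deriv_def ip_lim_def)
  have fhS: "fh s \<in> S" if "s \<in> Y" for s using fh[OF that] by (simp add: ip_deriv_def ip_lim_def)
  have bound: "\<exists>\<eta>\<in>X. \<exists>\<sigma>\<in>Y. \<bar>\<eta> - h0\<bar> \<le> \<bar>h - h0\<bar> \<and> \<bar>\<sigma> - s0\<bar> \<le> \<bar>s - s0\<bar> \<and>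
     nrm (f h s - f h0 s - (f h s0 - f h0 s0) - (s - s0) *\<^sub>R (h - h0) *\<^sub>R ?L)
       \<le> \<bar>s - s0\<bar> * (\<bar>h - h0\<bar> * nrm (fsh \<eta> \<sigma> - ?L))"
    if h: "h \<in> X" and s: "s \<in> Y" for h s
  proof -
    have "\<exists>\<sigma>\<in>Y. \<bar>\<sigma> - s0\<bar> \<le> \<bar>s - s0\<bar> \<and>
      nrm (f h s - f h0 s - (f h s0 - f h0 s0) - (s - s0) *\<^sub>R (h - h0) *\<^sub>R ?L)
        \<le> \<bar>s - s0\<bar> * nrm (fs h \<sigma> - fs h0 \<sigma> - (h - h0) *\<^sub>R ?L)"
      by (rule mean_value) (use h s X Y L f in \<open>auto intro!: deriv_diff fs\<close>)
    then obtain \<sigma> where \<sigma>: "\<sigma> \<in> Y" "\<bar>\<sigma> - s0\<bar> \<le> \<bar>s - s0\<bar>"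
      "nrm (f h s - f h0 s - (f h s0 - f h0 s0) - (s - s0) *\<^sub>R (h - h0) *\<^sub>R ?L)
        \<le> \<bar>s - s0\<bar> * nrm (fs h \<sigma> - fs h0 \<sigma> - (h - h0) *\<^sub>R ?L)" by blast
    have "\<exists>\<eta>\<in>X. \<bar>\<eta> - h0\<bar> \<le> \<bar>h - h0\<bar> \<and>
      nrm (fs h \<sigma> - fs h0 \<sigma> - (h - h0) *\<^sub>R ?L) \<le> \<bar>h - h0\<bar> * nrm (fsh \<eta> \<sigma> - ?L)"
      by (rule mean_value) (use h \<sigma> X L fsS in \<open>auto intro!: fsh\<close>)
    then obtain \<eta> where \<eta>: "\<eta> \<in> X" "\<bar>\<eta> - h0\<bar> \<le> \<bar>h - h0\<bar>"
      "nrm (fs h \<sigma> - fs h0 \<sigma> - (h - h0) *\<^sub>R ?L) \<le> \<bar>h - h0\<bar> * nrm (fsh \<eta> \<sigma> - ?L)" by blast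
    have "\<bar>s - s0\<bar> * nrm (fs h \<sigma> - fs h0 \<sigma> - (h - h0) *\<^sub>R ?L)
        \<le> \<bar>s - s0\<bar> * (\<bar>h - h0\<bar> * nrm (fsh \<eta> \<sigma> - ?L))"
      by (intro mult_left_mono \<eta>(3)) simp
    with \<sigma> \<eta> show ?thesis by (meson order_trans)
  qed
  have small: "\<exists>d>0. \<forall>s\<in>Y. \<bar>s - s0\<bar> < d \<longrightarrow> nrm (fh s - fh s0 - (s - s0) *\<^sub>R ?L) \<le> \<bar>s - s0\<bar> * \<epsilon>"
    if \<epsilon>: "\<epsilon> > 0" for \<epsilon>
  proof -
    have "\<forall>\<^sub>F p in at (h0, s0) within X \<times> Y. nrm ((\<lambda>(h, s). fsh h s) p - ?L) < \<epsilon>"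
      using cont \<epsilon> unfolding ip_lim_def by (auto intro: order_tendstoD)
    then obtain d where d: "d > 0" and *: "\<And>\<eta> \<sigma>. \<eta> \<in> X \<Longrightarrow> \<sigma> \<in> Y \<Longrightarrow> (\<eta>, \<sigma>) \<noteq> (h0, s0) \<Longrightarrow>
        dist (\<eta>, \<sigma>) (h0, s0) < d \<Longrightarrow> nrm (fsh \<eta> \<sigma> - ?L) < \<epsilon>"
      unfolding eventually_at by fastforce
    \<comment> \<open>\<open>cont\<close> says nothing about the point \<open>(h0, s0)\<close>
      itself, where the difference is 0; \<open>d / 2\<close> in each coordinate keeps the pair
      within distance \<open>d\<close>.\<close>
    have close: "nrm (fsh \<eta> \<sigma> - ?L) \<le> \<epsilon>"
      if "\<eta> \<in> X" "\<sigma> \<in> Y" "\<bar>\<eta> - h0\<bar> < d / 2" "\<bar>\<sigma> - s0\<bar> < d / 2" for \<eta> \<sigma>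
    proof (cases "(\<eta>, \<sigma>) = (h0, s0)")
      case True then show ?thesis using \<epsilon> by simp
    next
      case False
      have "dist (\<eta>, \<sigma>) (h0, s0) \<le> \<bar>\<eta> - h0\<bar> + \<bar>\<sigma> - s0\<bar>"
        using norm_Pair_le[of "\<eta> - h0" "\<sigma> - s0"] by (simp add: dist_norm)
      then show ?thesis using *[OF that(1,2) False] that by linarith
    qed
    have "nrm (fh s - fh s0 - (s - s0) *\<^sub>R ?L) \<le> \<bar>s - s0\<bar> * \<epsilon>" if s: "s \<in> Y" "\<bar>s - s0\<bar> < d / 2" for s
    proof -
      let ?q = "\<lambda>h. (f h s - f h0 s) /\<^sub>R (h - h0) - (f h s0 - f h0 s0) /\<^sub>R (h - h0) - (s - s0) *\<^sub>R ?L"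
      have "tends ?q (fh s - fh s0 - (s - s0) *\<^sub>R ?L) (at h0 within X)"
        using fh[OF s(1)] fh[OF Y(2)] L unfolding ip_deriv_def
        by (intro tends_diff tends_const) auto
      then have lim: "((\<lambda>h. nrm (?q h)) \<longlongrightarrow> nrm (fh s - fh s0 - (s - s0) *\<^sub>R ?L)) (at h0 within X)"
        by (rule tends_nrm)
      have "\<forall>\<^sub>F h in at h0 within X. nrm (?q h) \<le> \<bar>s - s0\<bar> * \<epsilon>"
        unfolding eventually_at
      proof (intro exI[of _ "d / 2"] conjI ballI impI)
        fix h assume h: "h \<in> X" "h \<noteq> h0 \<and> dist h h0 < d / 2"
        let ?e = "f h s - f h0 s - (f h s0 - f h0 s0) - (s - s0) *\<^sub>R (h - h0) *\<^sub>R ?L"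
        obtain \<eta> \<sigma> where b: "\<eta> \<in> X" "\<sigma> \<in> Y" "\<bar>\<eta> - h0\<bar> \<le> \<bar>h - h0\<bar>" "\<bar>\<sigma> - s0\<bar> \<le> \<bar>s - s0\<bar>"
          "nrm ?e \<le> \<bar>s - s0\<bar> * (\<bar>h - h0\<bar> * nrm (fsh \<eta> \<sigma> - ?L))"
          using bound[OF h(1) s(1)] by blast
        have "nrm (fsh \<eta> \<sigma> - ?L) \<le> \<epsilon>"
          using b h s by (intro close) (auto simp: dist_real_def)
        then have "\<bar>s - s0\<bar> * (\<bar>h - h0\<bar> * nrm (fsh \<eta> \<sigma> - ?L)) \<le> \<bar>s - s0\<bar> * (\<bar>h - h0\<bar> * \<epsilon>)"
          by (intro mult_left_mono) auto
        with b(5) have e: "nrm ?e \<le> \<bar>h - h0\<bar> * (\<bar>s - s0\<bar> * \<epsilon>)" by (simp add: ac_simps)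
        have eS: "?e \<in> S" using f h(1) s(1) X(2) Y(2) L by blast
        have "inverse (h - h0) *\<^sub>R (s - s0) *\<^sub>R (h - h0) *\<^sub>R ?L = (s - s0) *\<^sub>R ?L"
          using h(2) by (simp add: mult.left_commute)
        then have "?q h = inverse (h - h0) *\<^sub>R ?e"
          by (simp only: scaleR_diff_right)
        then have "nrm (?q h) = inverse \<bar>h - h0\<bar> * nrm ?e"
          using nrm_scale[OF eS] by simp
        also have "\<dots> \<le> inverse \<bar>h - h0\<bar> * (\<bar>h - h0\<bar> * (\<bar>s - s0\<bar> * \<epsilon>))"
          by (intro mult_left_mono e) simp
        also have "\<dots> = \<bar>s - s0\<bar> * \<epsilon>" using h(2) by simp
        finally show "nrm (?q h) \<le> \<bar>s - s0\<bar> * \<epsilon>" .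
      qed (use d in simp)
      then show ?thesis using tendsto_upperbound[OF lim] X(3) by blast
    qed
    then show ?thesis using d half_gt_zero by blast
  qed
  have "((\<lambda>s. nrm ((fh s - fh s0) /\<^sub>R (s - s0) - ?L)) \<longlongrightarrow> 0) (at s0 within Y)"
    unfolding tendsto_iff
  proof (intro allI impI)
    fix \<epsilon> :: real assume \<epsilon>: "\<epsilon> > 0"
    obtain d where d: "d > 0"
      and *: "\<And>s. s\<in>Y \<Longrightarrow> \<bar>s - s0\<bar> < d \<Longrightarrow> nrm (fh s - fh s0 - (s - s0) *\<^sub>R ?L) \<le> \<bar>s - s0\<bar> * (\<epsilon> / 2)"
      using small[of "\<epsilon> / 2"] \<epsilon> by auto
    show "\<forall>\<^sub>F s in at s0 within Y. dist (nrm ((fh s - fh s0) /\<^sub>R (s - s0) - ?L)) 0 < \<epsilon>"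
      unfolding eventually_at
    proof (intro exI[of _ d] conjI ballI impI d)
      fix s assume s: "s \<in> Y" "s \<noteq> s0 \<and> dist s s0 < d"
      let ?e = "fh s - fh s0 - (s - s0) *\<^sub>R ?L"
      have eS: "?e \<in> S" using fhS s(1) Y(2) L by blast
      have "inverse (s - s0) *\<^sub>R (s - s0) *\<^sub>R ?L = ?L"
        using s(2) by simp
      then have "(fh s - fh s0) /\<^sub>R (s - s0) - ?L = inverse (s - s0) *\<^sub>R ?e"
        by (simp only: scaleR_diff_right)
      then have "nrm ((fh s - fh s0) /\<^sub>R (s - s0) - ?L) = inverse \<bar>s - s0\<bar> * nrm ?e"
        using nrm_scale[OF eS] by simp
      also have "\<dots> \<le> inverse \<bar>s - s0\<bar> * (\<bar>s - s0\<bar> * (\<epsilon> / 2))"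
        using *[OF s(1)] s(2) by (intro mult_left_mono) (auto simp: dist_real_def)
      also have "\<dots> = \<epsilon> / 2" using s(2) by simp
      finally have "nrm ((fh s - fh s0) /\<^sub>R (s - s0) - ?L) < \<epsilon>" using \<epsilon> by simp
      moreover have "0 \<le> nrm ((fh s - fh s0) /\<^sub>R (s - s0) - ?L)"
        using fhS[OF s(1)] fhS[OF Y(2)] L by (intro nrm_nonneg) blast
      ultimately show "dist (nrm ((fh s - fh s0) /\<^sub>R (s - s0) - ?L)) 0 < \<epsilon>" by simp
    qed
  qed
  moreover have "\<forall>\<^sub>F s in at s0 within Y. (fh s - fh s0) /\<^sub>R (s - s0) \<in> S"
    unfolding eventually_at_filter by (rule always_eventually) (use fhS Y(2) in blast)
  ultimately show ?thesis using L by (simp add: ip_deriv_def ip_lim_def)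
qed

end

lemma ip_lim_filtermap: "ip_lim S g f a (filtermap k F) \<longleftrightarrow> ip_lim S g (\<lambda>x. f (k x)) a F"
  by (simp add: ip_lim_def eventually_filtermap filterlim_filtermap)

lemma ip_lim_UNIV_inner: "ip_lim UNIV inner f a F \<longleftrightarrow> (f \<longlongrightarrow> a) F"
proof -
  have "ip_norm inner u = norm u" for u :: 'a
    by (simp add: ip_norm_def norm_eq_sqrt_inner)
  then show ?thesis by (simp add: ip_lim_def tendsto_norm_zero_iff LIM_zero_iff)
qed

text \<open>Level 0 is the ambient space with its own inner product; here derivatives in the scale
  meet \<open>vector_derivative\<close> and hence \<open>h_deriv\<close>.\<close>

lemma ip_deriv_UNIV_inner:
  "ip_deriv UNIV inner f a x X \<longleftrightarrow> (f has_vector_derivative a) (at x within X)"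
proof -
  have "\<forall>\<^sub>F y in at x within X.
      norm ((f y - f x) /\<^sub>R (y - x) - a) = norm ((1 / norm (y - x)) *\<^sub>R (f y - (f x + (y - x) *\<^sub>R a)))"
    unfolding eventually_at_filter
  proof (rule always_eventually, intro allI impI)
    fix y assume "y \<noteq> x" "y \<in> X"
    then have "(f y - f x) /\<^sub>R (y - x) - a = inverse (y - x) *\<^sub>R (f y - (f x + (y - x) *\<^sub>R a))"
      by (simp add: scaleR_diff_right scaleR_add_right)
    then show "norm ((f y - f x) /\<^sub>R (y - x) - a)
        = norm ((1 / norm (y - x)) *\<^sub>R (f y - (f x + (y - x) *\<^sub>R a)))"
      by (simp add: divide_inverse)
  qed
  note cong = tendsto_cong[OF this, of 0]
  have "ip_deriv UNIV inner f a x X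
      \<longleftrightarrow> ((\<lambda>y. norm ((f y - f x) /\<^sub>R (y - x) - a)) \<longlongrightarrow> 0) (at x within X)"
    unfolding ip_deriv_def ip_lim_UNIV_inner by (simp add: tendsto_norm_zero_iff LIM_zero_iff)
  also have "\<dots> \<longleftrightarrow> ((\<lambda>y. (1 / norm (y - x)) *\<^sub>R (f y - (f x + (y - x) *\<^sub>R a))) \<longlongrightarrow> 0) (at x within X)"
    unfolding cong by (rule tendsto_norm_zero_iff)
  also have "\<dots> \<longleftrightarrow> (f has_vector_derivative a) (at x within X)"
    unfolding has_vector_derivative_def has_derivative_within
    by (simp add: bounded_linear_scaleR_left)
  finally show ?thesis .
qed

text \<open>Restricting to lines keeps only directional derivatives. Together with the linearity in
  the direction and the joint continuity recorded in \<open>derivative_tower\<close> they suffice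
  for the chain rule, and they fit the one-variable mean value inequality.\<close>

lemma (in hilbert_carrier) frechet_at_imp_deriv:
  assumes T: "hilbert_carrier T g'" and F: "frechet_at S g T g' f f' (u + s0 *\<^sub>R w)"
    and f: "\<And>x. x \<in> S \<Longrightarrow> f x \<in> T" and u: "u \<in> S" and w: "w \<in> S"
  shows "ip_deriv T g' (\<lambda>s. f (u + s *\<^sub>R w)) (f' w) s0 UNIV"
proof -
  interpret T: hilbert_carrier T g' by (rule T)
  let ?p = "u + s0 *\<^sub>R w"
  have lin: "f' (c *\<^sub>R w) = c *\<^sub>R f' w" for c using F w by (simp add: frechet_at_def)
  have f'w: "f' w \<in> T" using F w by (simp add: frechet_at_def)
  have S: "u + s *\<^sub>R w \<in> S" for s using u w by blast
  show ?thesis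
  \<comment> \<open>For \<open>w = 0\<close> the line stays at its base point and does not enter the
    punctured filter \<open>atin\<close>.\<close>
  proof (cases "w = 0")
    case True
    then have "f' w = 0" using lin[of 0] by simp
    then show ?thesis using True f[OF u] T.deriv_const by simp
  next
    case False
    have nw: "0 < nrm w" using False w nrm_eq_0[of w] nrm_nonneg[of w] by linarith
    have "filterlim (\<lambda>s. u + s *\<^sub>R w) (atin (ip_top S g) ?p) (at s0)"
      unfolding filterlim_iff ip_top_def M.eventually_atin_metric
    proof (intro allI impI)
      fix P assume "?p \<in> S \<longrightarrow> (\<exists>\<delta>>0. \<forall>x. x \<in> S \<and> 0 < ip_dist S g x ?p \<and> ip_dist S g x ?p < \<delta> \<longrightarrow> P x)"
      then obtain \<delta> where \<delta>: "\<delta> > 0"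
        and P: "\<And>x. x \<in> S \<Longrightarrow> 0 < ip_dist S g x ?p \<Longrightarrow> ip_dist S g x ?p < \<delta> \<Longrightarrow> P x"
        using S by blast
      have dist: "ip_dist S g (u + s *\<^sub>R w) ?p = \<bar>s - s0\<bar> * nrm w" for s
      proof -
        have "u + s *\<^sub>R w - ?p = (s - s0) *\<^sub>R w" by (simp add: scaleR_diff_left)
        then show ?thesis using S nrm_scale[OF w] by (simp add: ip_dist_def)
      qed
      show "\<forall>\<^sub>F s in at s0. P (u + s *\<^sub>R w)"
        unfolding eventually_at
      proof (intro exI[of _ "\<delta> / nrm w"] conjI ballI impI)
        fix s assume s: "s \<noteq> s0 \<and> dist s s0 < \<delta> / nrm w"
        show "P (u + s *\<^sub>R w)"
        proof (rule P[OF S])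
          show "0 < ip_dist S g (u + s *\<^sub>R w) ?p" using s nw by (simp add: dist)
          show "ip_dist S g (u + s *\<^sub>R w) ?p < \<delta>"
            using s nw by (simp add: dist dist_real_def pos_less_divide_eq)
        qed
      qed (use \<delta> nw in simp)
    qed
    moreover have "((\<lambda>x. ip_norm g' (f x - f ?p - f' (x - ?p)) / nrm (x - ?p)) \<longlongrightarrow> 0)
        (atin (ip_top S g) ?p)"
      using F by (simp add: frechet_at_def)
    ultimately have "((\<lambda>s. ip_norm g' (f (u + s *\<^sub>R w) - f ?p - f' (u + s *\<^sub>R w - ?p))
        / nrm (u + s *\<^sub>R w - ?p)) \<longlongrightarrow> 0) (at s0)"
      by (rule filterlim_compose[rotated])
    \<comment> \<open>Multiplying by \<open>nrm w\<close> leaves the absolute value of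
      \<open>s - s0\<close> as the denominator.\<close>
    then have lim: "((\<lambda>s. ip_norm g' (f (u + s *\<^sub>R w) - f ?p - f' (u + s *\<^sub>R w - ?p))
        / nrm (u + s *\<^sub>R w - ?p) * nrm w) \<longlongrightarrow> 0) (at s0)"
      by (rule tendsto_mult_left_zero)
    have eq: "ip_norm g' (f (u + s *\<^sub>R w) - f ?p - f' (u + s *\<^sub>R w - ?p)) / nrm (u + s *\<^sub>R w - ?p) * nrm w
        = ip_norm g' ((f (u + s *\<^sub>R w) - f ?p) /\<^sub>R (s - s0) - f' w)" if "s \<noteq> s0" for s
    proof -
      have d: "u + s *\<^sub>R w - ?p = (s - s0) *\<^sub>R w" by (simp add: scaleR_diff_left)
      let ?e = "f (u + s *\<^sub>R w) - f ?p - (s - s0) *\<^sub>R f' w"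
      have "?e \<in> T" using f[OF S] f'w by blast
      then have "ip_norm g' (inverse (s - s0) *\<^sub>R ?e) = inverse \<bar>s - s0\<bar> * ip_norm g' ?e"
        by (simp add: T.nrm_scale)
      moreover have "inverse (s - s0) *\<^sub>R ?e = (f (u + s *\<^sub>R w) - f ?p) /\<^sub>R (s - s0) - f' w"
        using that by (simp add: scaleR_diff_right)
      moreover have "ip_norm g' ?e / (\<bar>s - s0\<bar> * nrm w) * nrm w = inverse \<bar>s - s0\<bar> * ip_norm g' ?e"
        using nw that by (simp add: field_simps)
      ultimately show ?thesis by (simp only: d lin nrm_scale[OF w])
    qed
    have "((\<lambda>s. ip_norm g' ((f (u + s *\<^sub>R w) - f ?p) /\<^sub>R (s - s0) - f' w)) \<longlongrightarrow> 0) (at s0)"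
      by (rule Lim_transform_eventually[OF lim])
        (unfold eventually_at_filter, rule always_eventually, blast intro: eq)
    moreover have "\<forall>\<^sub>F s in at s0. (f (u + s *\<^sub>R w) - f ?p) /\<^sub>R (s - s0) \<in> T"
      by (rule always_eventually) (use f[OF S] in blast)
    ultimately show ?thesis using f'w by (simp add: ip_deriv_def ip_lim_def)
  qed
qed

section \<open>Mixed derivatives of a compatible family\<close>

text \<open>
  Unlike in \<open>Ck_inf\<close>, the argument \<open>v\<close> is not restricted to extensional functions. Continuity is
  phrased by filters; a definition cannot quantify over their type, and \<open>real \<times> real\<close>, the parameter
  space of the families considered below, is large enough.
\<close>

definition derivative_tower ::
  "nat \<Rightarrow> real \<Rightarrow> 'a::real_vector set \<Rightarrow> ('a \<Rightarrow> 'a \<Rightarrow> real) \<Rightarrow> 'a set \<Rightarrow> ('a \<Rightarrow> 'a \<Rightarrow> real) \<Rightarrow>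
   (real \<Rightarrow> 'a \<Rightarrow> 'a) \<Rightarrow> (nat \<Rightarrow> nat \<Rightarrow> real \<Rightarrow> 'a \<Rightarrow> (nat \<Rightarrow> 'a) \<Rightarrow> 'a) \<Rightarrow> bool" where
  "derivative_tower k hs S g T g' \<phi> E \<longleftrightarrow>
     (\<forall>h\<in>{0..<hs}. \<forall>u\<in>S. \<forall>v. E 0 0 h u v = \<phi> h u) \<and>
     (\<forall>j i h u v v'. (\<forall>r<i. v r = v' r) \<longrightarrow> E j i h u v = E j i h u v') \<and>
     (\<forall>i. \<forall>h\<in>{0..<hs}. \<forall>u\<in>S. \<forall>w\<in>S. \<forall>v s. (\<forall>r<i. v r \<in> S) \<longrightarrow>
        ip_deriv T g' (\<lambda>s. E 0 i h (u + s *\<^sub>R w) v) (E 0 (Suc i) h (u + s *\<^sub>R w) (v(i := w))) s UNIV) \<and>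
     (\<forall>i. \<forall>h\<in>{0..<hs}. \<forall>u\<in>S. \<forall>w\<in>S. \<forall>w'\<in>S. \<forall>v a b. (\<forall>r<i. v r \<in> S) \<longrightarrow>
        E 0 (Suc i) h u (v(i := a *\<^sub>R w + b *\<^sub>R w'))
          = a *\<^sub>R E 0 (Suc i) h u (v(i := w)) + b *\<^sub>R E 0 (Suc i) h u (v(i := w'))) \<and>
     (\<forall>i. \<forall>j<k. \<forall>h\<in>{0..<hs}. \<forall>u\<in>S. \<forall>v. (\<forall>r<i. v r \<in> S) \<longrightarrow>
        ip_deriv T g' (\<lambda>h. E j i h u v) (E (Suc j) i h u v) h {0..<hs}) \<and>
     (\<forall>i. \<forall>j\<le>k. \<forall>t c V t0 c0 V0 (F :: (real \<times> real) filter).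
        (t \<longlongrightarrow> t0) F \<longrightarrow> (\<forall>\<^sub>F x in F. t x \<in> {0..<hs}) \<longrightarrow> t0 \<in> {0..<hs} \<longrightarrow>
        ip_lim S g c c0 F \<longrightarrow> (\<forall>r<i. ip_lim S g (V r) (V0 r) F) \<longrightarrow>
        ip_lim T g' (\<lambda>x. E j i (t x) (c x) (\<lambda>r. V r x)) (E j i t0 c0 V0) F)"

context
  fixes k hs S g T g' \<phi> E
  assumes E: "derivative_tower k hs S g T g' \<phi> E"
begin

lemmas derivative_tower_base = E[unfolded derivative_tower_def, THEN conjunct1, rule_format]
  and derivative_tower_cong =
    E[unfolded derivative_tower_def, THEN conjunct2, THEN conjunct1, rule_format]
  and derivative_tower_deriv_u =
    E[unfolded derivative_tower_def, THEN conjunct2, THEN conjunct2, THEN conjunct1, rule_format]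
  and derivative_tower_linear =
    E[unfolded derivative_tower_def, THEN conjunct2, THEN conjunct2, THEN conjunct2, THEN conjunct1,
      rule_format]
  and derivative_tower_deriv_h =
    E[unfolded derivative_tower_def, THEN conjunct2, THEN conjunct2, THEN conjunct2, THEN conjunct2,
      THEN conjunct1, rule_format]
  and derivative_tower_tends =
    E[unfolded derivative_tower_def, THEN conjunct2, THEN conjunct2, THEN conjunct2, THEN conjunct2,
      THEN conjunct2, rule_format]

end

lemma restrict_upd_lessThan:
  "(restrict v {..<i})(i := w) = restrict (v(i := w)) {..<Suc i}"
  by (auto simp: restrict_def fun_eq_iff)

lemma Ck_inf_imp_derivative_tower:
  assumes S: "hilbert_carrier S g" and T: "hilbert_carrier T g'" and C: "Ck_inf k hs S g T g' \<phi>"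
  obtains E where "derivative_tower k hs S g T g' \<phi> E"
proof -
  interpret S: hilbert_carrier S g by (rule S)
  interpret T: hilbert_carrier T g' by (rule T)
  from C[unfolded Ck_inf_def] obtain D where
      d0: "\<forall>h\<in>{0..<hs}. \<forall>u\<in>S. D 0 0 h u (\<lambda>_. undefined) = \<phi> h u"
    and du: "\<forall>i. \<forall>h\<in>{0..<hs}. \<forall>u\<in>S. \<forall>v \<in> {..<i} \<rightarrow>\<^sub>E S.
           frechet_at S g T g' (\<lambda>w. D 0 i h w v) (\<lambda>w. D 0 (Suc i) h u (v(i := w))) u"
    and dh: "\<forall>i. \<forall>j<k. \<forall>h\<in>{0..<hs}. \<forall>u\<in>S. \<forall>v \<in> {..<i} \<rightarrow>\<^sub>E S.
           limitin (ip_top T g') (\<lambda>h'. (D j i h' u v - D j i h u v) /\<^sub>R (h' - h))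
             (D (Suc j) i h u v) (at h within {0..<hs})"
    and dc: "\<forall>i. \<forall>j\<le>k.
           continuous_map
             (prod_topology (top_of_set {0..<hs})
               (prod_topology (ip_top S g) (product_topology (\<lambda>_. ip_top S g) {..<i})))
             (ip_top T g')
             (\<lambda>(h, u, v). D j i h u v)"
    by (elim exE conjE) (rule that; assumption)
  note D0 = d0[rule_format] and Du = du[rule_format] and Dh = dh[rule_format] and Dc = dc[rule_format]
  \<comment> \<open>Restricting \<open>v\<close> lets the directions be ordinary functions: entries
    from \<open>i\<close> on cannot influence the value.\<close>
  define E where "E j i h u v = D j i h u (restrict v {..<i})" for j i h u v
  have ext: "restrict v {..<i} \<in> {..<i} \<rightarrow>\<^sub>E S" if "\<forall>r<i. v r \<in> S" for v and i :: nat
    using that by auto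
  have cont: "ip_lim T g' (\<lambda>x. E j i (t x) (c x) (\<lambda>r. V r x)) (E j i t0 c0 V0) F"
    if j: "j \<le> k" and t: "(t \<longlongrightarrow> t0) F" "\<forall>\<^sub>F x in F. t x \<in> {0..<hs}" "t0 \<in> {0..<hs}"
      and c: "ip_lim S g c c0 F" and V: "\<forall>r<i. ip_lim S g (V r) (V0 r) F"
    for i j t t0 c c0 V V0 and F :: "(real \<times> real) filter"
  proof -
    let ?X = "prod_topology (top_of_set {0..<hs})
               (prod_topology (ip_top S g) (product_topology (\<lambda>_. ip_top S g) {..<i}))"
    have VS: "\<forall>\<^sub>F x in F. \<forall>r\<in>{..<i}. V r x \<in> S"
      by (rule eventually_ball_finite) (use V in \<open>auto simp: ip_lim_def\<close>)
    have ev: "\<forall>\<^sub>F x in F. (\<lambda>r\<in>{..<i}. V r x) \<in> topspace (product_topology (\<lambda>_. ip_top S g) {..<i})"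
      using VS by eventually_elim auto
    have "limitin ?X (\<lambda>x. (t x, c x, \<lambda>r\<in>{..<i}. V r x)) (t0, c0, restrict V0 {..<i}) F"
      unfolding limitin_pairwise limitin_componentwise
      using t c V ev by (simp add: o_def limitin_subtopology S.limitin_ip_top)
    from continuous_map_limit[OF Dc[OF j] this] show ?thesis
      by (simp add: o_def E_def T.limitin_ip_top)
  qed
  \<comment> \<open>Membership is read off from continuity: along the filter \<open>bot\<close>
    every eventual condition is vacuous, yet the limit statement still asserts that the limit lies
    in \<open>T\<close>.\<close>
  have ET: "E 0 i h u v \<in> T" if "h \<in> {0..<hs}" "u \<in> S" "\<forall>r<i. v r \<in> S" for i h u v
    using cont[of 0 "\<lambda>_. h" h bot "\<lambda>_. u" u i "\<lambda>r _. v r" v] that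
    by (auto simp: ip_lim_def)
  have "derivative_tower k hs S g T g' \<phi> E"
    unfolding derivative_tower_def
  proof (intro conjI allI ballI impI)
    fix h u and v :: "nat \<Rightarrow> 'a" assume "h \<in> {0..<hs}" "u \<in> S"
    moreover have "restrict v {..<0::nat} = (\<lambda>_. undefined)" by auto
    ultimately show "E 0 0 h u v = \<phi> h u" by (simp only: E_def D0)
  next
    fix j i :: nat and h u and v v' :: "nat \<Rightarrow> 'a" assume "\<forall>r<i. v r = v' r"
    then have "restrict v {..<i} = restrict v' {..<i}" by auto
    then show "E j i h u v = E j i h u v'" by (simp add: E_def)
  next
    fix i :: nat and h u w v and s :: real
    assume *: "h \<in> {0..<hs}" "u \<in> S" "w \<in> S" "\<forall>r<i. v r \<in> S"
    have us: "u + s *\<^sub>R w \<in> S" using * by blast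
    show "ip_deriv T g' (\<lambda>s. E 0 i h (u + s *\<^sub>R w) v) (E 0 (Suc i) h (u + s *\<^sub>R w) (v(i := w))) s UNIV"
      using S.frechet_at_imp_deriv[OF T Du[OF *(1) us ext[OF *(4)]] _ *(2,3)] ET[OF *(1) _ *(4)]
      by (simp add: E_def restrict_upd_lessThan)
  next
    fix i :: nat and h u w w' v and a b :: real
    assume *: "h \<in> {0..<hs}" "u \<in> S" "w \<in> S" "w' \<in> S" "\<forall>r<i. v r \<in> S"
    let ?f = "\<lambda>w. D 0 (Suc i) h u ((restrict v {..<i})(i := w))"
    have fr: "frechet_at S g T g' (\<lambda>w. D 0 i h w (restrict v {..<i})) ?f u"
      by (rule Du[OF *(1,2) ext[OF *(5)]])
    have S2: "a *\<^sub>R w \<in> S" "b *\<^sub>R w' \<in> S" using * by auto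
    have "?f (a *\<^sub>R w + b *\<^sub>R w') = ?f (a *\<^sub>R w) + ?f (b *\<^sub>R w')"
      using fr S2 unfolding frechet_at_def by blast
    also have "?f (a *\<^sub>R w) = a *\<^sub>R ?f w" using fr *(3) unfolding frechet_at_def by blast
    also have "?f (b *\<^sub>R w') = b *\<^sub>R ?f w'" using fr *(4) unfolding frechet_at_def by blast
    finally show "E 0 (Suc i) h u (v(i := a *\<^sub>R w + b *\<^sub>R w'))
          = a *\<^sub>R E 0 (Suc i) h u (v(i := w)) + b *\<^sub>R E 0 (Suc i) h u (v(i := w'))"
      by (simp only: E_def restrict_upd_lessThan)
  next
    fix i j :: nat and h u v assume "j < k" "h \<in> {0..<hs}" "u \<in> S" "\<forall>r<i. v r \<in> S"
    then show "ip_deriv T g' (\<lambda>h. E j i h u v) (E (Suc j) i h u v) h {0..<hs}"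
      using Dh ext by (simp add: E_def ip_deriv_def T.limitin_ip_top)
  next
    fix i j :: nat and t c V t0 c0 V0 and F :: "(real \<times> real) filter"
    assume "j \<le> k" "(t \<longlongrightarrow> t0) F" "\<forall>\<^sub>F x in F. t x \<in> {0..<hs}" "t0 \<in> {0..<hs}"
      "ip_lim S g c c0 F" "\<forall>r<i. ip_lim S g (V r) (V0 r) F"
    then show "ip_lim T g' (\<lambda>x. E j i (t x) (c x) (\<lambda>r. V r x)) (E j i t0 c0 V0) F"
      by (rule cont)
  qed
  then show ?thesis using that by blast
qed

text \<open>A connected set with at least two points has no isolated point, and the midpoint of
  \<open>h\<close> and \<open>b\<close> is a second point. One-sided derivatives are unique for this
  reason.\<close>

lemma at_within_atLeastLessThan:
  fixes h :: real
  assumes "h \<in> {a..<b}"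
  shows "at h within {a..<b} \<noteq> bot"
proof -
  have "{a..<b} \<noteq> {x}" for x
  proof
    assume I: "{a..<b} = {x}"
    have "h \<in> {a..<b}" "(h + b) / 2 \<in> {a..<b}" using assms by auto
    then have "h = x" "(h + b) / 2 = x" unfolding I by auto
    then show False using assms by simp
  qed
  then show ?thesis
    using connected_imp_perfect[of "{a..<b}" h] assms by (auto simp: trivial_limit_within)
qed

section \<open>The scale, and one array of mixed derivatives for all levels\<close>

locale scale_of_spaces =
  fixes Hs :: "nat \<Rightarrow> 'a::real_inner set" and ip :: "nat \<Rightarrow> 'a \<Rightarrow> 'a \<Rightarrow> real" and hs :: real
  assumes scale: "hilbert_scale Hs ip" and hs: "0 < hs"
begin

text \<open>With the level left as a parameter, one interpretation provides the calculus of all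
  spaces of the scale.\<close>

sublocale H: hilbert_carrier "Hs l" "ip l" for l
  by unfold_locales (use scale in \<open>simp add: hilbert_scale_def\<close>)

abbreviation I :: "real set" where "I \<equiv> {0..<hs}"

lemma Hs_0 [simp]: "Hs 0 = UNIV" and ip_0: "ip 0 = inner"
  using scale by (auto simp: hilbert_scale_def)

lemma Hs_antimono: "l \<le> m \<Longrightarrow> Hs m \<subseteq> Hs l"
  by (rule lift_Suc_antimono_le[of Hs]) (use scale in \<open>auto simp: hilbert_scale_def\<close>)

lemma Hs_mem: "u \<in> Hs m \<Longrightarrow> l \<le> m \<Longrightarrow> u \<in> Hs l"
  using Hs_antimono by blast

lemma tends_level:
  assumes "H.tends m f a F" "l \<le> m"
  shows "H.tends l f a F"
  using assms(2,1)
proof (induction rule: dec_induct)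
  case (step n)
  obtain C where C: "\<And>u. u \<in> Hs (Suc n) \<Longrightarrow> H.nrm n u \<le> C * H.nrm (Suc n) u"
    using scale unfolding hilbert_scale_def by blast
  have S: "a \<in> Hs (Suc n)" "\<forall>\<^sub>F x in F. f x \<in> Hs (Suc n)"
    and l: "((\<lambda>x. H.nrm (Suc n) (f x - a)) \<longlongrightarrow> 0) F"
    using step.prems by (auto simp: ip_lim_def)
  have "H.tends n f a F"
  proof (rule H.tends_dominated[where e = "\<lambda>x. C * H.nrm (Suc n) (f x - a)"])
    show "a \<in> Hs n" using S(1) Hs_mem[of _ "Suc n" n] by simp
    show "\<forall>\<^sub>F x in F. f x \<in> Hs n"
      using S(2) by eventually_elim (rule Hs_mem[of _ "Suc n" n], simp_all)
    show "\<forall>\<^sub>F x in F. H.nrm n (f x - a) \<le> C * H.nrm (Suc n) (f x - a)"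
      using S(2) by eventually_elim (rule C, use S(1) in blast)
    show "((\<lambda>x. C * H.nrm (Suc n) (f x - a)) \<longlongrightarrow> 0) F"
      by (rule tendsto_mult_right_zero[OF l])
  qed
  then show ?case by (rule step.IH)
qed

lemma deriv_level: "H.deriv m f a x X \<Longrightarrow> l \<le> m \<Longrightarrow> H.deriv l f a x X"
  unfolding ip_deriv_def by (rule tends_level)

lemma deriv_0_iff: "H.deriv 0 f a x X \<longleftrightarrow> (f has_vector_derivative a) (at x within X)"
  by (simp add: ip_0 ip_deriv_UNIV_inner)

lemma deriv_imp_vector: "H.deriv l f a x X \<Longrightarrow> (f has_vector_derivative a) (at x within X)"
  using deriv_level[of l f a x X 0] by (simp add: ip_0 ip_deriv_UNIV_inner)

lemma at_within_I: "h \<in> I \<Longrightarrow> at h within I \<noteq> bot"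
  by (rule at_within_atLeastLessThan)

lemma vector_deriv_I_unique:
  "(f has_vector_derivative a) (at h within I) \<Longrightarrow> (f has_vector_derivative b) (at h within I) \<Longrightarrow>
   h \<in> I \<Longrightarrow> a = b"
  using vector_derivative_unique_within[OF at_within_I] by blast

text \<open>All entries are iterated derivatives of the same \<phi>, and a derivative at any level
  is one in the ambient space, where limits are unique. First \<open>i\<close> grows at
  \<open>j = 0\<close> through directional derivatives, then \<open>j\<close> through
  \<open>h\<close>-derivatives.\<close>

lemma derivative_tower_unique:
  assumes E: "derivative_tower k hs (Hs a) (ip a) (Hs b) (ip b) \<phi> E"
    and E': "derivative_tower k' hs (Hs a') (ip a') (Hs b') (ip b') \<phi> E'"
    and a: "a \<le> a'" and j: "j \<le> k" "j \<le> k'" and h: "h \<in> I" and u: "u \<in> Hs a'"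
    and v: "\<forall>r<i. v r \<in> Hs a'"
  shows "E j i h u v = E' j i h u v"
  using j h u v
proof (induction j arbitrary: i h u v)
  case 0
  then show ?case
  proof (induction i arbitrary: u v)
    case 0
    then show ?case
      by (simp add: derivative_tower_base[OF E] derivative_tower_base[OF E'] Hs_mem[OF _ a])
  next
    case (Suc i)
    let ?w = "v i"
    have w: "?w \<in> Hs a'" "\<forall>r<i. v r \<in> Hs a'" using Suc.prems by auto
    have eq: "E 0 i h (u + s *\<^sub>R ?w) v = E' 0 i h (u + s *\<^sub>R ?w) v" for s
      by (rule Suc.IH) (use Suc.prems w in auto)
    have "H.deriv b (\<lambda>s. E 0 i h (u + s *\<^sub>R ?w) v) (E 0 (Suc i) h (u + 0 *\<^sub>R ?w) (v(i := ?w))) 0 UNIV"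
      by (rule derivative_tower_deriv_u[OF E]) (use Suc.prems w Hs_mem[OF _ a] in auto)
    moreover have "H.deriv b' (\<lambda>s. E' 0 i h (u + s *\<^sub>R ?w) v)
        (E' 0 (Suc i) h (u + 0 *\<^sub>R ?w) (v(i := ?w))) 0 UNIV"
      by (rule derivative_tower_deriv_u[OF E']) (use Suc.prems w in auto)
    ultimately show ?case
      using vector_derivative_unique_at[OF deriv_imp_vector deriv_imp_vector] by (simp add: eq)
  qed
next
  case (Suc j)
  have eq: "E j i y u v = E' j i y u v" if "y \<in> I" for y
    by (rule Suc.IH) (use Suc.prems that in auto)
  have "H.deriv b (\<lambda>h. E j i h u v) (E (Suc j) i h u v) h I"
    by (rule derivative_tower_deriv_h[OF E]) (use Suc.prems Hs_mem[OF _ a] in auto)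
  moreover have "H.deriv b' (\<lambda>h. E' j i h u v) (E' (Suc j) i h u v) h I"
    by (rule derivative_tower_deriv_h[OF E']) (use Suc.prems in auto)
  then have "H.deriv b' (\<lambda>h. E j i h u v) (E' (Suc j) i h u v) h I"
    using H.deriv_cong[of I "\<lambda>h. E j i h u v" "\<lambda>h. E' j i h u v" h b'] eq Suc.prems by blast
  ultimately show ?case
    using vector_deriv_I_unique deriv_imp_vector Suc.prems by blast
qed

text \<open>One array for all levels, \<open>E j i\<close> carrying level \<open>j + l\<close> to
  level \<open>l\<close>. Beyond \<open>derivative_tower\<close> it has \<open>u\<close>-derivatives
  for every \<open>j\<close> and linearity in every direction, both of which the chain rule
  uses.\<close>

definition scale_tower ::
  "(real \<Rightarrow> 'a \<Rightarrow> 'a) \<Rightarrow> (nat \<Rightarrow> nat \<Rightarrow> real \<Rightarrow> 'a \<Rightarrow> (nat \<Rightarrow> 'a) \<Rightarrow> 'a) \<Rightarrow> bool" where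
  "scale_tower \<phi> E \<longleftrightarrow>
     (\<forall>h\<in>I. \<forall>u v. E 0 0 h u v = \<phi> h u) \<and>
     (\<forall>j i h u v v'. (\<forall>r<i. v r = v' r) \<longrightarrow> E j i h u v = E j i h u v') \<and>
     (\<forall>l j i t c V t0 c0 V0. \<forall>F :: (real \<times> real) filter.
        (t \<longlongrightarrow> t0) F \<longrightarrow> (\<forall>\<^sub>F x in F. t x \<in> I) \<longrightarrow> t0 \<in> I \<longrightarrow>
        H.tends (j + l) c c0 F \<longrightarrow> (\<forall>r<i. H.tends (j + l) (V r) (V0 r) F) \<longrightarrow>
        H.tends l (\<lambda>x. E j i (t x) (c x) (\<lambda>r. V r x)) (E j i t0 c0 V0) F) \<and>
     (\<forall>l j i. \<forall>h\<in>I. \<forall>u\<in>Hs (Suc j + l). \<forall>v. (\<forall>r<i. v r \<in> Hs (Suc j + l)) \<longrightarrow>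
        H.deriv l (\<lambda>h. E j i h u v) (E (Suc j) i h u v) h I) \<and>
     (\<forall>l j i. \<forall>h\<in>I. \<forall>u\<in>Hs (j + l). \<forall>w\<in>Hs (j + l). \<forall>v s. (\<forall>r<i. v r \<in> Hs (j + l)) \<longrightarrow>
        H.deriv l (\<lambda>s. E j i h (u + s *\<^sub>R w) v) (E j (Suc i) h (u + s *\<^sub>R w) (v(i := w))) s UNIV) \<and>
     (\<forall>j i. \<forall>h\<in>I. \<forall>u\<in>Hs j. \<forall>w\<in>Hs j. \<forall>w'\<in>Hs j. \<forall>v a b. \<forall>r<i. (\<forall>r<i. v r \<in> Hs j) \<longrightarrow>
        E j i h u (v(r := a *\<^sub>R w + b *\<^sub>R w')) = a *\<^sub>R E j i h u (v(r := w)) + b *\<^sub>R E j i h u (v(r := w')))"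

context
  fixes \<phi> E
  assumes E: "scale_tower \<phi> E"
begin

lemmas scale_tower_base = E[unfolded scale_tower_def, THEN conjunct1, rule_format]
  and scale_tower_cong =
    E[unfolded scale_tower_def, THEN conjunct2, THEN conjunct1, rule_format]
  and scale_tower_tends =
    E[unfolded scale_tower_def, THEN conjunct2, THEN conjunct2, THEN conjunct1, rule_format]
  and scale_tower_deriv_h =
    E[unfolded scale_tower_def, THEN conjunct2, THEN conjunct2, THEN conjunct2, THEN conjunct1,
      rule_format]
  and scale_tower_deriv_u =
    E[unfolded scale_tower_def, THEN conjunct2, THEN conjunct2, THEN conjunct2, THEN conjunct2,
      THEN conjunct1, rule_format]
  and scale_tower_linear =
    E[unfolded scale_tower_def, THEN conjunct2, THEN conjunct2, THEN conjunct2, THEN conjunct2,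
      THEN conjunct2, rule_format]

end

lemma compatible_imp_scale_tower:
  assumes "compatible hs Hs ip \<phi>"
  obtains E where "scale_tower \<phi> E"
proof -
  have "\<exists>E. derivative_tower k hs (Hs (k + l)) (ip (k + l)) (Hs l) (ip l) \<phi> E" for k l
    by (rule Ck_inf_imp_derivative_tower[OF H.hilbert_carrier_axioms H.hilbert_carrier_axioms])
      (use assms in \<open>auto simp: compatible_def\<close>)
  then obtain EE where EE: "\<And>k l. derivative_tower k hs (Hs (k + l)) (ip (k + l)) (Hs l) (ip l) \<phi> (EE k l)"
    by metis
  \<comment> \<open>Target level 0 gives the largest source space, \<open>Hs j\<close>, on which
    \<open>j\<close> derivatives in \<open>h\<close> are available; by uniqueness any other tower
    agrees with this one on its own, smaller source space.\<close>
  define E where "E j = EE j 0 j" for j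
  have agree: "EE k l j i h u v = E j i h u v"
    if "j \<le> k" "h \<in> I" "u \<in> Hs (k + l)" "\<forall>r<i. v r \<in> Hs (k + l)" for k l j i h u v
    unfolding E_def
    by (rule derivative_tower_unique[OF EE[of j 0] EE[of k l], symmetric]) (use that in auto)
  have cong: "E j i h u v = E j i h u v'" if "\<forall>r<i. v r = v' r" for j i h u v v'
    unfolding E_def by (rule derivative_tower_cong[OF EE]) (use that in blast)
  have cont: "H.tends l (\<lambda>x. E j i (t x) (c x) (\<lambda>r. V r x)) (E j i t0 c0 V0) F"
    if t: "(t \<longlongrightarrow> t0) F" "\<forall>\<^sub>F x in F. t x \<in> I" "t0 \<in> I"
      and c: "H.tends (j + l) c c0 F" and V: "\<forall>r<i. H.tends (j + l) (V r) (V0 r) F"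
    for l j i t t0 c c0 V V0 and F :: "(real \<times> real) filter"
  proof -
    have "H.tends l (\<lambda>x. EE j l j i (t x) (c x) (\<lambda>r. V r x)) (EE j l j i t0 c0 V0) F"
      by (rule derivative_tower_tends[OF EE]) (use that in auto)
    moreover have "EE j l j i t0 c0 V0 = E j i t0 c0 V0"
      by (rule agree) (use t c V in \<open>auto simp: ip_lim_def\<close>)
    moreover have "\<forall>\<^sub>F x in F. EE j l j i (t x) (c x) (\<lambda>r. V r x) = E j i (t x) (c x) (\<lambda>r. V r x)"
    proof -
      have VS: "\<forall>\<^sub>F x in F. \<forall>r\<in>{..<i}. V r x \<in> Hs (j + l)"
        by (rule eventually_ball_finite) (use V in \<open>auto simp: ip_lim_def\<close>)
      have "\<forall>\<^sub>F x in F. c x \<in> Hs (j + l)" using c by (simp add: ip_lim_def)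
      with VS t(2) show ?thesis by eventually_elim (auto intro: agree)
    qed
    ultimately show ?thesis by (simp add: H.tends_cong)
  qed
  have dh: "H.deriv l (\<lambda>h. E j i h u v) (E (Suc j) i h u v) h I"
    if "h \<in> I" "u \<in> Hs (Suc j + l)" "\<forall>r<i. v r \<in> Hs (Suc j + l)" for l j i h u v
  proof -
    have "H.deriv l (\<lambda>h. EE (Suc j) l j i h u v) (EE (Suc j) l (Suc j) i h u v) h I"
      by (rule derivative_tower_deriv_h[OF EE]) (use that in auto)
    moreover have "EE (Suc j) l (Suc j) i h u v = E (Suc j) i h u v"
      by (rule agree) (use that in auto)
    moreover have "EE (Suc j) l j i y u v = E j i y u v" if "y \<in> I" for y
      by (rule agree) (use that \<open>u \<in> _\<close> \<open>\<forall>r<i. v r \<in> _\<close> in auto)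
    ultimately show ?thesis
      using H.deriv_cong[of I "\<lambda>h. EE (Suc j) l j i h u v" "\<lambda>h. E j i h u v"] that by simp
  qed
  have mem: "E j i h u v \<in> Hs l" if "h \<in> I" "u \<in> Hs (j + l)" "\<forall>r<i. v r \<in> Hs (j + l)" for l j i h u v
    using cont[of "\<lambda>_. h" h bot j l "\<lambda>_. u" u i "\<lambda>r _. v r" v] that by (auto simp: ip_lim_def)
  \<comment> \<open>The towers differentiate in \<open>u\<close> only at \<open>j = 0\<close>. For
    \<open>Suc j\<close>, \<open>mixed_deriv\<close> is applied to \<open>E j i\<close>: its
    \<open>u\<close>-derivative is known by induction, and the \<open>h\<close>-derivative of that
    is the entry \<open>E (Suc j) (Suc i)\<close>.\<close>
  have du: "H.deriv l (\<lambda>s. E j i h (u + s *\<^sub>R w) v) (E j (Suc i) h (u + s *\<^sub>R w) (v(i := w))) s UNIV"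
    if "h \<in> I" "u \<in> Hs (j + l)" "w \<in> Hs (j + l)" "\<forall>r<i. v r \<in> Hs (j + l)" for l j i h u w v s
    using that
  proof (induction j arbitrary: h s)
    case 0
    have up: "u + s *\<^sub>R w \<in> Hs (0 + l)" for s using 0 by auto
    have "H.deriv l (\<lambda>s. EE 0 l 0 i h (u + s *\<^sub>R w) v) (EE 0 l 0 (Suc i) h (u + s *\<^sub>R w) (v(i := w))) s UNIV"
      by (rule derivative_tower_deriv_u[OF EE]) (use 0 in auto)
    moreover have "EE 0 l 0 (Suc i) h (u + s *\<^sub>R w) (v(i := w)) = E 0 (Suc i) h (u + s *\<^sub>R w) (v(i := w))"
      by (rule agree) (use 0 up in auto)
    moreover have "EE 0 l 0 i h (u + s *\<^sub>R w) v = E 0 i h (u + s *\<^sub>R w) v" for s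
      by (rule agree) (use 0 up in auto)
    ultimately show ?case by (simp only:)
  next
    case (Suc j)
    have S: "u \<in> Hs (j + l)" "w \<in> Hs (j + l)" "\<forall>r<i. v r \<in> Hs (j + l)"
      using Suc.prems Hs_mem[of _ "Suc j + l" "j + l"] by auto
    have up: "u + s *\<^sub>R w \<in> Hs (j + l)" for s using S by blast
    have up': "u + s *\<^sub>R w \<in> Hs (Suc j + l)" for s using Suc.prems by blast
    have v': "\<forall>r<Suc i. (v(i := w)) r \<in> Hs (Suc j + l)" using Suc.prems by (simp add: less_Suc_eq)
    show ?case
    proof (rule H.mixed_deriv[where X = I and Y = UNIV and f = "\<lambda>h s. E j i h (u + s *\<^sub>R w) v"
          and fs = "\<lambda>h s. E j (Suc i) h (u + s *\<^sub>R w) (v(i := w))"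
          and fsh = "\<lambda>h s. E (Suc j) (Suc i) h (u + s *\<^sub>R w) (v(i := w))"])
      show "at h within I \<noteq> bot" using at_within_I Suc.prems by blast
      show "E j i h (u + s *\<^sub>R w) v \<in> Hs l" if "h \<in> I" for h s
        using that S up by (intro mem) auto
      show "H.deriv l (\<lambda>h. E j i h (u + s *\<^sub>R w) v) (E (Suc j) i h (u + s *\<^sub>R w) v) h I" for s
        using Suc.prems up' by (intro dh) auto
      show "H.deriv l (\<lambda>s. E j i h (u + s *\<^sub>R w) v) (E j (Suc i) h (u + s *\<^sub>R w) (v(i := w))) s UNIV"
        if "h \<in> I" for h s
        using that S by (rule Suc.IH)
      show "H.deriv l (\<lambda>h. E j (Suc i) h (u + s *\<^sub>R w) (v(i := w)))
          (E (Suc j) (Suc i) h (u + s *\<^sub>R w) (v(i := w))) h I" if "h \<in> I" for h s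
        using that up' v' by (rule dh)
      have tw: "H.tends (Suc j + l) (\<lambda>p. u + snd p *\<^sub>R w) (u + s *\<^sub>R w) (at (h, s) within I \<times> UNIV)"
        using Suc.prems by (intro H.tends_add H.tends_const H.tends_scaleR)
          (auto intro!: tendsto_eq_intros)
      have ev: "\<forall>\<^sub>F p in at (h, s) within I \<times> UNIV. fst p \<in> I"
        unfolding eventually_at_filter by (rule always_eventually) auto
      have "H.tends l (\<lambda>p. E (Suc j) (Suc i) (fst p) (u + snd p *\<^sub>R w) (\<lambda>r. (v(i := w)) r))
          (E (Suc j) (Suc i) h (u + s *\<^sub>R w) (v(i := w))) (at (h, s) within I \<times> UNIV)"
        by (rule cont[OF _ ev _ tw])
          (use Suc.prems(1) v' in \<open>auto intro!: tendsto_eq_intros H.tends_const\<close>)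
      then show "H.tends l (\<lambda>(h, s). E (Suc j) (Suc i) h (u + s *\<^sub>R w) (v(i := w)))
          (E (Suc j) (Suc i) h (u + s *\<^sub>R w) (v(i := w))) (at (h, s) within I \<times> UNIV)"
        by (simp only: case_prod_unfold)
    qed (use Suc.prems in auto)
  qed
  \<comment> \<open>A tower is linear only in its last direction, at \<open>j = 0\<close>. For an
    earlier slot the identity at order \<open>i\<close> is differentiated along the last direction
    \<open>v i\<close>; then \<open>j\<close> is raised by differentiating in
    \<open>h\<close>.\<close>
  have lin: "E j i h u (v(r := a *\<^sub>R w + b *\<^sub>R w')) = a *\<^sub>R E j i h u (v(r := w)) + b *\<^sub>R E j i h u (v(r := w'))"
    if "h \<in> I" "u \<in> Hs j" "w \<in> Hs j" "w' \<in> Hs j" "r < i" "\<forall>r<i. v r \<in> Hs j" for j i h u w w' v a b r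
    using that
  proof (induction j arbitrary: i h u v)
    case 0
    then show ?case
    proof (induction i arbitrary: u v)
      case (Suc i)
      show ?case
      proof (cases "r = i")
        case True
        then show ?thesis
          unfolding E_def
          by (simp only: True) (rule derivative_tower_linear[OF EE[of 0 0]], use Suc.prems in auto)
      next
        case False
        let ?f = "\<lambda>x s. E 0 i h (u + s *\<^sub>R v i) (v(r := x))"
        have d: "(?f x has_vector_derivative E 0 (Suc i) h u (v(r := x))) (at 0)" for x
        proof -
          have "(v(r := x))(i := v i) = v(r := x)" using False by auto
          then show ?thesis
            using deriv_imp_vector[OF du[of h u 0 0 "v i" i "v(r := x)" 0]] Suc.prems by simp
        qed
        have "(\<lambda>s. ?f (a *\<^sub>R w + b *\<^sub>R w') s) = (\<lambda>s. a *\<^sub>R ?f w s + b *\<^sub>R ?f w' s)"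
          by (intro ext Suc.IH) (use Suc.prems False in auto)
        then have "((\<lambda>s. a *\<^sub>R ?f w s + b *\<^sub>R ?f w' s) has_vector_derivative
            E 0 (Suc i) h u (v(r := a *\<^sub>R w + b *\<^sub>R w'))) (at 0)"
          using d[of "a *\<^sub>R w + b *\<^sub>R w'"] by simp
        moreover have "((\<lambda>s. a *\<^sub>R ?f w s + b *\<^sub>R ?f w' s) has_vector_derivative
            a *\<^sub>R E 0 (Suc i) h u (v(r := w)) + b *\<^sub>R E 0 (Suc i) h u (v(r := w'))) (at 0)"
          by (intro has_vector_derivative_add bounded_linear.has_vector_derivative[OF bounded_linear_scaleR_right] d)
        ultimately show ?thesis by (rule vector_derivative_unique_at)
      qed
    qed simp
  next
    case (Suc j)
    let ?f = "\<lambda>x h. E j i h u (v(r := x))"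
    have d: "(?f x has_vector_derivative E (Suc j) i h u (v(r := x))) (at h within I)"
      if "x \<in> Hs (Suc j)" for x
      using deriv_imp_vector[OF dh[of h u j 0 i "v(r := x)"]] Suc.prems that by simp
    have S: "a *\<^sub>R w + b *\<^sub>R w' \<in> Hs (Suc j)" using Suc.prems by auto
    have eq: "?f (a *\<^sub>R w + b *\<^sub>R w') h = a *\<^sub>R ?f w h + b *\<^sub>R ?f w' h" if "h \<in> I" for h
      by (rule Suc.IH) (use Suc.prems that Hs_mem[of _ "Suc j" j] in auto)
    have "((\<lambda>h. a *\<^sub>R ?f w h + b *\<^sub>R ?f w' h) has_vector_derivative
        E (Suc j) i h u (v(r := a *\<^sub>R w + b *\<^sub>R w'))) (at h within I)"
      by (rule has_vector_derivative_transform[OF Suc.prems(1) eq[symmetric] d[OF S]])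
    moreover have "((\<lambda>h. a *\<^sub>R ?f w h + b *\<^sub>R ?f w' h) has_vector_derivative
        a *\<^sub>R E (Suc j) i h u (v(r := w)) + b *\<^sub>R E (Suc j) i h u (v(r := w'))) (at h within I)"
      by (intro has_vector_derivative_add bounded_linear.has_vector_derivative[OF bounded_linear_scaleR_right] d Suc.prems)
    ultimately show ?case by (rule vector_deriv_I_unique) (rule Suc.prems)
  qed
  have base: "E 0 0 h u v = \<phi> h u" if "h \<in> I" for h u v
    unfolding E_def by (rule derivative_tower_base[OF EE]) (use that in auto)
  have "scale_tower \<phi> E"
    unfolding scale_tower_def
    by (intro conjI allI ballI impI; (rule base cong cont dh du lin; assumption)?)
  then show ?thesis by (rule that)
qed

text \<open>Continuity is stated for filters on \<open>real \<times> real\<close>; a filter on the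
  line is moved there along the diagonal.\<close>

lemma scale_tower_tends_real:
  fixes F :: "real filter"
  assumes E: "scale_tower \<phi> E"
    and t: "(t \<longlongrightarrow> t0) F" "\<forall>\<^sub>F x in F. t x \<in> I" "t0 \<in> I"
    and c: "H.tends (j + l) c c0 F" and V: "\<And>r. r < i \<Longrightarrow> H.tends (j + l) (V r) (V0 r) F"
  shows "H.tends l (\<lambda>x. E j i (t x) (c x) (\<lambda>r. V r x)) (E j i t0 c0 V0) F"
proof -
  let ?F = "filtermap (\<lambda>x. (x, x)) F"
  have "H.tends l (\<lambda>p. E j i (t (fst p)) (c (fst p)) (\<lambda>r. V r (fst p))) (E j i t0 c0 V0) ?F"
  proof (rule scale_tower_tends[OF E])
    show "((\<lambda>p. t (fst p)) \<longlongrightarrow> t0) ?F" using t(1) by (simp add: filterlim_filtermap)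
    show "\<forall>\<^sub>F p in ?F. t (fst p) \<in> I" using t(2) by (simp add: eventually_filtermap)
    show "H.tends (j + l) (\<lambda>p. c (fst p)) c0 ?F" using c by (simp add: ip_lim_filtermap)
    show "H.tends (j + l) (\<lambda>p. V r (fst p)) (V0 r) ?F" if "r < i" for r
      using V[OF that] by (simp add: ip_lim_filtermap)
  qed (rule t)
  then show ?thesis by (simp add: ip_lim_filtermap)
qed

lemma scale_tower_mem:
  assumes E: "scale_tower \<phi> E" and "h \<in> I" "u \<in> Hs (j + l)" "\<And>r. r < i \<Longrightarrow> v r \<in> Hs (j + l)"
  shows "E j i h u v \<in> Hs l"
  using scale_tower_tends_real[OF E, of "\<lambda>_. h" h bot j l "\<lambda>_. u" u i "\<lambda>r _. v r" v] assms
  by (auto simp: ip_lim_def)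

section \<open>Chain rule for a scale tower\<close>

lemma tends_deriv_imp_tends:
  assumes d: "H.deriv l f a x X" and f: "f x \<in> Hs l"
  shows "H.tends l f (f x) (at x within X)"
proof -
  have "((\<lambda>y. y - x) \<longlongrightarrow> x - x) (at x within X)" by (intro tendsto_intros)
  then have "H.tends l (\<lambda>y. f x + (y - x) *\<^sub>R ((f y - f x) /\<^sub>R (y - x))) (f x + (x - x) *\<^sub>R a) (at x within X)"
    using d f unfolding ip_deriv_def by (intro H.tends_add H.tends_const H.tends_scaleR)
  moreover have "\<forall>\<^sub>F y in at x within X. f x + (y - x) *\<^sub>R ((f y - f x) /\<^sub>R (y - x)) = f y"
    unfolding eventually_at_filter by (rule always_eventually) simp
  ultimately show ?thesis by (simp add: H.tends_cong)
qed

text \<open>First of three increments: time moves from \<open>t x\<close> to \<open>t y\<close>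
  while the other arguments already sit at \<open>y\<close>. The mean value point depends on
  \<open>y\<close>, so joint continuity of \<open>E (Suc j) i\<close> is used; this entry is the
  reason for the level \<open>Suc j + l\<close>.\<close>

lemma scale_tower_increment_h:
  assumes E: "scale_tower \<phi> E" and t: "\<And>y. y \<in> X \<Longrightarrow> t y \<in> I" "x \<in> X"
    and dt: "(t has_real_derivative \<tau>) (at x within X)"
    and c: "\<And>y. y \<in> X \<Longrightarrow> c y \<in> Hs (Suc j + l)" "H.tends (Suc j + l) c (c x) (at x within X)"
    and V: "\<And>r y. r < i \<Longrightarrow> y \<in> X \<Longrightarrow> V r y \<in> Hs (Suc j + l)"
      "\<And>r. r < i \<Longrightarrow> H.tends (Suc j + l) (V r) (V r x) (at x within X)"
  shows "H.tends l (\<lambda>y. (E j i (t y) (c y) (\<lambda>r. V r y) - E j i (t x) (c y) (\<lambda>r. V r y)) /\<^sub>R (y - x))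
    (\<tau> *\<^sub>R E (Suc j) i (t x) (c x) (\<lambda>r. V r x)) (at x within X)"
proof -
  let ?L = "E (Suc j) i (t x) (c x) (\<lambda>r. V r x)"
  let ?A = "\<lambda>y. E j i (t y) (c y) (\<lambda>r. V r y) - E j i (t x) (c y) (\<lambda>r. V r y)"
  let ?q = "\<lambda>y. (t y - t x) / (y - x)"
  have L: "?L \<in> Hs l" by (rule scale_tower_mem[OF E]) (use t c V in auto)
  have Em: "E j i h (c y) (\<lambda>r. V r y) \<in> Hs l" if "h \<in> I" "y \<in> X" for h y
    by (rule scale_tower_mem[OF E]) (use that c(1) V(1) in \<open>auto intro: Hs_mem[of _ "Suc j + l"]\<close>)
  have "\<exists>\<xi>\<in>I. \<bar>\<xi> - t x\<bar> \<le> \<bar>t y - t x\<bar> \<and>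
      H.nrm l (?A y - (t y - t x) *\<^sub>R ?L) \<le> \<bar>t y - t x\<bar> * H.nrm l (E (Suc j) i \<xi> (c y) (\<lambda>r. V r y) - ?L)"
    if y: "y \<in> X" for y
  proof (rule H.mean_value)
    show "H.deriv l (\<lambda>h. E j i h (c y) (\<lambda>r. V r y)) (E (Suc j) i h (c y) (\<lambda>r. V r y)) h I" if "h \<in> I" for h
      using that c(1) V(1) y by (intro scale_tower_deriv_h[OF E]) auto
  qed (use L Em t y in auto)
  then obtain \<xi> where \<xi>: "\<And>y. y \<in> X \<Longrightarrow> \<xi> y \<in> I" "\<And>y. y \<in> X \<Longrightarrow> \<bar>\<xi> y - t x\<bar> \<le> \<bar>t y - t x\<bar>"
    and bound: "\<And>y. y \<in> X \<Longrightarrow> H.nrm l (?A y - (t y - t x) *\<^sub>R ?L)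
      \<le> \<bar>t y - t x\<bar> * H.nrm l (E (Suc j) i (\<xi> y) (c y) (\<lambda>r. V r y) - ?L)"
    by metis
  have ev: "\<forall>\<^sub>F y in at x within X. y \<in> X \<and> y \<noteq> x"
    unfolding eventually_at_filter by (rule always_eventually) simp
  have q: "(?q \<longlongrightarrow> \<tau>) (at x within X)"
    using dt by (simp add: has_field_derivative_iff)
  have "(t \<longlongrightarrow> t x) (at x within X)"
    using DERIV_continuous[OF dt] by (simp add: continuous_within)
  then have "((\<lambda>y. \<bar>t y - t x\<bar>) \<longlongrightarrow> 0) (at x within X)"
    using LIM_zero tendsto_rabs_zero by blast
  \<comment> \<open>\<xi> is an arbitrary choice of mean value points; it converges because it is
    squeezed.\<close>
  then have "((\<lambda>y. \<xi> y - t x) \<longlongrightarrow> 0) (at x within X)"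
    by (rule Lim_null_comparison[rotated]) (use ev \<xi>(2) in \<open>auto elim: eventually_mono\<close>)
  then have \<xi>t: "(\<xi> \<longlongrightarrow> t x) (at x within X)" by (rule LIM_zero_cancel)
  have "H.tends l (\<lambda>y. E (Suc j) i (\<xi> y) (c y) (\<lambda>r. V r y)) ?L (at x within X)"
    by (rule scale_tower_tends_real[OF E \<xi>t])
      (use ev \<xi>(1) t c V in \<open>auto elim: eventually_mono\<close>)
  then have "((\<lambda>y. H.nrm l (E (Suc j) i (\<xi> y) (c y) (\<lambda>r. V r y) - ?L)) \<longlongrightarrow> 0) (at x within X)"
    by (simp add: ip_lim_def)
  from tendsto_mult[OF tendsto_rabs[OF q] this]
  have e: "((\<lambda>y. \<bar>?q y\<bar> * H.nrm l (E (Suc j) i (\<xi> y) (c y) (\<lambda>r. V r y) - ?L)) \<longlongrightarrow> 0) (at x within X)"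
    by simp
  have "H.tends l (\<lambda>y. ?A y /\<^sub>R (y - x) - ?q y *\<^sub>R ?L) 0 (at x within X)"
  proof (rule H.tends_dominated[OF H.mem_0 _ _ e])
    show "\<forall>\<^sub>F y in at x within X. ?A y /\<^sub>R (y - x) - ?q y *\<^sub>R ?L \<in> Hs l"
      using ev by eventually_elim (use Em t L in blast)
    show "\<forall>\<^sub>F y in at x within X. H.nrm l (?A y /\<^sub>R (y - x) - ?q y *\<^sub>R ?L - 0)
        \<le> \<bar>?q y\<bar> * H.nrm l (E (Suc j) i (\<xi> y) (c y) (\<lambda>r. V r y) - ?L)"
      using ev
    proof eventually_elim
      case (elim y)
      have S: "?A y - (t y - t x) *\<^sub>R ?L \<in> Hs l" using Em t L elim by blast
      have "?A y /\<^sub>R (y - x) - ?q y *\<^sub>R ?L - 0 = inverse (y - x) *\<^sub>R (?A y - (t y - t x) *\<^sub>R ?L)"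
        by (simp add: scaleR_diff_right divide_inverse mult.commute)
      then have "H.nrm l (?A y /\<^sub>R (y - x) - ?q y *\<^sub>R ?L - 0)
          = inverse \<bar>y - x\<bar> * H.nrm l (?A y - (t y - t x) *\<^sub>R ?L)"
        using H.nrm_scale[OF S] by simp
      also have "\<dots> \<le> inverse \<bar>y - x\<bar> * (\<bar>t y - t x\<bar> * H.nrm l (E (Suc j) i (\<xi> y) (c y) (\<lambda>r. V r y) - ?L))"
        by (intro mult_left_mono bound) (use elim in auto)
      also have "\<dots> = \<bar>?q y\<bar> * H.nrm l (E (Suc j) i (\<xi> y) (c y) (\<lambda>r. V r y) - ?L)"
        by (simp add: divide_inverse abs_mult)
      finally show ?case .
    qed
  qed
  from H.tends_add[OF this H.tends_scaleR[OF q H.tends_const[OF L]]] show ?thesis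
    by simp
qed

text \<open>Second increment: time is frozen and the base point moves along the segment from
  \<open>c x\<close> to \<open>c y\<close>. The direction \<open>c y - c x\<close> is replaced by
  the difference quotient, which converges at level \<open>j + l\<close>; joint continuity in the
  directions thus does the work of an operator norm bound.\<close>

lemma scale_tower_increment_u:
  assumes E: "scale_tower \<phi> E" and t: "t \<in> I" and x: "x \<in> X"
    and c: "\<And>y. y \<in> X \<Longrightarrow> c y \<in> Hs (j + l)" "H.deriv (j + l) c c1 x X"
    and V: "\<And>r y. r < i \<Longrightarrow> y \<in> X \<Longrightarrow> V r y \<in> Hs (j + l)"
      "\<And>r. r < i \<Longrightarrow> H.tends (j + l) (V r) (V r x) (at x within X)"
  shows "H.tends l (\<lambda>y. (E j i t (c y) (\<lambda>r. V r y) - E j i t (c x) (\<lambda>r. V r y)) /\<^sub>R (y - x))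
    (E j (Suc i) t (c x) ((\<lambda>r. V r x)(i := c1))) (at x within X)"
proof -
  let ?L = "E j (Suc i) t (c x) ((\<lambda>r. V r x)(i := c1))"
  let ?B = "\<lambda>y. E j i t (c y) (\<lambda>r. V r y) - E j i t (c x) (\<lambda>r. V r y)"
  let ?q = "\<lambda>y. (c y - c x) /\<^sub>R (y - x)"
  let ?D = "\<lambda>s y. E j (Suc i) t (c x + s *\<^sub>R (c y - c x)) ((\<lambda>r. V r y)(i := ?q y))"
  have c1: "c1 \<in> Hs (j + l)" using c(2) by (rule H.deriv_mem)
  have L: "?L \<in> Hs l" by (rule scale_tower_mem[OF E]) (use t c V x c1 in \<open>auto simp: less_Suc_eq\<close>)
  have w: "c y - c x \<in> Hs (j + l)" if "y \<in> X" for y using c(1) that x by blast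
  have up: "c x + s *\<^sub>R (c y - c x) \<in> Hs (j + l)" if "y \<in> X" for s y
    using c(1)[OF x] w[OF that] by blast
  have Em: "E j i t u (\<lambda>r. V r y) \<in> Hs l" if "u \<in> Hs (j + l)" "y \<in> X" for u y
    by (rule scale_tower_mem[OF E]) (use that t V(1) in auto)
  have Dm: "?D s y \<in> Hs l" if "y \<in> X" for s y
    by (rule scale_tower_mem[OF E]) (use that t V(1) up w in \<open>auto simp: less_Suc_eq\<close>)
  \<comment> \<open>Homogeneity as linearity with second coefficient 0. Slot \<open>i\<close> is
    first set to 0 because linearity wants all slots below \<open>Suc i\<close> in the space, and
    nothing is known of \<open>V i\<close>.\<close>
  have hom: "E j (Suc i) t (c x + s *\<^sub>R (c y - c x)) ((\<lambda>r. V r y)(i := c y - c x)) = (y - x) *\<^sub>R ?D s y"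
    if "y \<in> X" "y \<noteq> x" for s y
  proof -
    have "(y - x) *\<^sub>R ?q y + 0 *\<^sub>R ?q y = c y - c x" using that by simp
    moreover have "E j (Suc i) t (c x + s *\<^sub>R (c y - c x)) (((\<lambda>r. V r y)(i := 0))(i := (y - x) *\<^sub>R ?q y + 0 *\<^sub>R ?q y))
        = (y - x) *\<^sub>R E j (Suc i) t (c x + s *\<^sub>R (c y - c x)) (((\<lambda>r. V r y)(i := 0))(i := ?q y))
          + 0 *\<^sub>R E j (Suc i) t (c x + s *\<^sub>R (c y - c x)) (((\<lambda>r. V r y)(i := 0))(i := ?q y))"
    proof (rule scale_tower_linear[OF E])
      show "((\<lambda>r. V r y)(i := 0)) r \<in> Hs j" if "r < Suc i" for r
        using that V(1)[of r y] \<open>y \<in> X\<close> Hs_mem[of _ "j + l" j] by (auto simp: less_Suc_eq)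
      show "c x + s *\<^sub>R (c y - c x) \<in> Hs j" "?q y \<in> Hs j" "?q y \<in> Hs j"
        using Hs_mem[of _ "j + l" j] up[OF \<open>y \<in> X\<close>] w[OF \<open>y \<in> X\<close>] by auto
    qed (use t in auto)
    ultimately show ?thesis by simp
  qed
  \<comment> \<open>The segment is parametrised with end points 0 and 1. Only the bound 1 on the
    absolute value of \<xi> is retained, enough to make the intermediate point tend to
    \<open>c x\<close>.\<close>
  have "\<exists>\<xi>\<in>UNIV. \<bar>\<xi> - 0\<bar> \<le> \<bar>1 - 0\<bar> \<and>
      H.nrm l (E j i t (c x + 1 *\<^sub>R (c y - c x)) (\<lambda>r. V r y) - E j i t (c x + 0 *\<^sub>R (c y - c x)) (\<lambda>r. V r y)
          - (1 - 0) *\<^sub>R (y - x) *\<^sub>R ?L)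
        \<le> \<bar>1 - 0\<bar> * H.nrm l ((y - x) *\<^sub>R ?D \<xi> y - (y - x) *\<^sub>R ?L)"
    if y: "y \<in> X" "y \<noteq> x" for y
  proof (rule H.mean_value)
    show "H.deriv l (\<lambda>s. E j i t (c x + s *\<^sub>R (c y - c x)) (\<lambda>r. V r y)) ((y - x) *\<^sub>R ?D s y) s UNIV" for s
      unfolding hom[OF y, symmetric]
      using t c(1)[OF x] w[OF y(1)] V(1)[OF _ y(1)] by (intro scale_tower_deriv_u[OF E]) auto
    show "(y - x) *\<^sub>R ?L \<in> Hs l" by (rule H.mem_scale[OF L])
  qed (use Em up y in auto)
  then have "\<exists>\<xi>. \<bar>\<xi>\<bar> \<le> 1 \<and> H.nrm l (?B y - (y - x) *\<^sub>R ?L) \<le> \<bar>y - x\<bar> * H.nrm l (?D \<xi> y - ?L)"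
    if y: "y \<in> X" "y \<noteq> x" for y
  proof -
    obtain \<xi> where \<xi>: "\<bar>\<xi> - 0\<bar> \<le> \<bar>1 - 0\<bar>"
      "H.nrm l (E j i t (c x + 1 *\<^sub>R (c y - c x)) (\<lambda>r. V r y) - E j i t (c x + 0 *\<^sub>R (c y - c x)) (\<lambda>r. V r y)
          - (1 - 0) *\<^sub>R (y - x) *\<^sub>R ?L)
        \<le> \<bar>1 - 0\<bar> * H.nrm l ((y - x) *\<^sub>R ?D \<xi> y - (y - x) *\<^sub>R ?L)"
      using \<open>\<And>y. y \<in> X \<Longrightarrow> y \<noteq> x \<Longrightarrow> \<exists>\<xi>\<in>UNIV. _ y \<xi>\<close> y by blast
    have "H.nrm l ((y - x) *\<^sub>R ?D \<xi> y - (y - x) *\<^sub>R ?L) = \<bar>y - x\<bar> * H.nrm l (?D \<xi> y - ?L)"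
      unfolding scaleR_diff_right[symmetric] by (rule H.nrm_scale) (use Dm y L in blast)
    with \<xi> show ?thesis by (intro exI[of _ \<xi>]) simp
  qed
  then obtain \<xi> where \<xi>: "\<And>y. y \<in> X \<Longrightarrow> y \<noteq> x \<Longrightarrow> \<bar>\<xi> y\<bar> \<le> 1"
    and bound: "\<And>y. y \<in> X \<Longrightarrow> y \<noteq> x \<Longrightarrow> H.nrm l (?B y - (y - x) *\<^sub>R ?L) \<le> \<bar>y - x\<bar> * H.nrm l (?D (\<xi> y) y - ?L)"
    by metis
  have ev: "\<forall>\<^sub>F y in at x within X. y \<in> X \<and> y \<noteq> x"
    unfolding eventually_at_filter by (rule always_eventually) simp
  have q: "H.tends (j + l) ?q c1 (at x within X)" using c(2) by (simp add: ip_deriv_def)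
  have "H.tends (j + l) c (c x) (at x within X)"
    by (rule tends_deriv_imp_tends[OF c(2) c(1)[OF x]])
  then have "H.tends (j + l) (\<lambda>y. c y - c x) (c x - c x) (at x within X)"
    using c(1)[OF x] by (intro H.tends_diff H.tends_const)
  then have l0: "((\<lambda>y. H.nrm (j + l) (c y - c x)) \<longlongrightarrow> 0) (at x within X)" by (simp add: ip_lim_def)
  have "H.tends (j + l) (\<lambda>y. c x + \<xi> y *\<^sub>R (c y - c x)) (c x) (at x within X)"
  proof (rule H.tends_dominated[OF c(1)[OF x] _ _ l0])
    show "\<forall>\<^sub>F y in at x within X. c x + \<xi> y *\<^sub>R (c y - c x) \<in> Hs (j + l)"
      using ev by eventually_elim (use up in blast)
    show "\<forall>\<^sub>F y in at x within X. H.nrm (j + l) (c x + \<xi> y *\<^sub>R (c y - c x) - c x) \<le> H.nrm (j + l) (c y - c x)"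
      using ev
    proof eventually_elim
      case (elim y)
      have "\<bar>\<xi> y\<bar> * H.nrm (j + l) (c y - c x) \<le> 1 * H.nrm (j + l) (c y - c x)"
        using elim \<xi> w by (intro mult_right_mono H.nrm_nonneg) auto
      then show ?case using H.nrm_scale[OF w] elim by simp
    qed
  qed
  moreover have "H.tends (j + l) (\<lambda>y. ((\<lambda>r. V r y)(i := ?q y)) r) (((\<lambda>r. V r x)(i := c1)) r) (at x within X)"
    if "r < Suc i" for r
    using that V(2) q by (auto simp: less_Suc_eq)
  ultimately have "H.tends l (\<lambda>y. E j (Suc i) t (c x + \<xi> y *\<^sub>R (c y - c x)) (\<lambda>r. ((\<lambda>r. V r y)(i := ?q y)) r)) ?L (at x within X)"
    using t by (intro scale_tower_tends_real[OF E]) auto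
  then have e: "((\<lambda>y. H.nrm l (?D (\<xi> y) y - ?L)) \<longlongrightarrow> 0) (at x within X)"
    by (simp only: ip_lim_def)
  show "H.tends l (\<lambda>y. ?B y /\<^sub>R (y - x)) ?L (at x within X)"
  proof (rule H.tends_dominated[OF L _ _ e])
    show "\<forall>\<^sub>F y in at x within X. ?B y /\<^sub>R (y - x) \<in> Hs l"
      using ev by eventually_elim (use Em c(1) x in blast)
    show "\<forall>\<^sub>F y in at x within X. H.nrm l (?B y /\<^sub>R (y - x) - ?L) \<le> H.nrm l (?D (\<xi> y) y - ?L)"
      using ev
    proof eventually_elim
      case (elim y)
      have S: "?B y - (y - x) *\<^sub>R ?L \<in> Hs l" using Em c(1) x L elim by blast
      have "inverse (y - x) *\<^sub>R (y - x) *\<^sub>R ?L = ?L" using elim by simp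
      then have "?B y /\<^sub>R (y - x) - ?L = inverse (y - x) *\<^sub>R (?B y - (y - x) *\<^sub>R ?L)"
        by (simp only: scaleR_diff_right)
      then have "H.nrm l (?B y /\<^sub>R (y - x) - ?L) = inverse \<bar>y - x\<bar> * H.nrm l (?B y - (y - x) *\<^sub>R ?L)"
        using H.nrm_scale[OF S] by simp
      also have "\<dots> \<le> inverse \<bar>y - x\<bar> * (\<bar>y - x\<bar> * H.nrm l (?D (\<xi> y) y - ?L))"
        by (intro mult_left_mono bound) (use elim in auto)
      also have "\<dots> = H.nrm l (?D (\<xi> y) y - ?L)" using elim by simp
      finally show ?case .
    qed
  qed
qed

text \<open>Third increment: the product rule for a multilinear map, obtained by changing the
  directions one at a time.\<close>

lemma scale_tower_increment_v:
  assumes E: "scale_tower \<phi> E" and t: "t \<in> I" and x: "x \<in> X" and u: "u \<in> Hs (j + l)"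
    and V: "\<And>r y. r < i \<Longrightarrow> y \<in> X \<Longrightarrow> V r y \<in> Hs (j + l)"
      "\<And>r. r < i \<Longrightarrow> H.deriv (j + l) (V r) (V1 r) x X"
  shows "H.tends l (\<lambda>y. (E j i t u (\<lambda>r. V r y) - E j i t u (\<lambda>r. V r x)) /\<^sub>R (y - x))
    (\<Sum>r<i. E j i t u ((\<lambda>r. V r x)(r := V1 r))) (at x within X)"
proof -
  let ?q = "\<lambda>r y. (V r y - V r x) /\<^sub>R (y - x)"
  \<comment> \<open>Slots below \<open>r\<close> are already at \<open>x\<close>, the others still
    at \<open>y\<close>. Passing from \<open>W r\<close> to \<open>W (Suc r)\<close> changes slot
    \<open>r\<close> alone, and \<open>W 0\<close>, \<open>W i\<close> are the two ends of the
    telescoping sum.\<close>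
  define W where "W r y r' = (if r' < r then V r' x else V r' y)" for r y r'
  have WS: "W r y r' \<in> Hs (j + l)" if "r' < i" "y \<in> X" for r y r'
    using that V(1) x by (simp add: W_def)
  have lim: "H.tends l (\<lambda>y. E j i t u ((W r y)(r := ?q r y))) (E j i t u ((\<lambda>r. V r x)(r := V1 r))) (at x within X)"
    if r: "r < i" for r
  proof -
    have "H.tends (j + l) (\<lambda>y. ((W r y)(r := ?q r y)) r') (((\<lambda>r. V r x)(r := V1 r)) r') (at x within X)"
      if r': "r' < i" for r'
    proof -
      have "H.tends (j + l) (V r') (V r' x) (at x within X)"
        by (rule tends_deriv_imp_tends[OF V(2)[OF r'] V(1)[OF r' x]])
      then show ?thesis
        using V(2)[OF r] V(1)[OF r' x] H.tends_const[of "V r' x" "j + l"]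
        by (cases "r' < r") (auto simp: W_def ip_deriv_def)
    qed
    then have "H.tends l (\<lambda>y. E j i t u (\<lambda>r'. ((W r y)(r := ?q r y)) r')) (E j i t u ((\<lambda>r. V r x)(r := V1 r))) (at x within X)"
      using t u by (intro scale_tower_tends_real[OF E]) (auto intro: H.tends_const)
    then show ?thesis by (simp only:)
  qed
  have eq: "(E j i t u (\<lambda>r. V r y) - E j i t u (\<lambda>r. V r x)) /\<^sub>R (y - x) = (\<Sum>r<i. E j i t u ((W r y)(r := ?q r y)))"
    if y: "y \<in> X" "y \<noteq> x" for y
  proof -
    have step: "E j i t u (W r y) - E j i t u (W (Suc r) y) = (y - x) *\<^sub>R E j i t u ((W r y)(r := ?q r y))"
      if r: "r < i" for r
    proof -
      have "(y - x) *\<^sub>R ?q r y + 1 *\<^sub>R V r x = V r y" using y by simp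
      moreover have "E j i t u ((W r y)(r := (y - x) *\<^sub>R ?q r y + 1 *\<^sub>R V r x))
          = (y - x) *\<^sub>R E j i t u ((W r y)(r := ?q r y)) + 1 *\<^sub>R E j i t u ((W r y)(r := V r x))"
      proof (rule scale_tower_linear[OF E t _ _ _ r])
        show "W r y r' \<in> Hs j" if "r' < i" for r'
          using WS[OF that y(1)] Hs_mem[of _ "j + l" j] by simp
        have "?q r y \<in> Hs (j + l)" using V(1)[OF r] x y by blast
        then show "u \<in> Hs j" "?q r y \<in> Hs j" "V r x \<in> Hs j"
          using u V(1)[OF r x] Hs_mem[of _ "j + l" j] by auto
      qed
      moreover have "(W r y)(r := V r y) = W r y" "(W r y)(r := V r x) = W (Suc r) y"
        by (auto simp: W_def fun_eq_iff less_Suc_eq)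
      ultimately show ?thesis by simp
    qed
    have "E j i t u (\<lambda>r. V r y) - E j i t u (\<lambda>r. V r x) = E j i t u (W 0 y) - E j i t u (W i y)"
      using scale_tower_cong[OF E, of i "\<lambda>r. V r x" "W i y"]
        scale_tower_cong[OF E, of i "\<lambda>r. V r y" "W 0 y"] by (simp add: W_def)
    also have "\<dots> = (\<Sum>r<i. E j i t u (W r y) - E j i t u (W (Suc r) y))"
      by (rule sum_lessThan_telescope'[symmetric])
    also have "\<dots> = (y - x) *\<^sub>R (\<Sum>r<i. E j i t u ((W r y)(r := ?q r y)))"
      unfolding scaleR_sum_right by (intro sum.cong) (use step in auto)
    finally show ?thesis using y by simp
  qed
  have ev: "\<forall>\<^sub>F y in at x within X. (E j i t u (\<lambda>r. V r y) - E j i t u (\<lambda>r. V r x)) /\<^sub>R (y - x)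
      = (\<Sum>r<i. E j i t u ((W r y)(r := ?q r y)))"
    unfolding eventually_at_filter by (rule always_eventually) (use eq in blast)
  have "H.tends l (\<lambda>y. \<Sum>r<i. E j i t u ((W r y)(r := ?q r y))) (\<Sum>r<i. E j i t u ((\<lambda>r. V r x)(r := V1 r))) (at x within X)"
    by (rule H.tends_sum) (use lim in auto)
  then show ?thesis using H.tends_cong[OF ev] by blast
qed

text \<open>Only the time increment asks for arguments of level \<open>Suc j + l\<close>; their
  derivatives enter at level \<open>j + l\<close>. This is the pattern of \<open>scale_diff\<close>:
  continuity one level above the derivatives.\<close>

lemma scale_tower_chain:
  assumes E: "scale_tower \<phi> E" and t: "\<And>y. y \<in> X \<Longrightarrow> t y \<in> I" "x \<in> X"
    and dt: "(t has_real_derivative \<tau>) (at x within X)"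
    and c: "\<And>y. y \<in> X \<Longrightarrow> c y \<in> Hs (Suc j + l)" "H.tends (Suc j + l) c (c x) (at x within X)"
      "H.deriv (j + l) c c1 x X"
    and V: "\<And>r y. r < i \<Longrightarrow> y \<in> X \<Longrightarrow> V r y \<in> Hs (Suc j + l)"
      "\<And>r. r < i \<Longrightarrow> H.tends (Suc j + l) (V r) (V r x) (at x within X)"
      "\<And>r. r < i \<Longrightarrow> H.deriv (j + l) (V r) (V1 r) x X"
  shows "H.deriv l (\<lambda>y. E j i (t y) (c y) (\<lambda>r. V r y))
    (\<tau> *\<^sub>R E (Suc j) i (t x) (c x) (\<lambda>r. V r x) + E j (Suc i) (t x) (c x) ((\<lambda>r. V r x)(i := c1))
      + (\<Sum>r<i. E j i (t x) (c x) ((\<lambda>r. V r x)(r := V1 r)))) x X"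
proof -
  have c': "c y \<in> Hs (j + l)" if "y \<in> X" for y using Hs_mem[OF c(1)[OF that]] by simp
  have V': "V r y \<in> Hs (j + l)" if "r < i" "y \<in> X" for r y using Hs_mem[OF V(1)[OF that]] by simp
  have Vl: "H.tends (j + l) (V r) (V r x) (at x within X)" if "r < i" for r
    using tends_level[OF V(2)[OF that]] by simp
  have tx: "t x \<in> I" using t by blast
  have "H.tends l (\<lambda>y. (E j i (t y) (c y) (\<lambda>r. V r y) - E j i (t x) (c y) (\<lambda>r. V r y)) /\<^sub>R (y - x)
      + (E j i (t x) (c y) (\<lambda>r. V r y) - E j i (t x) (c x) (\<lambda>r. V r y)) /\<^sub>R (y - x)
      + (E j i (t x) (c x) (\<lambda>r. V r y) - E j i (t x) (c x) (\<lambda>r. V r x)) /\<^sub>R (y - x))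
    (\<tau> *\<^sub>R E (Suc j) i (t x) (c x) (\<lambda>r. V r x) + E j (Suc i) (t x) (c x) ((\<lambda>r. V r x)(i := c1))
      + (\<Sum>r<i. E j i (t x) (c x) ((\<lambda>r. V r x)(r := V1 r)))) (at x within X)"
    by (intro H.tends_add scale_tower_increment_h[OF E t dt c(1,2) V(1,2)]
        scale_tower_increment_u[OF E tx t(2) c' c(3) V' Vl]
        scale_tower_increment_v[OF E tx t(2) c'[OF t(2)] V' V(3)])
  then show ?thesis by (simp add: ip_deriv_def scaleR_add_right[symmetric])
qed

section \<open>Two-parameter families losing one space per derivative\<close>

definition scale_cont :: "nat \<Rightarrow> (real \<Rightarrow> real \<Rightarrow> 'a) \<Rightarrow> bool" where
  "scale_cont l c \<longleftrightarrow>
     (\<forall>x\<in>I. \<forall>y\<in>I. H.tends l (\<lambda>p. c (fst p) (snd p)) (c x y) (at (x, y) within I \<times> I))"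

text \<open>\<open>n\<close> derivatives lead from level \<open>N + l\<close> to level
  \<open>N - n + l\<close>. The recursion through the existence of partial derivatives spares any
  enumeration of mixed ones; that they commute is proved only when the Leibniz rule calls for
  it.\<close>

primrec scale_diff :: "nat \<Rightarrow> nat \<Rightarrow> (real \<Rightarrow> real \<Rightarrow> 'a) \<Rightarrow> bool" where
  "scale_diff 0 l c = scale_cont l c"
| "scale_diff (Suc N) l c =
     (scale_cont (Suc (N + l)) c \<and>
      (\<exists>cx cy. (\<forall>x\<in>I. \<forall>y\<in>I. H.deriv (N + l) (\<lambda>x. c x y) (cx x y) x I \<and>
                               H.deriv (N + l) (\<lambda>y. c x y) (cy x y) y I) \<and>
               scale_diff N l cx \<and> scale_diff N l cy))"

lemma scale_cont_mem: "scale_cont l c \<Longrightarrow> x \<in> I \<Longrightarrow> y \<in> I \<Longrightarrow> c x y \<in> Hs l"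
  by (auto simp: scale_cont_def ip_lim_def)

lemma scale_cont_level: "scale_cont m c \<Longrightarrow> l \<le> m \<Longrightarrow> scale_cont l c"
  unfolding scale_cont_def using tends_level by blast

lemma filterlim_Pair_within:
  assumes "y0 \<in> I"
  shows "filterlim (\<lambda>x. (x, y0)) (at (x0, y0) within I \<times> I) (at x0 within I)"
    and "filterlim (\<lambda>x. (y0, x)) (at (y0, x0) within I \<times> I) (at x0 within I)"
  unfolding filterlim_at
  by (use assms in \<open>auto intro!: tendsto_eq_intros simp: eventually_at_filter\<close>)

lemma scale_cont_section:
  assumes "scale_cont l c" "x \<in> I" "y \<in> I"
  shows "H.tends l (\<lambda>x. c x y) (c x y) (at x within I)"
    and "H.tends l (\<lambda>y. c x y) (c x y) (at y within I)"
proof -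
  have *: "H.tends l (\<lambda>p. c (fst p) (snd p)) (c x y) (at (x, y) within I \<times> I)"
    using assms by (auto simp: scale_cont_def)
  show "H.tends l (\<lambda>x. c x y) (c x y) (at x within I)"
    using H.tends_compose[OF * filterlim_Pair_within(1)[OF assms(3)]] by simp
  show "H.tends l (\<lambda>y. c x y) (c x y) (at y within I)"
    using H.tends_compose[OF * filterlim_Pair_within(2)[OF assms(2)]] by simp
qed

lemma scale_cont_cong:
  assumes "\<And>x y. x \<in> I \<Longrightarrow> y \<in> I \<Longrightarrow> c x y = c' x y"
  shows "scale_cont l c \<longleftrightarrow> scale_cont l c'"
proof -
  have "H.tends l (\<lambda>p. c (fst p) (snd p)) (c x y) (at (x, y) within I \<times> I) \<longleftrightarrow>
        H.tends l (\<lambda>p. c' (fst p) (snd p)) (c' x y) (at (x, y) within I \<times> I)"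
    if "x \<in> I" "y \<in> I" for x y
  proof -
    have "\<forall>\<^sub>F p in at (x, y) within I \<times> I. c (fst p) (snd p) = c' (fst p) (snd p)"
      unfolding eventually_at_filter by (rule always_eventually) (use assms in auto)
    from H.tends_cong[OF this] show ?thesis using assms[OF that] by simp
  qed
  then show ?thesis by (simp add: scale_cont_def)
qed

lemma scale_diff_cont: "scale_diff N l c \<Longrightarrow> scale_cont (N + l) c"
  by (cases N) simp_all

lemma scale_diff_cong:
  assumes "\<And>x y. x \<in> I \<Longrightarrow> y \<in> I \<Longrightarrow> c x y = c' x y"
  shows "scale_diff N l c \<longleftrightarrow> scale_diff N l c'"
proof (cases N)
  case 0
  then show ?thesis using scale_cont_cong[OF assms] by simp
next
  case (Suc M)
  have "H.deriv (M + l) (\<lambda>x. c x y) a x I \<longleftrightarrow> H.deriv (M + l) (\<lambda>x. c' x y) a x I"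
    and "H.deriv (M + l) (\<lambda>y. c x y) a y I \<longleftrightarrow> H.deriv (M + l) (\<lambda>y. c' x y) a y I"
    if "x \<in> I" "y \<in> I" for x y a
    by (rule H.deriv_cong; use that assms in blast)+
  moreover have "scale_cont (Suc (M + l)) c \<longleftrightarrow> scale_cont (Suc (M + l)) c'"
    by (rule scale_cont_cong[OF assms])
  ultimately show ?thesis by (simp add: Suc)
qed

lemma scale_diff_SucE:
  assumes "scale_diff (Suc N) l c"
  obtains cx cy where "scale_cont (Suc (N + l)) c"
    and "\<And>x y. x \<in> I \<Longrightarrow> y \<in> I \<Longrightarrow> H.deriv (N + l) (\<lambda>x. c x y) (cx x y) x I"
    and "\<And>x y. x \<in> I \<Longrightarrow> y \<in> I \<Longrightarrow> H.deriv (N + l) (\<lambda>y. c x y) (cy x y) y I"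
    and "scale_diff N l cx" "scale_diff N l cy"
proof -
  from assms obtain cx cy where "scale_cont (Suc (N + l)) c"
    and "\<forall>x\<in>I. \<forall>y\<in>I. H.deriv (N + l) (\<lambda>x. c x y) (cx x y) x I \<and>
                       H.deriv (N + l) (\<lambda>y. c x y) (cy x y) y I"
    and "scale_diff N l cx" "scale_diff N l cy"
    unfolding scale_diff.simps by blast
  then show ?thesis by (intro that) blast+
qed

lemma scale_diff_SucI:
  assumes "scale_cont (Suc (N + l)) c"
    and "\<And>x y. x \<in> I \<Longrightarrow> y \<in> I \<Longrightarrow> H.deriv (N + l) (\<lambda>x. c x y) (cx x y) x I"
    and "\<And>x y. x \<in> I \<Longrightarrow> y \<in> I \<Longrightarrow> H.deriv (N + l) (\<lambda>y. c x y) (cy x y) y I"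
    and "scale_diff N l cx" "scale_diff N l cy"
  shows "scale_diff (Suc N) l c"
  unfolding scale_diff.simps using assms by blast

lemma scale_diff_level: "scale_diff N (Suc l) c \<Longrightarrow> scale_diff N l c"
proof (induction N arbitrary: c)
  case 0
  then show ?case using scale_cont_level[of "Suc l" c l] by simp
next
  case (Suc N)
  from Suc.prems obtain cx cy where *: "scale_cont (Suc (N + Suc l)) c"
    "\<And>x y. x \<in> I \<Longrightarrow> y \<in> I \<Longrightarrow> H.deriv (N + Suc l) (\<lambda>x. c x y) (cx x y) x I"
    "\<And>x y. x \<in> I \<Longrightarrow> y \<in> I \<Longrightarrow> H.deriv (N + Suc l) (\<lambda>y. c x y) (cy x y) y I"
    "scale_diff N (Suc l) cx" "scale_diff N (Suc l) cy"
    by (rule scale_diff_SucE) (rule that)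
  show ?case
  proof (rule scale_diff_SucI[where cx = cx and cy = cy])
    show "scale_cont (Suc (N + l)) c" by (rule scale_cont_level[OF *(1)]) simp
    fix x y assume "x \<in> I" "y \<in> I"
    then show "H.deriv (N + l) (\<lambda>x. c x y) (cx x y) x I" "H.deriv (N + l) (\<lambda>y. c x y) (cy x y) y I"
      using deriv_level[OF *(2)] deriv_level[OF *(3)] by auto
  qed (intro Suc.IH *)+
qed

text \<open>The exchange that makes the chain rule close: one derivative given up is one level
  gained. It feeds the term with \<open>E (Suc j) i\<close>, whose arguments have to be one level
  higher.\<close>

lemma scale_diff_Suc_level: "scale_diff (Suc N) l c \<Longrightarrow> scale_diff N (Suc l) c"
proof (induction N arbitrary: c)
  case 0
  then show ?case by simp
next
  case (Suc N)
  from Suc.prems obtain cx cy where *: "scale_cont (Suc (Suc N + l)) c"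
    "\<And>x y. x \<in> I \<Longrightarrow> y \<in> I \<Longrightarrow> H.deriv (Suc N + l) (\<lambda>x. c x y) (cx x y) x I"
    "\<And>x y. x \<in> I \<Longrightarrow> y \<in> I \<Longrightarrow> H.deriv (Suc N + l) (\<lambda>y. c x y) (cy x y) y I"
    "scale_diff (Suc N) l cx" "scale_diff (Suc N) l cy"
    by (rule scale_diff_SucE) (rule that)
  show ?case
    by (rule scale_diff_SucI[where cx = cx and cy = cy]) (use * Suc.IH in simp_all)
qed

lemma scale_diff_Suc: "scale_diff (Suc N) l c \<Longrightarrow> scale_diff N l c"
  by (rule scale_diff_level[OF scale_diff_Suc_level])

lemma scale_cont_add:
  "scale_cont l c \<Longrightarrow> scale_cont l c' \<Longrightarrow> scale_cont l (\<lambda>x y. c x y + c' x y)"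
  by (simp add: scale_cont_def H.tends_add)

lemma scale_diff_add:
  "scale_diff N l c \<Longrightarrow> scale_diff N l c' \<Longrightarrow> scale_diff N l (\<lambda>x y. c x y + c' x y)"
proof (induction N arbitrary: c c')
  case 0
  then show ?case using scale_cont_add[of l c c'] by simp
next
  case (Suc N)
  from Suc.prems(1) obtain cx cy where *: "scale_cont (Suc (N + l)) c"
    "\<And>x y. x \<in> I \<Longrightarrow> y \<in> I \<Longrightarrow> H.deriv (N + l) (\<lambda>x. c x y) (cx x y) x I"
    "\<And>x y. x \<in> I \<Longrightarrow> y \<in> I \<Longrightarrow> H.deriv (N + l) (\<lambda>y. c x y) (cy x y) y I"
    "scale_diff N l cx" "scale_diff N l cy"
    by (rule scale_diff_SucE) (rule that)
  from Suc.prems(2) obtain dx dy where d: "scale_cont (Suc (N + l)) c'"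
    "\<And>x y. x \<in> I \<Longrightarrow> y \<in> I \<Longrightarrow> H.deriv (N + l) (\<lambda>x. c' x y) (dx x y) x I"
    "\<And>x y. x \<in> I \<Longrightarrow> y \<in> I \<Longrightarrow> H.deriv (N + l) (\<lambda>y. c' x y) (dy x y) y I"
    "scale_diff N l dx" "scale_diff N l dy"
    by (rule scale_diff_SucE) (rule that)
  show ?case
    by (rule scale_diff_SucI[where cx = "\<lambda>x y. cx x y + dx x y" and cy = "\<lambda>x y. cy x y + dy x y"])
      (intro scale_cont_add H.deriv_add Suc.IH * d; assumption)+
qed

lemma scale_cont_scaleR: "scale_cont l c \<Longrightarrow> scale_cont l (\<lambda>x y. k *\<^sub>R c x y)"
  by (simp add: scale_cont_def H.tends_scaleR)

lemma scale_diff_scaleR: "scale_diff N l c \<Longrightarrow> scale_diff N l (\<lambda>x y. k *\<^sub>R c x y)"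
proof (induction N arbitrary: c)
  case 0
  then show ?case using scale_cont_scaleR[of l c k] by simp
next
  case (Suc N)
  from Suc.prems(1) obtain cx cy where *: "scale_cont (Suc (N + l)) c"
    "\<And>x y. x \<in> I \<Longrightarrow> y \<in> I \<Longrightarrow> H.deriv (N + l) (\<lambda>x. c x y) (cx x y) x I"
    "\<And>x y. x \<in> I \<Longrightarrow> y \<in> I \<Longrightarrow> H.deriv (N + l) (\<lambda>y. c x y) (cy x y) y I"
    "scale_diff N l cx" "scale_diff N l cy"
    by (rule scale_diff_SucE) (rule that)
  show ?case
    by (rule scale_diff_SucI[where cx = "\<lambda>x y. k *\<^sub>R cx x y" and cy = "\<lambda>x y. k *\<^sub>R cy x y"])
      (intro scale_cont_scaleR H.deriv_scaleR Suc.IH *; assumption)+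
qed

lemma scale_diff_const: "a \<in> Hs (N + l) \<Longrightarrow> scale_diff N l (\<lambda>_ _. a)"
proof (induction N arbitrary: a)
  case 0
  then show ?case by (simp add: scale_cont_def H.tends_const)
next
  case (Suc N)
  then have a: "a \<in> Hs (N + l)" using Hs_mem[of a "Suc N + l" "N + l"] by simp
  show ?case
    by (rule scale_diff_SucI[where cx = "\<lambda>_ _. 0" and cy = "\<lambda>_ _. 0"])
      (use Suc a in \<open>auto simp: scale_cont_def intro: H.tends_const H.deriv_const\<close>)
qed

lemma scale_diff_sum:
  "(\<And>r. r \<in> A \<Longrightarrow> scale_diff N l (c r)) \<Longrightarrow> scale_diff N l (\<lambda>x y. \<Sum>r\<in>A. c r x y)"
proof (induction A rule: infinite_finite_induct)
  case (insert r A)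
  have "scale_diff N l (\<lambda>x y. c r x y + (\<Sum>r\<in>A. c r x y))"
    by (rule scale_diff_add) (use insert in auto)
  then show ?case by (simp only: sum.insert[OF insert(1,2)])
qed (simp_all add: scale_diff_const)

lemma scale_tower_scale_cont:
  assumes E: "scale_tower \<phi> E"
    and t: "\<And>x y. x \<in> I \<Longrightarrow> y \<in> I \<Longrightarrow> p * x + q * y \<in> I"
    and c: "scale_cont (j + l) c" and V: "\<And>r. r < i \<Longrightarrow> scale_cont (j + l) (V r)"
  shows "scale_cont l (\<lambda>x y. E j i (p * x + q * y) (c x y) (\<lambda>r. V r x y))"
  unfolding scale_cont_def
proof (intro ballI)
  fix x y assume xy: "x \<in> I" "y \<in> I"
  show "H.tends l (\<lambda>z. E j i (p * fst z + q * snd z) (c (fst z) (snd z)) (\<lambda>r. V r (fst z) (snd z)))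
      (E j i (p * x + q * y) (c x y) (\<lambda>r. V r x y)) (at (x, y) within I \<times> I)"
  proof (rule scale_tower_tends[OF E])
    show "((\<lambda>z. p * fst z + q * snd z) \<longlongrightarrow> p * x + q * y) (at (x, y) within I \<times> I)"
      by (auto intro!: tendsto_eq_intros)
    show "\<forall>\<^sub>F z in at (x, y) within I \<times> I. p * fst z + q * snd z \<in> I"
      unfolding eventually_at_filter by (rule always_eventually) (use t in auto)
    show "p * x + q * y \<in> I" by (rule t[OF xy])
    show "H.tends (j + l) (\<lambda>z. c (fst z) (snd z)) (c x y) (at (x, y) within I \<times> I)"
      using c xy by (auto simp: scale_cont_def)
    show "H.tends (j + l) (\<lambda>z. V r (fst z) (snd z)) (V r x y) (at (x, y) within I \<times> I)" if "r < i" for r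
      using V[OF that] xy by (auto simp: scale_cont_def)
  qed
qed

text \<open>Each partial derivative of such a composite is a sum of composites of the same shape,
  with \<open>(Suc j, i)\<close>, \<open>(j, Suc i)\<close> and \<open>(j, i)\<close>; hence the
  induction on \<open>N\<close> for all \<open>j\<close>, \<open>i\<close>, \<open>c\<close>,
  \<open>V\<close> at once. The time \<open>p * x + q * y\<close> lets either parameter be the step
  size.\<close>

theorem scale_tower_scale_diff:
  assumes E: "scale_tower \<phi> E"
    and t: "\<And>x y. x \<in> I \<Longrightarrow> y \<in> I \<Longrightarrow> p * x + q * y \<in> I"
    and c: "scale_diff N (j + l) c" and V: "\<And>r. r < i \<Longrightarrow> scale_diff N (j + l) (V r)"
  shows "scale_diff N l (\<lambda>x y. E j i (p * x + q * y) (c x y) (\<lambda>r. V r x y))"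
  using c V
proof (induction N arbitrary: j i c V)
  case 0
  then show ?case using scale_tower_scale_cont[OF E t, of j l c i V] by simp
next
  case (Suc N)
  from Suc.prems(1) obtain cx cy where c: "scale_cont (Suc (N + (j + l))) c"
    "\<And>x y. x \<in> I \<Longrightarrow> y \<in> I \<Longrightarrow> H.deriv (N + (j + l)) (\<lambda>x. c x y) (cx x y) x I"
    "\<And>x y. x \<in> I \<Longrightarrow> y \<in> I \<Longrightarrow> H.deriv (N + (j + l)) (\<lambda>y. c x y) (cy x y) y I"
    "scale_diff N (j + l) cx" "scale_diff N (j + l) cy"
    by (rule scale_diff_SucE) (rule that)
  \<comment> \<open>Collecting the data of one direction in a predicate allows the partial
    derivatives to be chosen for all \<open>r < i\<close> at once.\<close>
  define P where "P r Vx Vy \<longleftrightarrow> scale_cont (Suc (N + (j + l))) (V r) \<and>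
    (\<forall>x\<in>I. \<forall>y\<in>I. H.deriv (N + (j + l)) (\<lambda>x. V r x y) (Vx x y) x I \<and>
                    H.deriv (N + (j + l)) (\<lambda>y. V r x y) (Vy x y) y I) \<and>
    scale_diff N (j + l) Vx \<and> scale_diff N (j + l) Vy" for r Vx Vy
  have "\<exists>Vx Vy. P r Vx Vy" if "r < i" for r
    using Suc.prems(2)[OF that] unfolding scale_diff.simps P_def by blast
  then obtain Vx Vy where P: "\<And>r. r < i \<Longrightarrow> P r (Vx r) (Vy r)" by metis
  have V: "\<And>r. r < i \<Longrightarrow> scale_cont (Suc (N + (j + l))) (V r)"
    "\<And>r x y. r < i \<Longrightarrow> x \<in> I \<Longrightarrow> y \<in> I \<Longrightarrow> H.deriv (N + (j + l)) (\<lambda>x. V r x y) (Vx r x y) x I"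
    "\<And>r x y. r < i \<Longrightarrow> x \<in> I \<Longrightarrow> y \<in> I \<Longrightarrow> H.deriv (N + (j + l)) (\<lambda>y. V r x y) (Vy r x y) y I"
    "\<And>r. r < i \<Longrightarrow> scale_diff N (j + l) (Vx r)" "\<And>r. r < i \<Longrightarrow> scale_diff N (j + l) (Vy r)"
    using P unfolding P_def by blast+
  have c': "scale_diff N (j + l) c" "scale_diff N (Suc j + l) c"
    using scale_diff_Suc[OF Suc.prems(1)] scale_diff_Suc_level[OF Suc.prems(1)] by simp_all
  have V': "scale_diff N (j + l) (V r)" "scale_diff N (Suc j + l) (V r)" if "r < i" for r
    using scale_diff_Suc[OF Suc.prems(2)[OF that]] scale_diff_Suc_level[OF Suc.prems(2)[OF that]] by simp_all
  \<comment> \<open>The chain rule gives both partial derivatives this form, with \<tau> equal to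
    \<open>p\<close> or \<open>q\<close>.\<close>
  let ?d = "\<lambda>\<tau> c1 V1 x y. \<tau> *\<^sub>R E (Suc j) i (p * x + q * y) (c x y) (\<lambda>r. V r x y)
      + E j (Suc i) (p * x + q * y) (c x y) ((\<lambda>r. V r x y)(i := c1 x y))
      + (\<Sum>r<i. E j i (p * x + q * y) (c x y) ((\<lambda>r. V r x y)(r := V1 r x y)))"
  have diff: "scale_diff N l (?d \<tau> c1 V1)"
    if c1: "scale_diff N (j + l) c1" and V1: "\<And>r. r < i \<Longrightarrow> scale_diff N (j + l) (V1 r)" for \<tau> c1 V1
  proof (intro scale_diff_add scale_diff_scaleR scale_diff_sum)
    show "scale_diff N l (\<lambda>x y. E (Suc j) i (p * x + q * y) (c x y) (\<lambda>r. V r x y))"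
      by (rule Suc.IH[OF c'(2) V'(2)])
    have "scale_diff N l (\<lambda>x y. E j (Suc i) (p * x + q * y) (c x y) (\<lambda>r. (V(i := c1)) r x y))"
      by (rule Suc.IH[OF c'(1)]) (use V' c1 in \<open>auto simp: less_Suc_eq\<close>)
    moreover have "(\<lambda>r. (V(i := c1)) r x y) = (\<lambda>r. V r x y)(i := c1 x y)" for x y by auto
    ultimately show "scale_diff N l (\<lambda>x y. E j (Suc i) (p * x + q * y) (c x y) ((\<lambda>r. V r x y)(i := c1 x y)))"
      by (simp only:)
    fix r assume "r \<in> {..<i}"
    then have r: "r < i" by simp
    have "scale_diff N l (\<lambda>x y. E j i (p * x + q * y) (c x y) (\<lambda>r'. (V(r := V1 r)) r' x y))"
      by (rule Suc.IH[OF c'(1)]) (use V' V1 r in auto)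
    moreover have "(\<lambda>r'. (V(r := V1 r)) r' x y) = (\<lambda>r. V r x y)(r := V1 r x y)" for x y by auto
    ultimately show "scale_diff N l (\<lambda>x y. E j i (p * x + q * y) (c x y) ((\<lambda>r. V r x y)(r := V1 r x y)))"
      by (simp only:)
  qed
  have lev: "Suc j + (N + l) = Suc (N + (j + l))" "j + (N + l) = N + (j + l)" by simp_all
  show ?case
  proof (rule scale_diff_SucI[where cx = "?d p cx Vx" and cy = "?d q cy Vy"])
    show "scale_cont (Suc (N + l)) (\<lambda>x y. E j i (p * x + q * y) (c x y) (\<lambda>r. V r x y))"
      by (rule scale_tower_scale_cont[OF E t]) (use c(1) V(1) in \<open>simp_all add: add.left_commute\<close>)
    show "scale_diff N l (?d p cx Vx)" by (rule diff[OF c(4) V(4)])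
    show "scale_diff N l (?d q cy Vy)" by (rule diff[OF c(5) V(5)])
    fix x y assume x: "x \<in> I" and y: "y \<in> I"
    show "H.deriv (N + l) (\<lambda>x. E j i (p * x + q * y) (c x y) (\<lambda>r. V r x y)) (?d p cx Vx x y) x I"
    proof (rule scale_tower_chain[OF E, where t = "\<lambda>x. p * x + q * y" and l = "N + l" and j = j, unfolded lev])
      show "((\<lambda>x. p * x + q * y) has_real_derivative p) (at x within I)"
        by (auto intro!: derivative_eq_intros)
      show "p * x' + q * y \<in> I" if "x' \<in> I" for x' by (rule t) (use that x y in auto)
    qed (intro x y scale_cont_mem[OF c(1)] scale_cont_section[OF c(1)] c(2) V(2)
        scale_cont_mem[OF V(1)] scale_cont_section[OF V(1)]; assumption)+
    show "H.deriv (N + l) (\<lambda>y. E j i (p * x + q * y) (c x y) (\<lambda>r. V r x y)) (?d q cy Vy x y) y I"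
    proof (rule scale_tower_chain[OF E, where t = "\<lambda>y. p * x + q * y" and l = "N + l" and j = j, unfolded lev])
      show "((\<lambda>y. p * x + q * y) has_real_derivative q) (at y within I)"
        by (auto intro!: derivative_eq_intros)
      show "p * x + q * y' \<in> I" if "y' \<in> I" for y' by (rule t) (use that x y in auto)
    qed (intro x y scale_cont_mem[OF c(1)] scale_cont_section[OF c(1)] c(3) V(3)
        scale_cont_mem[OF V(1)] scale_cont_section[OF V(1)]; assumption)+
  qed
qed

lemma scale_tower_scale_diff_compose:
  assumes E: "scale_tower \<phi> E"
    and t: "\<And>x y. x \<in> I \<Longrightarrow> y \<in> I \<Longrightarrow> p * x + q * y \<in> I"
    and c: "scale_diff N l c"
  shows "scale_diff N l (\<lambda>x y. \<phi> (p * x + q * y) (c x y))"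
proof -
  have "scale_diff N l (\<lambda>x y. E 0 0 (p * x + q * y) (c x y) (\<lambda>r. 0))"
    by (rule scale_tower_scale_diff[OF E t, of N 0 l c 0 "\<lambda>_ _ _. 0"]) (use c in auto)
  moreover have "E 0 0 (p * x + q * y) (c x y) (\<lambda>r. 0) = \<phi> (p * x + q * y) (c x y)"
    if "x \<in> I" "y \<in> I" for x y
    by (rule scale_tower_base[OF E t[OF that]])
  ultimately show ?thesis
    using scale_diff_cong[of "\<lambda>x y. E 0 0 (p * x + q * y) (c x y) (\<lambda>r. 0)"
        "\<lambda>x y. \<phi> (p * x + q * y) (c x y)"] by blast
qed

section \<open>Higher derivatives in the step size\<close>

abbreviation dh :: "nat \<Rightarrow> (real \<Rightarrow> 'a) \<Rightarrow> real \<Rightarrow> 'a" where "dh \<equiv> h_deriv hs"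

lemma vector_derivative_I:
  "(f has_vector_derivative a) (at h within I) \<Longrightarrow> h \<in> I \<Longrightarrow> vector_derivative f (at h within I) = a"
  using vector_derivative_within[OF at_within_I] by blast

lemma has_vector_derivative_cong_I:
  assumes "\<And>h. h \<in> I \<Longrightarrow> f h = g h" "h \<in> I"
  shows "(f has_vector_derivative a) (at h within I) \<longleftrightarrow> (g has_vector_derivative a) (at h within I)"
  using has_vector_derivative_transform[OF assms(2), of f g] has_vector_derivative_transform[OF assms(2), of g f]
    assms(1) by auto

lemma h_deriv_cong:
  assumes "\<And>h. h \<in> I \<Longrightarrow> f h = g h" "h \<in> I"
  shows "dh k f h = dh k g h"
  using assms(2)
proof (induction k arbitrary: h)
  case 0
  then show ?case using assms(1) by simp
next
  case (Suc k)
  have "(dh k f has_vector_derivative a) (at h within I) \<longleftrightarrow> (dh k g has_vector_derivative a) (at h within I)" for a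
    by (rule has_vector_derivative_cong_I) (use Suc in auto)
  then show ?case by (simp add: vector_derivative_def)
qed

text \<open>\<open>h_deriv\<close> peels off the outermost derivative; this peels off the innermost
  one, so that inductions on the order can pass from \<open>f\<close> to \<open>f'\<close>.\<close>

lemma h_deriv_Suc:
  assumes "\<And>h. h \<in> I \<Longrightarrow> (f has_vector_derivative f' h) (at h within I)" "h \<in> I"
  shows "dh (Suc k) f h = dh k f' h"
  using assms(2)
proof (induction k arbitrary: h)
  case 0
  then show ?case by (simp add: vector_derivative_I[OF assms(1)])
next
  case (Suc k)
  have "(dh (Suc k) f has_vector_derivative a) (at h within I) \<longleftrightarrow> (dh k f' has_vector_derivative a) (at h within I)" for a
    by (rule has_vector_derivative_cong_I) (use Suc in blast)+
  then show ?case unfolding h_deriv.simps(2)[of hs "Suc k" f] h_deriv.simps(2)[of hs k f']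
    by (simp add: vector_derivative_def del: h_deriv.simps(2))
qed

lemma differentiable_cong_I:
  assumes "\<And>h. h \<in> I \<Longrightarrow> f h = g h" "h \<in> I"
  shows "f differentiable (at h within I) \<longleftrightarrow> g differentiable (at h within I)"
  using assms differentiable_transform_within[of _ h I 1] by (metis zero_less_one)

lemma h_differentiable_Suc:
  fixes f f' :: "real \<Rightarrow> 'a"
  assumes d: "\<And>h. h \<in> I \<Longrightarrow> (f has_vector_derivative f' h) (at h within I)"
  shows "h_differentiable hs (Suc n) f \<longleftrightarrow> h_differentiable hs n f'"
proof -
  have "dh 0 f differentiable (at h within I)" if "h \<in> I" for h
    using differentiableI_vector[OF d[OF that]] by simp
  moreover have "dh (Suc k) f differentiable (at h within I) \<longleftrightarrow> dh k f' differentiable (at h within I)"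
    if "h \<in> I" for h k
    by (rule differentiable_cong_I[OF h_deriv_Suc[OF d] that])
  ultimately show ?thesis
    unfolding h_differentiable_def All_less_Suc2 by blast
qed

lemma h_differentiable_SucE:
  fixes f :: "real \<Rightarrow> 'a"
  assumes "h_differentiable hs (Suc n) f"
  obtains f' where "\<And>h. h \<in> I \<Longrightarrow> (f has_vector_derivative f' h) (at h within I)" "h_differentiable hs n f'"
proof -
  have d: "(f has_vector_derivative vector_derivative f (at h within I)) (at h within I)" if "h \<in> I" for h
    using assms that vector_derivative_works unfolding h_differentiable_def by fastforce
  show ?thesis
    by (rule that[OF d]) (use h_differentiable_Suc[OF d] assms in blast)+
qed

lemma h_differentiable_0 [simp]: "h_differentiable hs 0 f"
  by (simp add: h_differentiable_def)

lemma h_deriv_add: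
  assumes "h_differentiable hs n f" "h_differentiable hs n g"
  shows "h_differentiable hs n (\<lambda>h. f h + g h)"
    and "k \<le> n \<Longrightarrow> h \<in> I \<Longrightarrow> dh k (\<lambda>h. f h + g h) h = dh k f h + dh k g h"
proof -
  have "h_differentiable hs n (\<lambda>h. f h + g h) \<and>
      (\<forall>k\<le>n. \<forall>h\<in>I. dh k (\<lambda>h. f h + g h) h = dh k f h + dh k g h)"
    using assms
  proof (induction n arbitrary: f g)
    case (Suc n)
    obtain f' where f': "\<And>h. h \<in> I \<Longrightarrow> (f has_vector_derivative f' h) (at h within I)" "h_differentiable hs n f'"
      by (rule h_differentiable_SucE[OF Suc.prems(1)]) (rule that)
    obtain g' where g': "\<And>h. h \<in> I \<Longrightarrow> (g has_vector_derivative g' h) (at h within I)" "h_differentiable hs n g'"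
      by (rule h_differentiable_SucE[OF Suc.prems(2)]) (rule that)
    have d: "((\<lambda>h. f h + g h) has_vector_derivative f' h + g' h) (at h within I)" if "h \<in> I" for h
      by (intro has_vector_derivative_add f' g' that)
    note IH = Suc.IH[OF f'(2) g'(2)]
    have "dh k (\<lambda>h. f h + g h) h = dh k f h + dh k g h" if "k \<le> Suc n" "h \<in> I" for k h
    proof (cases k)
      case (Suc k')
      then show ?thesis
        using IH that h_deriv_Suc[OF d that(2)] h_deriv_Suc[OF f'(1) that(2)] h_deriv_Suc[OF g'(1) that(2)]
        by (simp del: h_deriv.simps(2))
    qed simp
    then show ?case using h_differentiable_Suc[OF d] IH by blast
  qed simp
  then show "h_differentiable hs n (\<lambda>h. f h + g h)"
    and "k \<le> n \<Longrightarrow> h \<in> I \<Longrightarrow> dh k (\<lambda>h. f h + g h) h = dh k f h + dh k g h" by auto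
qed

lemma h_deriv_scaleR:
  assumes "h_differentiable hs n f"
  shows "h_differentiable hs n (\<lambda>h. c *\<^sub>R f h)"
    and "k \<le> n \<Longrightarrow> h \<in> I \<Longrightarrow> dh k (\<lambda>h. c *\<^sub>R f h) h = c *\<^sub>R dh k f h"
proof -
  have "h_differentiable hs n (\<lambda>h. c *\<^sub>R f h) \<and> (\<forall>k\<le>n. \<forall>h\<in>I. dh k (\<lambda>h. c *\<^sub>R f h) h = c *\<^sub>R dh k f h)"
    using assms
  proof (induction n arbitrary: f)
    case (Suc n)
    obtain f' where f': "\<And>h. h \<in> I \<Longrightarrow> (f has_vector_derivative f' h) (at h within I)" "h_differentiable hs n f'"
      by (rule h_differentiable_SucE[OF Suc.prems(1)]) (rule that)
    have d: "((\<lambda>h. c *\<^sub>R f h) has_vector_derivative c *\<^sub>R f' h) (at h within I)" if "h \<in> I" for h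
      by (rule bounded_linear.has_vector_derivative[OF bounded_linear_scaleR_right f'(1)[OF that]])
    note IH = Suc.IH[OF f'(2)]
    have "dh k (\<lambda>h. c *\<^sub>R f h) h = c *\<^sub>R dh k f h" if "k \<le> Suc n" "h \<in> I" for k h
    proof (cases k)
      case (Suc k')
      then show ?thesis
        using IH that h_deriv_Suc[OF d that(2)] h_deriv_Suc[OF f'(1) that(2)] by (simp del: h_deriv.simps(2))
    qed simp
    then show ?case using h_differentiable_Suc[OF d] IH by blast
  qed simp
  then show "h_differentiable hs n (\<lambda>h. c *\<^sub>R f h)"
    and "k \<le> n \<Longrightarrow> h \<in> I \<Longrightarrow> dh k (\<lambda>h. c *\<^sub>R f h) h = c *\<^sub>R dh k f h" by auto
qed

text \<open>The bounds on \<open>a\<close> keep \<open>a * h\<close> in \<open>I\<close>; the use is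
  \<open>a = 1 / m\<close>, for the step size \<open>h / m\<close> of the \<open>m\<close>-fold
  iterate.\<close>

lemma h_deriv_scale_arg:
  assumes "h_differentiable hs n f" and a: "0 < a" "a \<le> 1"
  shows "h_differentiable hs n (\<lambda>h. f (a * h))"
    and "k \<le> n \<Longrightarrow> h \<in> I \<Longrightarrow> dh k (\<lambda>h. f (a * h)) h = a ^ k *\<^sub>R dh k f (a * h)"
proof -
  have aI: "a * h \<in> I" if "h \<in> I" for h
    using that a mult_left_le_one_le[of h a] by auto
  have "h_differentiable hs n (\<lambda>h. f (a * h)) \<and>
      (\<forall>k\<le>n. \<forall>h\<in>I. dh k (\<lambda>h. f (a * h)) h = a ^ k *\<^sub>R dh k f (a * h))"
    using assms(1)
  proof (induction n arbitrary: f)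
    case (Suc n)
    obtain f' where f': "\<And>h. h \<in> I \<Longrightarrow> (f has_vector_derivative f' h) (at h within I)" "h_differentiable hs n f'"
      by (rule h_differentiable_SucE[OF Suc.prems(1)]) (rule that)
    have d: "((\<lambda>h. f (a * h)) has_vector_derivative a *\<^sub>R f' (a * h)) (at h within I)" if h: "h \<in> I" for h
    proof -
      have "((\<lambda>h. a * h) has_real_derivative a) (at h within I)"
        by (auto intro!: derivative_eq_intros)
      then have "((\<lambda>h. a * h) has_vector_derivative a) (at h within I)"
        by (simp only: has_real_derivative_iff_has_vector_derivative)
      moreover have "(f has_vector_derivative f' (a * h)) (at (a * h) within (\<lambda>h. a * h) ` I)"
        by (rule has_vector_derivative_within_subset[OF f'(1)[OF aI[OF h]]]) (use aI in blast)
      ultimately have "(f \<circ> (\<lambda>h. a * h) has_vector_derivative a *\<^sub>R f' (a * h)) (at h within I)"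
        by (rule vector_diff_chain_within)
      then show ?thesis by (simp only: o_def)
    qed
    note IH = Suc.IH[OF f'(2)]
    have "dh k (\<lambda>h. f (a * h)) h = a ^ k *\<^sub>R dh k f (a * h)" if "k \<le> Suc n" "h \<in> I" for k h
    proof (cases k)
      case (Suc k')
      have "dh (Suc k') (\<lambda>h. f (a * h)) h = dh k' (\<lambda>h. a *\<^sub>R f' (a * h)) h"
        by (rule h_deriv_Suc[OF d that(2)])
      also have "\<dots> = a *\<^sub>R dh k' (\<lambda>h. f' (a * h)) h"
        using h_deriv_scaleR(2)[of n "\<lambda>h. f' (a * h)" k' h a] IH that Suc by simp
      also have "\<dots> = a ^ Suc k' *\<^sub>R dh k' f' (a * h)"
        using IH that Suc by simp
      also have "dh k' f' (a * h) = dh (Suc k') f (a * h)"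
        by (rule h_deriv_Suc[OF f'(1) aI[OF that(2)], symmetric])
      finally show ?thesis using Suc by simp
    qed simp
    moreover have "h_differentiable hs n (\<lambda>h. a *\<^sub>R f' (a * h))"
      using h_deriv_scaleR(1)[of n "\<lambda>h. f' (a * h)" a] IH by blast
    ultimately show ?case using h_differentiable_Suc[OF d] by blast
  qed simp
  then show "h_differentiable hs n (\<lambda>h. f (a * h))"
    and "k \<le> n \<Longrightarrow> h \<in> I \<Longrightarrow> dh k (\<lambda>h. f (a * h)) h = a ^ k *\<^sub>R dh k f (a * h)" by auto
qed

lemma h_differentiable_const: "h_differentiable hs n (\<lambda>_. a)"
  and h_deriv_const: "h \<in> I \<Longrightarrow> dh (Suc k) (\<lambda>_. a) h = 0"
proof -
  have d: "((\<lambda>_. a) has_vector_derivative 0) (at h within I)" for h :: real and a :: 'a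
    by (rule has_vector_derivative_const)
  have zero: "h_differentiable hs n (\<lambda>_. 0 :: 'a)" for n
    by (induction n) (simp, simp add: h_differentiable_Suc[OF d])
  then show "h_differentiable hs n (\<lambda>_. a)"
    by (cases n) (simp, simp add: h_differentiable_Suc[OF d])
  have "dh k (\<lambda>_. 0) h = (0 :: 'a)" if "h \<in> I" for k h
    by (induction k) (simp, simp add: h_deriv_Suc[OF d that] del: h_deriv.simps(2))
  then show "h \<in> I \<Longrightarrow> dh (Suc k) (\<lambda>_. a) h = 0"
    using h_deriv_Suc[OF d[of a]] by simp
qed

lemma h_deriv_zero: "h \<in> I \<Longrightarrow> dh k (\<lambda>_. 0) h = 0"
  by (cases k) (simp, rule ssubst[of k], assumption, rule h_deriv_const)

lemma h_deriv_sum: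
  assumes "\<And>i. i \<in> A \<Longrightarrow> h_differentiable hs n (f i)"
  shows "h_differentiable hs n (\<lambda>h. \<Sum>i\<in>A. f i h)"
    and "k \<le> n \<Longrightarrow> h \<in> I \<Longrightarrow> dh k (\<lambda>h. \<Sum>i\<in>A. f i h) h = (\<Sum>i\<in>A. dh k (f i) h)"
proof -
  have "h_differentiable hs n (\<lambda>h. \<Sum>i\<in>A. f i h) \<and>
     (\<forall>k\<le>n. \<forall>h\<in>I. dh k (\<lambda>h. \<Sum>i\<in>A. f i h) h = (\<Sum>i\<in>A. dh k (f i) h))"
    using assms
  proof (induction A rule: infinite_finite_induct)
    case (insert i A)
    have *: "h_differentiable hs n (f i)" "h_differentiable hs n (\<lambda>h. \<Sum>i\<in>A. f i h)"
      using insert by auto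
    show ?case
      using h_deriv_add[OF *] insert by (simp add: insert(1,2))
  qed (simp_all add: h_differentiable_const h_deriv_zero)
  then show "h_differentiable hs n (\<lambda>h. \<Sum>i\<in>A. f i h)"
    and "k \<le> n \<Longrightarrow> h \<in> I \<Longrightarrow> dh k (\<lambda>h. \<Sum>i\<in>A. f i h) h = (\<Sum>i\<in>A. dh k (f i) h)" by auto
qed

text \<open>The path from \<open>(h, h)\<close> to \<open>(y, y)\<close> runs through
  \<open>(h, y)\<close>. The second variable moves at the fixed first coordinate \<open>h\<close>,
  where a derivative at one point is enough; the first moves at the varying second coordinate
  \<open>y\<close>, which calls for the mean value inequality and continuity of
  \<open>cx\<close>.\<close>

lemma diagonal_derivative:
  assumes cx: "\<And>x y. x \<in> I \<Longrightarrow> y \<in> I \<Longrightarrow> H.deriv l (\<lambda>x. c x y) (cx x y) x I"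
    and cy: "H.deriv l (\<lambda>y. c h y) b h I"
    and c: "\<And>x y. x \<in> I \<Longrightarrow> y \<in> I \<Longrightarrow> c x y \<in> Hs l"
    and cont: "scale_cont l cx" and h: "h \<in> I"
  shows "H.deriv l (\<lambda>h. c h h) (cx h h + b) h I"
proof -
  let ?L = "cx h h"
  have L: "?L \<in> Hs l" by (rule scale_cont_mem[OF cont h h])
  have "\<exists>\<xi>\<in>I. \<bar>\<xi> - h\<bar> \<le> \<bar>y - h\<bar> \<and>
      H.nrm l (c y y - c h y - (y - h) *\<^sub>R ?L) \<le> \<bar>y - h\<bar> * H.nrm l (cx \<xi> y - ?L)" if "y \<in> I" for y
    by (rule H.mean_value) (use that cx c L h in auto)
  then obtain \<xi> where \<xi>: "\<And>y. y \<in> I \<Longrightarrow> \<xi> y \<in> I" "\<And>y. y \<in> I \<Longrightarrow> \<bar>\<xi> y - h\<bar> \<le> \<bar>y - h\<bar>"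
    and bound: "\<And>y. y \<in> I \<Longrightarrow> H.nrm l (c y y - c h y - (y - h) *\<^sub>R ?L) \<le> \<bar>y - h\<bar> * H.nrm l (cx (\<xi> y) y - ?L)"
    by metis
  have ev: "\<forall>\<^sub>F y in at h within I. y \<in> I \<and> y \<noteq> h"
    unfolding eventually_at_filter by (rule always_eventually) simp
  have "((\<lambda>y. \<bar>y - h\<bar>) \<longlongrightarrow> 0) (at h within I)"
    by (intro tendsto_rabs_zero LIM_zero tendsto_ident_at)
  then have "((\<lambda>y. \<xi> y - h) \<longlongrightarrow> 0) (at h within I)"
    by (rule Lim_null_comparison[rotated]) (use ev \<xi>(2) in \<open>auto elim: eventually_mono\<close>)
  then have \<xi>h: "(\<xi> \<longlongrightarrow> h) (at h within I)" by (rule LIM_zero_cancel)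
  have "filterlim (\<lambda>y. (\<xi> y, y)) (at (h, h) within I \<times> I) (at h within I)"
    unfolding filterlim_at
  proof
    show "\<forall>\<^sub>F y in at h within I. (\<xi> y, y) \<in> I \<times> I \<and> (\<xi> y, y) \<noteq> (h, h)"
      using ev by eventually_elim (use \<xi>(1) in auto)
    show "((\<lambda>y. (\<xi> y, y)) \<longlongrightarrow> (h, h)) (at h within I)"
      by (intro tendsto_Pair \<xi>h tendsto_ident_at)
  qed
  moreover have "H.tends l (\<lambda>p. cx (fst p) (snd p)) ?L (at (h, h) within I \<times> I)"
    using cont h by (simp add: scale_cont_def)
  ultimately have "H.tends l (\<lambda>y. cx (\<xi> y) y) ?L (at h within I)"
    using H.tends_compose by fastforce
  then have e: "((\<lambda>y. H.nrm l (cx (\<xi> y) y - ?L)) \<longlongrightarrow> 0) (at h within I)"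
    by (simp add: ip_lim_def)
  have "H.tends l (\<lambda>y. (c y y - c h y) /\<^sub>R (y - h)) ?L (at h within I)"
  proof (rule H.tends_dominated[OF L _ _ e])
    show "\<forall>\<^sub>F y in at h within I. (c y y - c h y) /\<^sub>R (y - h) \<in> Hs l"
      using ev by eventually_elim (use c h in blast)
    show "\<forall>\<^sub>F y in at h within I. H.nrm l ((c y y - c h y) /\<^sub>R (y - h) - ?L) \<le> H.nrm l (cx (\<xi> y) y - ?L)"
      using ev
    proof eventually_elim
      case (elim y)
      have S: "c y y - c h y - (y - h) *\<^sub>R ?L \<in> Hs l" using c h L elim by blast
      have "inverse (y - h) *\<^sub>R (y - h) *\<^sub>R ?L = ?L" using elim by simp
      then have "(c y y - c h y) /\<^sub>R (y - h) - ?L = inverse (y - h) *\<^sub>R (c y y - c h y - (y - h) *\<^sub>R ?L)"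
        by (simp only: scaleR_diff_right)
      then have "H.nrm l ((c y y - c h y) /\<^sub>R (y - h) - ?L) = inverse \<bar>y - h\<bar> * H.nrm l (c y y - c h y - (y - h) *\<^sub>R ?L)"
        using H.nrm_scale[OF S] by simp
      also have "\<dots> \<le> inverse \<bar>y - h\<bar> * (\<bar>y - h\<bar> * H.nrm l (cx (\<xi> y) y - ?L))"
        by (intro mult_left_mono bound) (use elim in auto)
      also have "\<dots> = H.nrm l (cx (\<xi> y) y - ?L)" using elim by simp
      finally show ?case .
    qed
  qed
  from H.tends_add[OF this cy[unfolded ip_deriv_def]] show ?thesis
    by (simp add: ip_deriv_def scaleR_add_right[symmetric])
qed

text \<open>The regularity in the form used by the Leibniz rule, in the ambient space. The last
  property is the substantial one: an \<open>x\<close>-derivative commutes with \<open>i\<close>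
  derivatives in \<open>y\<close>. One \<open>y\<close>-derivative is absorbed into
  \<open>cy\<close>, and the induction hypothesis for \<open>cy\<close> does the rest.\<close>

lemma scale_diff_partials:
  assumes "scale_diff (Suc M) l c"
  obtains cx cy where "scale_diff M l cx" "scale_diff M l cy"
    and "\<And>x y. x \<in> I \<Longrightarrow> y \<in> I \<Longrightarrow> ((\<lambda>x. c x y) has_vector_derivative cx x y) (at x within I)"
    and "\<And>x y. x \<in> I \<Longrightarrow> y \<in> I \<Longrightarrow> ((\<lambda>y. c x y) has_vector_derivative cy x y) (at y within I)"
    and "\<And>h. h \<in> I \<Longrightarrow> ((\<lambda>h. c h h) has_vector_derivative cx h h + cy h h) (at h within I)"
    and "\<And>i x y. i \<le> M \<Longrightarrow> x \<in> I \<Longrightarrow> y \<in> I \<Longrightarrow>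
           ((\<lambda>x. dh i (c x) y) has_vector_derivative dh i (cx x) y) (at x within I)"
proof -
  define P where "P M c cx cy \<longleftrightarrow> scale_diff M l cx \<and> scale_diff M l cy \<and>
      (\<forall>x\<in>I. \<forall>y\<in>I. ((\<lambda>x. c x y) has_vector_derivative cx x y) (at x within I) \<and>
        ((\<lambda>y. c x y) has_vector_derivative cy x y) (at y within I)) \<and>
      (\<forall>h\<in>I. ((\<lambda>h. c h h) has_vector_derivative cx h h + cy h h) (at h within I)) \<and>
      (\<forall>i\<le>M. \<forall>x\<in>I. \<forall>y\<in>I. ((\<lambda>x. dh i (c x) y) has_vector_derivative dh i (cx x) y) (at x within I))"
    for M c cx cy
  have "\<exists>cx cy. P M c cx cy"
    using assms
  proof (induction M arbitrary: c)
    case M: (0 c)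
    from M obtain cx cy where *: "scale_cont (Suc (0 + l)) c"
      "\<And>x y. x \<in> I \<Longrightarrow> y \<in> I \<Longrightarrow> H.deriv (0 + l) (\<lambda>x. c x y) (cx x y) x I"
      "\<And>x y. x \<in> I \<Longrightarrow> y \<in> I \<Longrightarrow> H.deriv (0 + l) (\<lambda>y. c x y) (cy x y) y I"
      "scale_diff 0 l cx" "scale_diff 0 l cy"
      by (rule scale_diff_SucE) (rule that)
    have cm: "c x y \<in> Hs l" if "x \<in> I" "y \<in> I" for x y
      using scale_cont_mem[OF *(1) that] Hs_mem[of _ "Suc (0 + l)" l] by simp
    have "H.deriv l (\<lambda>h. c h h) (cx h h + cy h h) h I" if "h \<in> I" for h
      by (rule diagonal_derivative) (use * that cm in auto)
    moreover have "H.deriv l (\<lambda>x. c x y) (cx x y) x I" "H.deriv l (\<lambda>y. c x y) (cy x y) y I"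
      if "x \<in> I" "y \<in> I" for x y
      using *(2,3)[OF that] by simp_all
    ultimately have v: "\<forall>h\<in>I. ((\<lambda>h. c h h) has_vector_derivative cx h h + cy h h) (at h within I)"
      "\<forall>x\<in>I. \<forall>y\<in>I. ((\<lambda>x. c x y) has_vector_derivative cx x y) (at x within I) \<and>
        ((\<lambda>y. c x y) has_vector_derivative cy x y) (at y within I)"
      using deriv_imp_vector by blast+
    then have "\<forall>i\<le>0. \<forall>x\<in>I. \<forall>y\<in>I. ((\<lambda>x. dh i (c x) y) has_vector_derivative dh i (cx x) y) (at x within I)"
      by auto
    with v *(4,5) have "P 0 c cx cy" unfolding P_def by blast
    then show ?case by blast
  next
    case (Suc M)
    from Suc.prems obtain cx cy where *: "scale_cont (Suc (Suc M + l)) c"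
      "\<And>x y. x \<in> I \<Longrightarrow> y \<in> I \<Longrightarrow> H.deriv (Suc M + l) (\<lambda>x. c x y) (cx x y) x I"
      "\<And>x y. x \<in> I \<Longrightarrow> y \<in> I \<Longrightarrow> H.deriv (Suc M + l) (\<lambda>y. c x y) (cy x y) y I"
      "scale_diff (Suc M) l cx" "scale_diff (Suc M) l cy"
      by (rule scale_diff_SucE) (rule that)
    have cm: "c x y \<in> Hs (Suc M + l)" if "x \<in> I" "y \<in> I" for x y
      using scale_cont_mem[OF *(1) that] Hs_mem[of _ "Suc (Suc M + l)" "Suc M + l"] by simp
    have diag: "H.deriv (Suc M + l) (\<lambda>h. c h h) (cx h h + cy h h) h I" if "h \<in> I" for h
      by (rule diagonal_derivative[OF *(2) *(3)[OF that that] cm scale_diff_cont[OF *(4)] that])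
    from Suc.IH[OF *(5)] obtain cyx cyy where Py: "P M cy cyx cyy" by blast
    have cyx: "scale_diff M l cyx"
      "\<And>x y. x \<in> I \<Longrightarrow> y \<in> I \<Longrightarrow> ((\<lambda>x. cy x y) has_vector_derivative cyx x y) (at x within I)"
      "\<And>i x y. i \<le> M \<Longrightarrow> x \<in> I \<Longrightarrow> y \<in> I \<Longrightarrow>
           ((\<lambda>x. dh i (cy x) y) has_vector_derivative dh i (cyx x) y) (at x within I)"
      using Py unfolding P_def by blast+
    \<comment> \<open>\<open>cyx\<close> arises as the \<open>x\<close>-derivative of
      \<open>cy\<close>; the Schwarz theorem shows that it is the \<open>y\<close>-derivative of
      \<open>cx\<close> too, so further \<open>y\<close>-derivatives of \<open>cyx\<close> are those
      of \<open>cx\<close> of one order more.\<close>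
    have cxy: "((\<lambda>y. cx x y) has_vector_derivative cyx x y) (at y within I)" if x: "x \<in> I" and y: "y \<in> I" for x y
    proof -
      have "H.deriv 0 (\<lambda>y. cx x y) (cyx x y) y I"
      proof (rule H.mixed_deriv[where X = I and Y = I and f = c and fs = cy and fsh = cyx])
        show "at x within I \<noteq> bot" by (rule at_within_I[OF x])
        have "scale_cont 0 cyx" using scale_diff_cont[OF cyx(1)] scale_cont_level by blast
        then show "H.tends 0 (\<lambda>(h, s). cyx h s) (cyx x y) (at (x, y) within I \<times> I)"
          using x y by (simp add: scale_cont_def case_prod_unfold)
        show "H.deriv 0 (\<lambda>h. c h s) (cx x s) x I" if "s \<in> I" for s
          by (rule deriv_level[OF *(2)[OF x that]]) simp
        show "H.deriv 0 (\<lambda>s. c h s) (cy h s) s I" if "h \<in> I" "s \<in> I" for h s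
          by (rule deriv_level[OF *(3)[OF that]]) simp
        show "H.deriv 0 (\<lambda>h. cy h s) (cyx h s) h I" if "h \<in> I" "s \<in> I" for h s
          unfolding deriv_0_iff by (rule cyx(2)[OF that])
      qed (use x y in auto)
      then show ?thesis by (simp add: ip_0 ip_deriv_UNIV_inner)
    qed
    have cyv: "((\<lambda>y. c x y) has_vector_derivative cy x y) (at y within I)" if "x \<in> I" "y \<in> I" for x y
      by (rule deriv_imp_vector[OF *(3)[OF that]])
    have "((\<lambda>x. dh i (c x) y) has_vector_derivative dh i (cx x) y) (at x within I)"
      if i: "i \<le> Suc M" and x: "x \<in> I" and y: "y \<in> I" for i x y
    proof (cases i)
      case 0
      then show ?thesis using deriv_imp_vector[OF *(2)[OF x y]] by simp
    next
      case (Suc i')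
      have "((\<lambda>x. dh i' (cy x) y) has_vector_derivative dh i' (cyx x) y) (at x within I)"
        by (rule cyx(3)) (use i Suc x y in auto)
      moreover have "dh i' (cyx x) y = dh (Suc i') (cx x) y"
        by (rule h_deriv_Suc[OF cxy[OF x] y, symmetric])
      moreover have "dh (Suc i') (c x) y = dh i' (cy x) y" if "x \<in> I" for x
        by (rule h_deriv_Suc[OF cyv[OF that] y])
      ultimately show ?thesis
        unfolding Suc using has_vector_derivative_transform[OF x, of "\<lambda>x. dh (Suc i') (c x) y" "\<lambda>x. dh i' (cy x) y"]
        by simp
    qed
    moreover have "\<forall>h\<in>I. ((\<lambda>h. c h h) has_vector_derivative cx h h + cy h h) (at h within I)"
      "\<forall>x\<in>I. \<forall>y\<in>I. ((\<lambda>x. c x y) has_vector_derivative cx x y) (at x within I) \<and>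
        ((\<lambda>y. c x y) has_vector_derivative cy x y) (at y within I)"
      using deriv_imp_vector[OF diag] deriv_imp_vector[OF *(2)] deriv_imp_vector[OF *(3)] by blast+
    ultimately have "P (Suc M) c cx cy" unfolding P_def using *(4,5) by blast
    then show ?case by blast
  qed
  then obtain cx cy where "P M c cx cy" by blast
  then show ?thesis unfolding P_def by (intro that[of cx cy]) blast+
qed

lemma scale_diff_imp_h_differentiable:
  assumes "scale_diff N l c"
  shows "h_differentiable hs N (\<lambda>h. c h h)"
    and "x \<in> I \<Longrightarrow> h_differentiable hs N (\<lambda>y. c x y)"
    and "y \<in> I \<Longrightarrow> h_differentiable hs N (\<lambda>x. c x y)"
proof -
  have "h_differentiable hs N (\<lambda>h. c h h) \<and> (\<forall>x\<in>I. h_differentiable hs N (\<lambda>y. c x y))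
     \<and> (\<forall>y\<in>I. h_differentiable hs N (\<lambda>x. c x y))"
    using assms
  proof (induction N arbitrary: c)
    case (Suc N)
    from Suc.prems obtain cx cy where c: "scale_diff N l cx" "scale_diff N l cy"
      "\<And>x y. x \<in> I \<Longrightarrow> y \<in> I \<Longrightarrow> ((\<lambda>x. c x y) has_vector_derivative cx x y) (at x within I)"
      "\<And>x y. x \<in> I \<Longrightarrow> y \<in> I \<Longrightarrow> ((\<lambda>y. c x y) has_vector_derivative cy x y) (at y within I)"
      "\<And>h. h \<in> I \<Longrightarrow> ((\<lambda>h. c h h) has_vector_derivative cx h h + cy h h) (at h within I)"
      by (rule scale_diff_partials) (rule that)
    have "h_differentiable hs N (\<lambda>h. cx h h + cy h h)"
      using h_deriv_add(1)[of N "\<lambda>h. cx h h" "\<lambda>h. cy h h"] Suc.IH[OF c(1)] Suc.IH[OF c(2)] by blast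
    then show ?case
      using h_differentiable_Suc[OF c(5)] h_differentiable_Suc[OF c(4)] h_differentiable_Suc[OF c(3)]
        Suc.IH[OF c(1)] Suc.IH[OF c(2)] by blast
  qed simp
  then show "h_differentiable hs N (\<lambda>h. c h h)"
    and "x \<in> I \<Longrightarrow> h_differentiable hs N (\<lambda>y. c x y)"
    and "y \<in> I \<Longrightarrow> h_differentiable hs N (\<lambda>x. c x y)" by auto
qed

text \<open>Of the \<open>N + i\<close> derivatives, \<open>i\<close> are spent on \<open>y\<close>
  and \<open>N\<close> remain for \<open>x\<close>. This later allows differences in the number of
  iterations to pass through \<open>x\<close>-derivatives.\<close>

lemma scale_diff_imp_h_differentiable_mixed:
  assumes "scale_diff (N + i) l c" "y \<in> I"
  shows "h_differentiable hs N (\<lambda>x. dh i (c x) y)"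
  using assms
proof (induction N arbitrary: c)
  case (Suc N)
  from Suc.prems have "scale_diff (Suc (N + i)) l c" by simp
  then obtain cx where c: "scale_diff (N + i) l cx"
    "\<And>j x y. j \<le> N + i \<Longrightarrow> x \<in> I \<Longrightarrow> y \<in> I \<Longrightarrow>
       ((\<lambda>x. dh j (c x) y) has_vector_derivative dh j (cx x) y) (at x within I)"
    by (rule scale_diff_partials) (rule that)
  have "((\<lambda>x. dh i (c x) y) has_vector_derivative dh i (cx x) y) (at x within I)" if "x \<in> I" for x
    by (rule c(2)) (use that Suc.prems in auto)
  from h_differentiable_Suc[OF this] show ?case
    using Suc.IH[OF c(1) Suc.prems(2)] by blast
qed simp

text \<open>Along the diagonal \<open>d/dh\<close> is the sum of the two partial derivatives, which
  commute by \<open>scale_diff_partials\<close>; its powers expand by Pascal's rule.\<close>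

theorem h_deriv_diagonal:
  assumes "scale_diff k l c"
  shows "dh k (\<lambda>h. c h h) 0 = (\<Sum>j\<le>k. real (k choose j) *\<^sub>R dh j (\<lambda>x. dh (k - j) (c x) 0) 0)"
  using assms
proof (induction k arbitrary: c)
  case 0
  then show ?case by simp
next
  case (Suc k)
  have z: "0 \<in> I" using hs by simp
  from Suc.prems obtain cx cy where c: "scale_diff k l cx" "scale_diff k l cy"
    "\<And>x y. x \<in> I \<Longrightarrow> y \<in> I \<Longrightarrow> ((\<lambda>x. c x y) has_vector_derivative cx x y) (at x within I)"
    "\<And>x y. x \<in> I \<Longrightarrow> y \<in> I \<Longrightarrow> ((\<lambda>y. c x y) has_vector_derivative cy x y) (at y within I)"
    "\<And>h. h \<in> I \<Longrightarrow> ((\<lambda>h. c h h) has_vector_derivative cx h h + cy h h) (at h within I)"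
    "\<And>i x y. i \<le> k \<Longrightarrow> x \<in> I \<Longrightarrow> y \<in> I \<Longrightarrow>
         ((\<lambda>x. dh i (c x) y) has_vector_derivative dh i (cx x) y) (at x within I)"
    by (rule scale_diff_partials) (rule that)
  define F where "F j i = dh j (\<lambda>x. dh i (c x) 0) 0" for j i
  have x: "dh j (\<lambda>x. dh (k - j) (cx x) 0) 0 = F (Suc j) (k - j)" for j
    unfolding F_def by (rule h_deriv_Suc[symmetric]) (use c(6) z in auto)
  have y: "dh j (\<lambda>x. dh (k - j) (cy x) 0) 0 = F j (Suc k - j)" if "j \<le> k" for j
    unfolding F_def
  proof (rule h_deriv_cong[OF _ z])
    fix x assume "x \<in> I"
    then have "dh (Suc (k - j)) (c x) 0 = dh (k - j) (cy x) 0" by (rule h_deriv_Suc[OF c(4) z])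
    then show "dh (k - j) (cy x) 0 = dh (Suc k - j) (c x) 0" using that by (simp only: Suc_diff_le)
  qed
  have "dh (Suc k) (\<lambda>h. c h h) 0 = dh k (\<lambda>h. cx h h + cy h h) 0"
    by (rule h_deriv_Suc[OF c(5) z])
  also have "\<dots> = dh k (\<lambda>h. cx h h) 0 + dh k (\<lambda>h. cy h h) 0"
    by (rule h_deriv_add(2)[OF scale_diff_imp_h_differentiable(1)[OF c(1)]
          scale_diff_imp_h_differentiable(1)[OF c(2)] order_refl z])
  also have "dh k (\<lambda>h. cx h h) 0 = (\<Sum>j\<le>k. real (k choose j) *\<^sub>R F (Suc j) (k - j))"
    by (simp only: Suc.IH[OF c(1)] x)
  also have "dh k (\<lambda>h. cy h h) 0 = (\<Sum>j\<le>k. real (k choose j) *\<^sub>R F j (Suc k - j))"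
    using Suc.IH[OF c(2)] y by simp
  \<comment> \<open>The added summand vanishes because \<open>k choose Suc k = 0\<close>; with the
    range enlarged, splitting off \<open>j = 0\<close> aligns this sum with the other.\<close>
  also have "\<dots> = (\<Sum>j\<le>Suc k. real (k choose j) *\<^sub>R F j (Suc k - j))"
    by simp
  also have "\<dots> = F 0 (Suc k) + (\<Sum>j\<le>k. real (k choose Suc j) *\<^sub>R F (Suc j) (k - j))"
    by (subst sum.atMost_Suc_shift) simp
  also have "(\<Sum>j\<le>k. real (k choose j) *\<^sub>R F (Suc j) (k - j)) + (F 0 (Suc k) + (\<Sum>j\<le>k. real (k choose Suc j) *\<^sub>R F (Suc j) (k - j)))
      = F 0 (Suc k) + (\<Sum>j\<le>k. real (Suc k choose Suc j) *\<^sub>R F (Suc j) (k - j))"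
    by (simp add: scaleR_add_left sum.distrib)
  also have "\<dots> = (\<Sum>j\<le>Suc k. real (Suc k choose j) *\<^sub>R F j (Suc k - j))"
    by (subst sum.atMost_Suc_shift) simp
  finally show ?case by (simp only: F_def)
qed

end

section \<open>Finite differences and the order conditions\<close>

text \<open>The new difference is taken innermost, since it is the first difference of the Taylor
  coefficients for which a formula is available.\<close>

primrec fdiff :: "nat \<Rightarrow> (nat \<Rightarrow> 'a::ab_group_add) \<Rightarrow> nat \<Rightarrow> 'a" where
  "fdiff 0 f = f"
| "fdiff (Suc r) f = fdiff r (\<lambda>m. f (Suc m) - f m)"

lemma newton_forward:
  fixes f :: "nat \<Rightarrow> 'a::real_vector"
  shows "f m = (\<Sum>r\<le>m. real (m choose r) *\<^sub>R fdiff r f 0)"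
proof (induction m arbitrary: f)
  case (Suc m)
  \<comment> \<open>The extra term at \<open>r = Suc m\<close> vanishes; after the shift both sums
    have the same range, ready for Pascal's rule.\<close>
  have "f m = (\<Sum>r\<le>Suc m. real (m choose r) *\<^sub>R fdiff r f 0)"
    using Suc.IH[of f] by simp
  also have "\<dots> = f 0 + (\<Sum>r\<le>m. real (m choose Suc r) *\<^sub>R fdiff (Suc r) f 0)"
    by (subst sum.atMost_Suc_shift) simp
  finally have "f m = f 0 + (\<Sum>r\<le>m. real (m choose Suc r) *\<^sub>R fdiff (Suc r) f 0)" .
  moreover have "f (Suc m) - f m = (\<Sum>r\<le>m. real (m choose r) *\<^sub>R fdiff (Suc r) f 0)"
    using Suc.IH[of "\<lambda>m. f (Suc m) - f m"] by simp
  ultimately have "f (Suc m) = f 0 + (\<Sum>r\<le>m. real (m choose Suc r) *\<^sub>R fdiff (Suc r) f 0)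
      + (\<Sum>r\<le>m. real (m choose r) *\<^sub>R fdiff (Suc r) f 0)"
    by (metis add_diff_cancel_left' diff_add_cancel add.commute)
  also have "\<dots> = f 0 + (\<Sum>r\<le>m. real (Suc m choose Suc r) *\<^sub>R fdiff (Suc r) f 0)"
    by (simp add: scaleR_add_left sum.distrib del: fdiff.simps)
  also have "\<dots> = (\<Sum>r\<le>Suc m. real (Suc m choose r) *\<^sub>R fdiff r f 0)"
    by (subst sum.atMost_Suc_shift) simp
  finally show ?case .
qed simp

lemma fdiff_sum:
  fixes f :: "'i \<Rightarrow> nat \<Rightarrow> 'a::real_vector"
  shows "fdiff r (\<lambda>m. \<Sum>j\<in>A. w j *\<^sub>R f j m) m = (\<Sum>j\<in>A. w j *\<^sub>R fdiff r (f j) m)"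
  by (induction r arbitrary: f) (simp_all add: sum_subtractf[symmetric] scaleR_diff_right[symmetric])

lemma binomial_Suc_real: "real (Suc r) * real (m choose Suc r) = (real m - real r) * real (m choose r)"
proof -
  have "Suc r * (m choose Suc r) = (m - r) * (m choose r)"
    by (simp only: binomial_absorption binomial_absorb_comp)
  then have "real (Suc r) * real (m choose Suc r) = real (m - r) * real (m choose r)"
    by (metis of_nat_mult)
  also have "\<dots> = (real m - real r) * real (m choose r)"
    by (cases "r \<le> m") (simp_all add: of_nat_diff)
  finally show ?thesis .
qed

text \<open>For \<open>r \<ge> 1\<close> the binomial coefficient is a polynomial in
  \<open>m\<close> without constant term and with leading coefficient \<open>1 / r!\<close>. After
  division by \<open>m^k\<close> it contains only the powers
  \<open>m^(1 - k), ..., m^(r - k)\<close>, all removed by the conditions unless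
  \<open>r = k\<close>, when \<open>1 / k!\<close> is left. The induction uses
  \<open>(r + 1) (m choose r + 1) = (m - r) (m choose r)\<close>: the factor \<open>m\<close> lowers
  \<open>k\<close> by one, and the other sum vanishes because \<open>r < k\<close>.\<close>

lemma sum_weights_binomial:
  fixes \<gamma> :: "nat \<Rightarrow> real"
  assumes one: "(\<Sum>m = 1..s. \<gamma> m) = 1"
    and zero: "\<And>k. 1 \<le> k \<Longrightarrow> k \<le> q - 1 \<Longrightarrow> (\<Sum>m = 1..s. real m powi (- int k) * \<gamma> m) = 0"
    and r: "1 \<le> r" "r \<le> k" "k \<le> q"
  shows "(\<Sum>m = 1..s. \<gamma> m * (1 / real m) ^ k * real (m choose r)) = (if r = k then 1 / fact k else 0)"
  using r
proof (induction r arbitrary: k rule: nat_induct_at_least)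
  case base
  then obtain k' where k: "k = Suc k'" by (cases k) auto
  have "(\<Sum>m = 1..s. \<gamma> m * (1 / real m) ^ k * real (m choose 1)) = (\<Sum>m = 1..s. real m powi (- int k') * \<gamma> m)"
    by (rule sum.cong) (auto simp: k power_int_minus field_simps)
  also have "\<dots> = (if 1 = k then 1 / fact k else 0)"
  proof (cases "k' = 0")
    case True
    then show ?thesis using one k by simp
  next
    case False
    then show ?thesis using zero[of k'] k base by auto
  qed
  finally show ?case .
next
  case (Suc r)
  then obtain k' where k: "k = Suc k'" by (cases k) auto
  have "real (Suc r) * (\<Sum>m = 1..s. \<gamma> m * (1 / real m) ^ k * real (m choose Suc r))
      = (\<Sum>m = 1..s. \<gamma> m * (1 / real m) ^ k * ((real m - real r) * real (m choose r)))"
    unfolding sum_distrib_left binomial_Suc_real[symmetric] by (rule sum.cong) simp_all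
  also have "\<dots> = (\<Sum>m = 1..s. \<gamma> m * (1 / real m) ^ k' * real (m choose r)
      - real r * (\<gamma> m * (1 / real m) ^ k * real (m choose r)))"
    by (rule sum.cong) (auto simp: k field_simps)
  also have "\<dots> = (\<Sum>m = 1..s. \<gamma> m * (1 / real m) ^ k' * real (m choose r))
      - real r * (\<Sum>m = 1..s. \<gamma> m * (1 / real m) ^ k * real (m choose r))"
    by (simp add: sum_subtractf sum_distrib_left)
  also have "\<dots> = (if r = k' then 1 / fact k' else 0)"
    using Suc.IH[of k'] Suc.IH[of k] Suc.prems k by auto
  finally have "(\<Sum>m = 1..s. \<gamma> m * (1 / real m) ^ k * real (m choose Suc r))
      = (if r = k' then 1 / fact k' else 0) / real (Suc r)"
    by (simp only: nonzero_eq_divide_eq[OF of_nat_neq_0] mult.commute[of _ "real (Suc r)"])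
  also have "\<dots> = (if Suc r = k then 1 / fact k else 0)"
    by (simp add: k)
  finally show ?case .
qed

section \<open>The derivative of a mild flow at time zero\<close>

lemma mild_flow_0: "mild_flow hs S F \<phi> \<Longrightarrow> \<phi> 0 = id"
  by (simp add: mild_flow_def)

lemma mild_flow_add:
  assumes "mild_flow hs S F \<phi>" "0 \<le> t" "0 \<le> t'" "t + t' < hs"
  shows "\<phi> (t + t') u = \<phi> t (\<phi> t' u)"
proof -
  have "\<forall>t\<ge>0. \<forall>t'\<ge>0. t + t' < hs \<longrightarrow> \<phi> (t + t') = \<phi> t \<circ> \<phi> t'"
    using assms(1) by (simp add: mild_flow_def)
  then show ?thesis using assms(2-4) by simp
qed

text \<open>By the Duhamel formula the difference is an integral over \<open>[0, t]\<close> whose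
  integrand tends to \<open>F u\<close>. Taking the difference matters: it is differentiable at 0
  whenever \<open>F\<close> is continuous at \<open>u\<close>, while each flow alone may fail to
  be.\<close>

lemma mild_flow_deriv_0:
  fixes S :: "real \<Rightarrow> 'a::banach \<Rightarrow> 'a"
  assumes hs: "0 < hs" and S: "c0_semigroup S"
    and bound: "\<And>t u. 0 \<le> t \<Longrightarrow> norm (S t u) \<le> exp (\<kappa> * t) * norm u"
    and F: "isCont F u" and flow: "mild_flow hs S F \<phi>"
  shows "((\<lambda>t. \<phi> t u - S t u) has_vector_derivative F u) (at 0 within {0..<hs})"
proof -
  have lin: "bounded_linear (S t)" if "0 \<le> t" for t using S that by (simp add: c0_semigroup_def)
  have S0: "S 0 = id" using S by (simp add: c0_semigroup_def)
  have \<phi>0: "\<phi> 0 = id" using flow by (simp add: mild_flow_def)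
  have "((\<lambda>s. \<phi> s u) \<longlongrightarrow> \<phi> 0 u) (at 0 within {0..<hs})"
  proof -
    have "continuous_on {0..<hs} (\<lambda>s. \<phi> s u)" using flow by (simp add: mild_flow_def)
    then show ?thesis using hs by (simp only: continuous_on_def) simp
  qed
  then have lim: "((\<lambda>s. F (\<phi> s u)) \<longlongrightarrow> F u) (at 0 within {0..<hs})"
    using isCont_tendsto_compose[OF F] by (simp add: \<phi>0)
  have S_lim: "((\<lambda>t. S t (F u)) \<longlongrightarrow> F u) (at_right 0)"
    using S by (simp add: c0_semigroup_def)
  have est: "\<exists>d>0. \<forall>t\<in>{0..<hs}. norm (t - 0) < d \<longrightarrow>
      norm (\<phi> t u - S t u - (\<phi> 0 u - S 0 u) - (t - 0) *\<^sub>R F u) \<le> \<epsilon> * norm (t - 0)"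
    if \<epsilon>: "0 < \<epsilon>" for \<epsilon> :: real
  proof -
    \<comment> \<open>The denominator compensates the growth of the semigroup, whose norm is at most
      \<open>exp \<bar>\<kappa>\<bar>\<close> on times up to 1; hence the 1 in
      \<open>?d\<close>.\<close>
    have "0 < \<epsilon> / (2 * exp \<bar>\<kappa>\<bar>)" using \<epsilon> by simp
    from tendstoD[OF lim this] obtain d1 where d1: "0 < d1"
      "\<And>s. s \<in> {0..<hs} \<Longrightarrow> s \<noteq> 0 \<Longrightarrow> dist s 0 < d1 \<Longrightarrow> dist (F (\<phi> s u)) (F u) < \<epsilon> / (2 * exp \<bar>\<kappa>\<bar>)"
      unfolding eventually_at by blast
    have "0 < \<epsilon> / 2" using \<epsilon> by simp
    from tendstoD[OF S_lim this] obtain d2 where d2: "0 < d2"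
      "\<And>r. r \<in> {0<..} \<Longrightarrow> r \<noteq> 0 \<Longrightarrow> dist r 0 < d2 \<Longrightarrow> dist (S r (F u)) (F u) < \<epsilon> / 2"
      unfolding eventually_at by blast
    let ?d = "min 1 (min d1 d2)"
    have "norm (\<phi> t u - S t u - (\<phi> 0 u - S 0 u) - (t - 0) *\<^sub>R F u) \<le> \<epsilon> * norm (t - 0)"
      if t: "t \<in> {0..<hs}" "norm (t - 0) < ?d" for t
    proof -
      have "((\<lambda>s. S (t - s) (F (\<phi> s u))) has_integral (\<phi> t u - S t u)) {0..t}"
        using flow t by (simp add: mild_flow_def)
      moreover have "((\<lambda>s. F u) has_integral t *\<^sub>R F u) {0..t}"
        using has_integral_const_real[of "F u" 0 t] t by simp
      ultimately have int: "((\<lambda>s. S (t - s) (F (\<phi> s u)) - F u) has_integral (\<phi> t u - S t u - t *\<^sub>R F u)) {0..t}"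
        by (rule has_integral_diff)
      have "norm (S (t - s) (F (\<phi> s u)) - F u) \<le> \<epsilon>" if s: "s \<in> {0..t}" for s
      proof -
        interpret B: bounded_linear "S (t - s)" by (rule lin) (use s in simp)
        have "norm (F (\<phi> s u) - F u) \<le> \<epsilon> / (2 * exp \<bar>\<kappa>\<bar>)"
          using d1(2)[of s] s t \<epsilon> by (cases "s = 0") (auto simp: \<phi>0 dist_norm)
        moreover have "exp (\<kappa> * (t - s)) \<le> exp \<bar>\<kappa>\<bar>"
        proof -
          have "\<kappa> * (t - s) \<le> \<bar>\<kappa>\<bar> * (t - s)" using s by (intro mult_right_mono) auto
          also have "\<dots> \<le> \<bar>\<kappa>\<bar> * 1" using s t by (intro mult_left_mono) auto
          finally show ?thesis by simp
        qed
        ultimately have "exp (\<kappa> * (t - s)) * norm (F (\<phi> s u) - F u) \<le> exp \<bar>\<kappa>\<bar> * (\<epsilon> / (2 * exp \<bar>\<kappa>\<bar>))"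
          by (intro mult_mono) auto
        then have "norm (S (t - s) (F (\<phi> s u) - F u)) \<le> \<epsilon> / 2"
          using bound[of "t - s" "F (\<phi> s u) - F u"] s by simp
        moreover have "norm (S (t - s) (F u) - F u) \<le> \<epsilon> / 2"
          using d2(2)[of "t - s"] s t \<epsilon> by (cases "t = s") (auto simp: S0 dist_norm)
        ultimately have "norm (S (t - s) (F (\<phi> s u) - F u) + (S (t - s) (F u) - F u)) \<le> \<epsilon> / 2 + \<epsilon> / 2"
          by (rule norm_add_rule_thm[OF _ _, THEN order_trans]) simp
        then show ?thesis by (simp add: B.diff)
      qed
      then have "norm (\<phi> t u - S t u - t *\<^sub>R F u) \<le> \<epsilon> * Henstock_Kurzweil_Integration.content {0..t}"
        using has_integral_bound_real[OF _ finite.emptyI int, of \<epsilon>] \<epsilon> by simp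
      then show ?thesis using t by (simp add: \<phi>0 S0)
    qed
    then show ?thesis using d1(1) d2(1) by (intro exI[of _ ?d]) auto
  qed
  then show ?thesis
    unfolding has_vector_derivative_def has_derivative_within_alt
    by (auto intro: bounded_linear_scaleR_left)
qed

text \<open>The integrand in the Duhamel formula is zero. This lets the comparison of \<phi> with
  the semigroup be read as one with \<open>\<phi>0\<close>, whose derivative is supplied by
  compatibility.\<close>

lemma mild_flow_zero:
  assumes S: "c0_semigroup S" and flow: "mild_flow hs S (\<lambda>_. 0) \<phi>" and t: "t \<in> {0..<hs}"
  shows "\<phi> t u = S t u"
proof -
  have "((\<lambda>s. S (t - s) 0) has_integral (\<phi> t u - S t u)) {0..t}"
    using flow t by (simp add: mild_flow_def)
  moreover have "((\<lambda>s. S (t - s) 0) has_integral 0) {0..t}"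
  proof (rule has_integral_is_0)
    fix s assume "s \<in> {0..t}"
    then interpret bounded_linear "S (t - s)" using S unfolding c0_semigroup_def by simp
    show "S (t - s) 0 = 0" by (rule zero)
  qed
  ultimately have "\<phi> t u - S t u = 0" by (rule has_integral_unique)
  then show ?thesis by simp
qed

lemma smooth_map_isCont: "smooth_map F \<Longrightarrow> isCont F u"
proof -
  assume "smooth_map F"
  then obtain D where "\<And>u v. D 0 u v = F u"
    "\<And>i u v. ((\<lambda>w. D i w v) has_derivative (\<lambda>w. D (Suc i) u (v(i := w)))) (at u)"
    unfolding smooth_map_def by blast
  from this(2)[where i = 0 and u = u, unfolded this(1)] show ?thesis by (rule has_derivative_continuous)
qed

context scale_of_spaces
begin

section \<open>Composition of compatible families\<close>

text \<open>A map is judged by its action on two-parameter families, with either parameter as the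
  step size. In this form composition and iteration are immediate, so no array of mixed derivatives
  has to be built for \<Psi> or its powers.\<close>

definition scale_family :: "(real \<Rightarrow> 'a \<Rightarrow> 'a) \<Rightarrow> bool" where
  "scale_family \<Psi> \<longleftrightarrow>
     (\<forall>N l c. scale_diff N l c \<longrightarrow>
        scale_diff N l (\<lambda>x y. \<Psi> x (c x y)) \<and> scale_diff N l (\<lambda>x y. \<Psi> y (c x y)))"

lemma scale_tower_imp_scale_family: "scale_tower \<phi> E \<Longrightarrow> scale_family \<phi>"
  unfolding scale_family_def
  using scale_tower_scale_diff_compose[of \<phi> E 1 0] scale_tower_scale_diff_compose[of \<phi> E 0 1] by simp

lemma scale_family_comp:
  "scale_family \<Psi> \<Longrightarrow> scale_family \<Psi>' \<Longrightarrow> scale_family (\<lambda>h. \<Psi> h \<circ> \<Psi>' h)"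
  by (simp add: scale_family_def)

lemma scale_family_funpow: "scale_family \<Psi> \<Longrightarrow> scale_family (\<lambda>h. \<Psi> h ^^ m)"
proof (induction m)
  case 0
  then show ?case by (simp add: scale_family_def)
next
  case (Suc m)
  then show ?case using scale_family_comp[of \<Psi> "\<lambda>h. \<Psi> h ^^ m"] by (simp add: comp_def)
qed

lemma scale_family_orbit:
  assumes \<Psi>: "scale_family \<Psi>" and u: "u \<in> Hs (N + l)"
  shows "scale_diff N l (\<lambda>x y. \<Psi> x u)" "scale_diff N l (\<lambda>x y. \<Psi> y u)"
  using \<Psi> scale_diff_const[OF u] by (auto simp: scale_family_def)

lemma scale_family_mem: "scale_family \<Psi> \<Longrightarrow> u \<in> Hs l \<Longrightarrow> h \<in> I \<Longrightarrow> \<Psi> h u \<in> Hs l"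
  using scale_diff_cont[OF scale_family_orbit(1)[of \<Psi> u 0 l]] scale_cont_mem[of l "\<lambda>x y. \<Psi> x u" h h] by simp

lemma scale_family_h_differentiable:
  "scale_family \<Psi> \<Longrightarrow> u \<in> Hs N \<Longrightarrow> h_differentiable hs N (\<lambda>h. \<Psi> h u)"
  using scale_diff_imp_h_differentiable(1)[OF scale_family_orbit(1)[of \<Psi> u N 0]] by simp

lemma scale_family_h_differentiable_deriv:
  assumes "scale_family \<Psi>" "scale_family \<Theta>" "u \<in> Hs (N + i)"
  shows "h_differentiable hs N (\<lambda>x. dh i (\<lambda>h. \<Theta> h (\<Psi> x u)) 0)"
proof (rule scale_diff_imp_h_differentiable_mixed)
  have "scale_diff (N + i) 0 (\<lambda>x y. \<Psi> x u)" using assms by (intro scale_family_orbit) simp_all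
  then show "scale_diff (N + i) 0 (\<lambda>x y. \<Theta> y (\<Psi> x u))" using assms(2) by (simp add: scale_family_def)
qed (use hs in simp)

text \<open>With separate step sizes \<open>x\<close> and \<open>y\<close> the composite is a
  two-parameter family, and its diagonal derivative is the sum of the partial ones. At 0 the other
  factor is the identity, which turns these into \<open>a\<close> and \<open>b\<close>.\<close>

lemma scale_family_vector_derivative_comp:
  assumes \<Phi>: "scale_family \<Phi>" "\<Phi> 0 = id" "((\<lambda>h. \<Phi> h u) has_vector_derivative a) (at 0 within I)"
    and \<Theta>: "scale_family \<Theta>" "\<Theta> 0 = id" "((\<lambda>h. \<Theta> h u) has_vector_derivative b) (at 0 within I)"
    and u: "u \<in> Hs 1"
  shows "((\<lambda>h. \<Phi> h (\<Theta> h u)) has_vector_derivative a + b) (at 0 within I)"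
proof -
  have z: "0 \<in> I" using hs by simp
  have "scale_diff (Suc 0) 0 (\<lambda>x y. \<Theta> y u)" using u by (intro scale_family_orbit \<Theta>) simp
  then have "scale_diff (Suc 0) 0 (\<lambda>x y. \<Phi> x (\<Theta> y u))" using \<Phi>(1) by (simp add: scale_family_def del: scale_diff.simps)
  then obtain cx cy where
      "\<And>x y. x \<in> I \<Longrightarrow> y \<in> I \<Longrightarrow> ((\<lambda>x. \<Phi> x (\<Theta> y u)) has_vector_derivative cx x y) (at x within I)"
    and "\<And>x y. x \<in> I \<Longrightarrow> y \<in> I \<Longrightarrow> ((\<lambda>y. \<Phi> x (\<Theta> y u)) has_vector_derivative cy x y) (at y within I)"
    and d: "\<And>h. h \<in> I \<Longrightarrow> ((\<lambda>h. \<Phi> h (\<Theta> h u)) has_vector_derivative cx h h + cy h h) (at h within I)"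
    by (rule scale_diff_partials) (rule that)
  from this(1)[OF z z] this(2)[OF z z]
  have "((\<lambda>h. \<Phi> h u) has_vector_derivative cx 0 0) (at 0 within I)"
    "((\<lambda>h. \<Theta> h u) has_vector_derivative cy 0 0) (at 0 within I)"
    using \<Phi>(2) \<Theta>(2) by simp_all
  then have "cx 0 0 = a" "cy 0 0 = b"
    using vector_deriv_I_unique[OF _ \<Phi>(3) z] vector_deriv_I_unique[OF _ \<Theta>(3) z] by blast+
  then show ?thesis using d[OF z] by simp
qed

lemma scale_tower_h_deriv:
  assumes E: "scale_tower \<phi> E" and u: "u \<in> Hs k" and h: "h \<in> I"
  shows "dh k (\<lambda>h. \<phi> h u) h = E k 0 h u v"
  using u h
proof (induction k arbitrary: h)
  case 0
  then show ?case by (simp add: scale_tower_base[OF E])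
next
  case (Suc k)
  have u: "u \<in> Hs k" using Hs_mem[OF Suc.prems(1)] by simp
  have "H.deriv 0 (\<lambda>h. E k 0 h u v) (E (Suc k) 0 h u v) h I"
    by (rule scale_tower_deriv_h[OF E Suc.prems(2)]) (use Suc.prems in auto)
  then have "((\<lambda>h. E k 0 h u v) has_vector_derivative E (Suc k) 0 h u v) (at h within I)"
    by (rule deriv_imp_vector)
  then have "(dh k (\<lambda>h. \<phi> h u) has_vector_derivative E (Suc k) 0 h u v) (at h within I)"
    by (subst has_vector_derivative_cong_I[OF _ Suc.prems(2), where g = "\<lambda>h. E k 0 h u v"])
      (rule Suc.IH[OF u])
  then show ?case using vector_derivative_I[OF _ Suc.prems(2)] by simp
qed

text \<open>Both sides are \<open>k\<close>-fold derivatives in \<open>y\<close> of the flow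
  identity, with \<open>\<phi> y\<close> as the outer map. At \<open>y = 0\<close> this moves time
  derivatives from time \<open>x\<close> to time 0.\<close>

lemma scale_tower_semigroup:
  assumes E: "scale_tower \<phi> E"
    and flow: "\<And>x y. 0 \<le> x \<Longrightarrow> 0 \<le> y \<Longrightarrow> x + y < hs \<Longrightarrow> \<phi> (x + y) u = \<phi> y (\<phi> x u)"
    and xy: "0 \<le> x" "0 \<le> y" "x + y < hs" and u: "u \<in> Hs k"
  shows "E k 0 (x + y) u v = E k 0 y (\<phi> x u) v"
  using xy u
proof (induction k arbitrary: y)
  case 0
  then show ?case by (simp add: scale_tower_base[OF E] flow)
next
  case (Suc k)
  \<comment> \<open>The flow identity holds only while \<open>x + z < hs\<close>; derivatives within
    the shorter interval still determine the value at \<open>y\<close>.\<close>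
  let ?J = "{0..<hs - x}"
  have J: "y \<in> ?J" "?J \<subseteq> I" using Suc.prems by auto
  have xI: "x \<in> I" "y \<in> I" "x + y \<in> I" using Suc.prems by auto
  have u: "u \<in> Hs k" using Hs_mem[OF Suc.prems(4)] by simp
  have \<phi>u: "\<phi> x u \<in> Hs (Suc k)"
    by (rule scale_family_mem[OF scale_tower_imp_scale_family[OF E] Suc.prems(4) xI(1)])
  have eq: "E k 0 (x + z) u v = E k 0 z (\<phi> x u) v" if "z \<in> ?J" for z
    by (rule Suc.IH) (use that Suc.prems u in auto)
  have "((\<lambda>z. E k 0 z (\<phi> x u) v) has_vector_derivative E (Suc k) 0 y (\<phi> x u) v) (at y within I)"
    by (rule deriv_imp_vector[of 0], rule scale_tower_deriv_h[OF E xI(2)]) (use \<phi>u in auto)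
  then have "((\<lambda>z. E k 0 z (\<phi> x u) v) has_vector_derivative E (Suc k) 0 y (\<phi> x u) v) (at y within ?J)"
    using J(2) by (rule has_vector_derivative_within_subset)
  then have 1: "((\<lambda>z. E k 0 (x + z) u v) has_vector_derivative E (Suc k) 0 y (\<phi> x u) v) (at y within ?J)"
    by (rule has_vector_derivative_transform[OF J(1), rotated]) (rule eq)
  have "((\<lambda>z. E k 0 z u v) has_vector_derivative E (Suc k) 0 (x + y) u v) (at (x + y) within I)"
    by (rule deriv_imp_vector[of 0], rule scale_tower_deriv_h[OF E xI(3)]) (use Suc.prems in auto)
  then have "((\<lambda>z. E k 0 z u v) has_vector_derivative E (Suc k) 0 (x + y) u v) (at (x + y) within (\<lambda>z. x + z) ` ?J)"
    by (rule has_vector_derivative_within_subset) (use xI in auto)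
  moreover have "((\<lambda>z. x + z) has_vector_derivative 1) (at y within ?J)"
    by (simp only: has_real_derivative_iff_has_vector_derivative[symmetric])
      (auto intro!: derivative_eq_intros)
  ultimately have "((\<lambda>z. E k 0 z u v) \<circ> (\<lambda>z. x + z) has_vector_derivative 1 *\<^sub>R E (Suc k) 0 (x + y) u v) (at y within ?J)"
    by (rule vector_diff_chain_within[rotated])
  then have 2: "((\<lambda>z. E k 0 (x + z) u v) has_vector_derivative E (Suc k) 0 (x + y) u v) (at y within ?J)"
    by (simp only: o_def scaleR_one)
  show ?case
    by (rule vector_derivative_unique_within[OF at_within_atLeastLessThan[OF J(1)] 2 1])
qed

text \<open>Chain rule with the time frozen at 0: the curve \<open>\<Psi> x u\<close> enters only
  through its tangent \<open>a\<close>. This is what allows one family to be exchanged for another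
  with the same tangent.\<close>

lemma h_deriv_1_tower_orbit:
  assumes E: "scale_tower \<phi> E" and \<Psi>: "scale_family \<Psi>" "\<Psi> 0 = id"
    and u: "u \<in> Hs (Suc k)"
    and d: "((\<lambda>h. \<Psi> h u) has_vector_derivative a) (at 0 within I)"
  shows "dh 1 (\<lambda>x. E k 0 0 (\<Psi> x u) v) 0 = E k 1 0 u (\<lambda>_. a)"
proof -
  have z: "0 \<in> I" using hs by simp
  have "scale_diff (Suc 0) k (\<lambda>x y. \<Psi> x u)" by (rule scale_family_orbit[OF \<Psi>(1)]) (use u in simp)
  then obtain cx cy where c: "scale_cont (Suc (0 + k)) (\<lambda>x y. \<Psi> x u)"
    "\<And>x y. x \<in> I \<Longrightarrow> y \<in> I \<Longrightarrow> H.deriv (0 + k) (\<lambda>x. \<Psi> x u) (cx x y) x I"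
    by (rule scale_diff_SucE) (rule that)
  have dk: "H.deriv (k + 0) (\<lambda>x. \<Psi> x u) (cx 0 0) 0 I" using c(2)[OF z z] by simp
  \<comment> \<open>\<open>a\<close> is a derivative in the ambient space, while the chain rule
    needs one at level \<open>k\<close>; uniqueness identifies the two.\<close>
  have cx: "cx 0 0 = a"
    by (rule vector_deriv_I_unique[OF deriv_imp_vector[OF dk] d z])
  have "H.deriv 0 (\<lambda>x. E k 0 0 (\<Psi> x u) (\<lambda>r. v r))
    (0 *\<^sub>R E (Suc k) 0 0 (\<Psi> 0 u) (\<lambda>r. v r) + E k (Suc 0) 0 (\<Psi> 0 u) ((\<lambda>r. v r)(0 := cx 0 0))
      + (\<Sum>r<0. E k 0 0 (\<Psi> 0 u) ((\<lambda>r. v r)(r := 0)))) 0 I"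
  \<comment> \<open>Frozen time has derivative 0, and at \<open>i = 0\<close> the sum over
    directions is empty; only the middle term remains.\<close>
  proof (rule scale_tower_chain[OF E, where t = "\<lambda>_. 0" and V = "\<lambda>r _. v r" and ?V1.0 = "\<lambda>_. 0"])
    show "H.deriv (k + 0) (\<lambda>x. \<Psi> x u) (cx 0 0) 0 I" by (rule dk)
    show "\<Psi> y u \<in> Hs (Suc k + 0)" if "y \<in> I" for y
      using scale_family_mem[OF \<Psi>(1) u that] by simp
    show "H.tends (Suc k + 0) (\<lambda>x. \<Psi> x u) (\<Psi> 0 u) (at 0 within I)"
      using scale_cont_section(1)[OF c(1) z z] by simp
  qed (use z in auto)
  then have "((\<lambda>x. E k 0 0 (\<Psi> x u) v) has_vector_derivative E k (Suc 0) 0 u (v(0 := a))) (at 0 within I)"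
    using deriv_imp_vector \<Psi>(2) cx by fastforce
  then have "dh 1 (\<lambda>x. E k 0 0 (\<Psi> x u) v) 0 = E k (Suc 0) 0 u (v(0 := a))"
    using vector_derivative_I[OF _ z] by simp
  also have "\<dots> = E k (Suc 0) 0 u (\<lambda>_. a)"
    by (rule scale_tower_cong[OF E]) simp
  finally show ?thesis by simp
qed

text \<open>By the flow property the \<open>k\<close>-th time derivative at time \<open>x\<close> is
  the one at time 0 started from \<open>\<phi> x u\<close>. Hence order \<open>Suc k\<close> at 0 is
  a derivative in \<open>x\<close> along the orbit, and there \<open>\<phi> x u\<close> can be
  traded for \<open>\<Psi> x u\<close>, both having tangent \<open>a\<close>.\<close>

lemma h_deriv_step:
  assumes E: "scale_tower \<phi> E" and \<phi>0: "\<phi> 0 = id"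
    and flow: "\<And>x y u. 0 \<le> x \<Longrightarrow> 0 \<le> y \<Longrightarrow> x + y < hs \<Longrightarrow> \<phi> (x + y) u = \<phi> y (\<phi> x u)"
    and \<Psi>: "scale_family \<Psi>" "\<Psi> 0 = id" and u: "u \<in> Hs (Suc k)"
    and d: "((\<lambda>h. \<Psi> h u) has_vector_derivative a) (at 0 within I)"
      "((\<lambda>h. \<phi> h u) has_vector_derivative a) (at 0 within I)"
  shows "dh 1 (\<lambda>x. dh k (\<lambda>h. \<phi> h (\<Psi> x u)) 0) 0 = dh (Suc k) (\<lambda>h. \<phi> h u) 0"
proof -
  have z: "0 \<in> I" using hs by simp
  let ?v = "\<lambda>_. 0"
  have u': "u \<in> Hs k" using Hs_mem[OF u] by simp
  note fam = scale_tower_imp_scale_family[OF E]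
  have *: "dh 1 (\<lambda>x. dh k (\<lambda>h. \<phi> h (\<Theta> x u)) 0) 0 = E k 1 0 u (\<lambda>_. a)"
    if \<Theta>: "scale_family \<Theta>" "\<Theta> 0 = id" "((\<lambda>h. \<Theta> h u) has_vector_derivative a) (at 0 within I)" for \<Theta>
  proof -
    have "dh 1 (\<lambda>x. dh k (\<lambda>h. \<phi> h (\<Theta> x u)) 0) 0 = dh 1 (\<lambda>x. E k 0 0 (\<Theta> x u) ?v) 0"
      by (rule h_deriv_cong[OF scale_tower_h_deriv[OF E scale_family_mem[OF \<Theta>(1) u'] z] z])
    then show ?thesis using h_deriv_1_tower_orbit[OF E \<Theta>(1,2) u \<Theta>(3)] by simp
  qed
  have "dh (Suc k) (\<lambda>h. \<phi> h u) 0 = vector_derivative (dh k (\<lambda>h. \<phi> h u)) (at 0 within I)" by simp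
  also have "\<dots> = dh 1 (dh k (\<lambda>h. \<phi> h u)) 0" by simp
  also have "\<dots> = dh 1 (\<lambda>x. dh k (\<lambda>h. \<phi> h (\<phi> x u)) 0) 0"
  proof (rule h_deriv_cong[OF _ z])
    fix x assume x: "x \<in> I"
    have "dh k (\<lambda>h. \<phi> h u) x = E k 0 (x + 0) u ?v"
      using scale_tower_h_deriv[OF E u' x] by simp
    also have "\<dots> = E k 0 0 (\<phi> x u) ?v"
      by (rule scale_tower_semigroup[OF E flow]) (use x u' in auto)
    also have "\<dots> = dh k (\<lambda>h. \<phi> h (\<phi> x u)) 0"
      by (rule scale_tower_h_deriv[OF E scale_family_mem[OF fam u' x] z, symmetric])
    finally show "dh k (\<lambda>h. \<phi> h u) x = dh k (\<lambda>h. \<phi> h (\<phi> x u)) 0" .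
  qed
  also have "\<dots> = E k 1 0 u (\<lambda>_. a)" by (rule *[OF fam \<phi>0 d(2)])
  also have "\<dots> = dh 1 (\<lambda>x. dh k (\<lambda>h. \<phi> h (\<Psi> x u)) 0) 0" by (rule *[OF \<Psi> d(1), symmetric])
  finally show ?thesis by (rule sym)
qed

section \<open>Taylor coefficients of the iterated splitting\<close>

lemma h_deriv_fdiff:
  assumes "\<And>m. h_differentiable hs n (F m)" "k \<le> n" "h \<in> I"
  shows "fdiff r (\<lambda>m. dh k (F m) h) m = dh k (\<lambda>x. fdiff r (\<lambda>m. F m x) m) h"
  using assms(1)
proof (induction r arbitrary: F)
  case (Suc r)
  let ?G = "\<lambda>m x. F (Suc m) x + (-1) *\<^sub>R F m x"
  have s: "h_differentiable hs n (\<lambda>x. (-1) *\<^sub>R F m x)" for m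
    by (rule h_deriv_scaleR(1)[OF Suc.prems])
  have G: "h_differentiable hs n (?G m)" for m
    by (rule h_deriv_add(1)[OF Suc.prems s])
  have "dh k (?G m) h = dh k (F (Suc m)) h + (-1) *\<^sub>R dh k (F m) h" for m
    by (simp only: h_deriv_add(2)[OF Suc.prems s assms(2,3)] h_deriv_scaleR(2)[OF Suc.prems assms(2,3)])
  then show ?case using Suc.IH[of ?G, OF G] by simp
qed simp

context
  fixes \<Psi> :: "real \<Rightarrow> 'a \<Rightarrow> 'a"
  assumes \<Psi>: "scale_family \<Psi>" and \<Psi>0: "\<Psi> 0 = id"
begin

text \<open>In the Leibniz rule the term without \<open>x\<close>-derivatives is the coefficient for
  \<open>m\<close>, as \<open>\<Psi> 0 = id\<close>. It cancels, and every other term has lower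
  order in \<open>y\<close>.\<close>

lemma h_deriv_funpow_Suc:
  assumes u: "u \<in> Hs k"
  shows "dh k (\<lambda>h. (\<Psi> h ^^ Suc m) u) 0 - dh k (\<lambda>h. (\<Psi> h ^^ m) u) 0
    = (\<Sum>j<k. real (k choose Suc j) *\<^sub>R
        dh (Suc j) (\<lambda>x. dh (k - Suc j) (\<lambda>h. (\<Psi> h ^^ m) (\<Psi> x u)) 0) 0)"
proof -
  let ?P = "\<lambda>j. real (k choose j) *\<^sub>R dh j (\<lambda>x. dh (k - j) (\<lambda>h. (\<Psi> h ^^ m) (\<Psi> x u)) 0) 0"
  have "scale_diff k 0 (\<lambda>x y. \<Psi> x u)" using u by (intro scale_family_orbit \<Psi>) simp
  then have "scale_diff k 0 (\<lambda>x y. (\<Psi> y ^^ m) (\<Psi> x u))"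
    using scale_family_funpow[OF \<Psi>] by (simp add: scale_family_def)
  from h_deriv_diagonal[OF this]
  have "dh k (\<lambda>h. (\<Psi> h ^^ Suc m) u) 0 = (\<Sum>j\<le>k. ?P j)"
    by (simp add: funpow_Suc_right del: funpow.simps)
  also have "\<dots> = ?P 0 + (\<Sum>j<k. ?P (Suc j))"
    unfolding lessThan_Suc_atMost[symmetric] by (rule sum.lessThan_Suc_shift)
  also have "?P 0 = dh k (\<lambda>h. (\<Psi> h ^^ m) u) 0" using \<Psi>0 by simp
  finally show ?thesis by simp
qed

text \<open>\<open>X\<close> is abstract here, known only by its recursion along \<Psi>. Each
  difference lowers the order by at least one, so for \<open>r > k\<close> the orders run out and
  everything vanishes. For \<open>r = k\<close> only \<open>j = 0\<close> can survive; its
  coefficient \<open>k\<close> and the factor \<open>(k - 1)!\<close> from the induction make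
  \<open>k!\<close>.\<close>

lemma fdiff_h_deriv_funpow:
  assumes X0: "\<And>u. X 0 u = u"
    and X: "\<And>k u. u \<in> Hs (Suc k) \<Longrightarrow> h_differentiable hs 1 (\<lambda>x. X k (\<Psi> x u)) \<and>
      dh 1 (\<lambda>x. X k (\<Psi> x u)) 0 = X (Suc k) u"
    and u: "u \<in> Hs k" and r: "k \<le> r"
  shows "fdiff r (\<lambda>m. dh k (\<lambda>h. (\<Psi> h ^^ m) u) 0) m = (if r = k then fact k *\<^sub>R X k u else 0)"
  using u r
proof (induction k arbitrary: u r m rule: less_induct)
  case (less k)
  have z: "0 \<in> I" using hs by simp
  show ?case
  proof (cases r)
    case 0
    \<comment> \<open>\<open>r = 0\<close> forces \<open>k = 0\<close>, where the coefficient is the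
      value at step size 0.\<close>
    have "(id ^^ m) u = u" by (induction m) auto
    then show ?thesis using 0 less.prems X0 \<Psi>0 by simp
  next
    case (Suc r')
    have diff: "h_differentiable hs (Suc j) (\<lambda>x. dh (k - Suc j) (\<lambda>h. (\<Psi> h ^^ m) (\<Psi> x u)) 0)" if "j < k" for j m
      by (rule scale_family_h_differentiable_deriv[OF \<Psi> scale_family_funpow[OF \<Psi>]])
        (use that less.prems in simp)
    have "fdiff r (\<lambda>m. dh k (\<lambda>h. (\<Psi> h ^^ m) u) 0) m
      = fdiff r' (\<lambda>m. \<Sum>j<k. real (k choose Suc j) *\<^sub>R
          dh (Suc j) (\<lambda>x. dh (k - Suc j) (\<lambda>h. (\<Psi> h ^^ m) (\<Psi> x u)) 0) 0) m"
      unfolding Suc fdiff.simps h_deriv_funpow_Suc[OF less.prems(1)] by (rule refl)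
    also have "\<dots> = (\<Sum>j<k. real (k choose Suc j) *\<^sub>R
          fdiff r' (\<lambda>m. dh (Suc j) (\<lambda>x. dh (k - Suc j) (\<lambda>h. (\<Psi> h ^^ m) (\<Psi> x u)) 0) 0) m)"
      by (rule fdiff_sum)
    \<comment> \<open>Differences in \<open>m\<close> are finite linear combinations, so they pass
      through the \<open>x\<close>-derivatives and reach the inner coefficients, to which the
      induction applies.\<close>
    also have "\<dots> = (\<Sum>j<k. real (k choose Suc j) *\<^sub>R
          dh (Suc j) (\<lambda>x. fdiff r' (\<lambda>m. dh (k - Suc j) (\<lambda>h. (\<Psi> h ^^ m) (\<Psi> x u)) 0) m) 0)"
      by (rule sum.cong[OF refl], rule arg_cong[where f = "scaleR _"], rule h_deriv_fdiff[OF diff order_refl z])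
        simp
    also have "\<dots> = (\<Sum>j<k. real (k choose Suc j) *\<^sub>R
          dh (Suc j) (\<lambda>x. if r' = k - Suc j then fact (k - Suc j) *\<^sub>R X (k - Suc j) (\<Psi> x u) else 0) 0)"
    proof (rule sum.cong[OF refl], rule arg_cong[where f = "scaleR _"], rule h_deriv_cong[OF _ z])
      fix j x assume j: "j \<in> {..<k}" and x: "x \<in> I"
      show "fdiff r' (\<lambda>m. dh (k - Suc j) (\<lambda>h. (\<Psi> h ^^ m) (\<Psi> x u)) 0) m
        = (if r' = k - Suc j then fact (k - Suc j) *\<^sub>R X (k - Suc j) (\<Psi> x u) else 0)"
      proof (rule less.IH)
        show "\<Psi> x u \<in> Hs (k - Suc j)"
          by (rule Hs_mem[OF scale_family_mem[OF \<Psi> less.prems(1) x]]) simp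
      qed (use j less.prems Suc in auto)
    qed
    also have "\<dots> = (\<Sum>j<k. if j = 0 \<and> Suc r' = k then fact k *\<^sub>R X k u else 0)"
    proof (rule sum.cong[OF refl])
      fix j assume j: "j \<in> {..<k}"
      show "real (k choose Suc j) *\<^sub>R
          dh (Suc j) (\<lambda>x. if r' = k - Suc j then fact (k - Suc j) *\<^sub>R X (k - Suc j) (\<Psi> x u) else 0) 0
        = (if j = 0 \<and> Suc r' = k then fact k *\<^sub>R X k u else 0)"
      proof (cases "j = 0 \<and> Suc r' = k")
        case True
        then have k: "k = Suc r'" by simp
        have "u \<in> Hs (Suc r')" using less.prems(1) by (simp only: k)
        note * = conjunct1[OF X[OF this]] conjunct2[OF X[OF this]]
        have "dh 1 (\<lambda>x. fact r' *\<^sub>R X r' (\<Psi> x u)) 0 = fact r' *\<^sub>R X k u"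
          by (simp only: h_deriv_scaleR(2)[OF *(1) order_refl z] *(2) k)
        moreover have "j = 0" using True by simp
        ultimately show ?thesis by (simp add: k del: h_deriv.simps(2))
      next
        case False
        then have "r' \<noteq> k - Suc j" using j less.prems(2) Suc by auto
        then show ?thesis
          unfolding if_not_P[OF False] by (simp only: if_False h_deriv_zero[OF z] scaleR_zero_right)
      qed
    qed
    also have "\<dots> = (if r = k then fact k *\<^sub>R X k u else 0)"
    proof (cases "r = k")
      case True
      then show ?thesis using Suc by (simp add: sum.delta)
    next
      case False
      then show ?thesis using Suc by simp
    qed
    finally show ?thesis .
  qed
qed

text \<open>As a function of \<open>m\<close> the coefficient of \<open>(\<Psi> h ^^ m) u\<close> is
  a Newton polynomial truncated at degree \<open>k\<close>. The step size \<open>h / m\<close>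
  contributes \<open>m^(-k)\<close>, and \<open>sum_weights_binomial\<close> picks out the top
  difference \<open>k! X k u\<close> with weight \<open>1 / k!\<close>.\<close>

theorem h_deriv_affine_method:
  assumes X0: "\<And>u. X 0 u = u"
    and X: "\<And>k u. u \<in> Hs (Suc k) \<Longrightarrow> h_differentiable hs 1 (\<lambda>x. X k (\<Psi> x u)) \<and>
      dh 1 (\<lambda>x. X k (\<Psi> x u)) 0 = X (Suc k) u"
    and one: "(\<Sum>m = 1..s. \<gamma> m) = 1"
    and zero: "\<And>k. 1 \<le> k \<Longrightarrow> k \<le> q - 1 \<Longrightarrow> (\<Sum>m = 1..s. real m powi (- int k) * \<gamma> m) = 0"
    and u: "u \<in> Hs q"
  shows "h_differentiable hs q (\<lambda>h. affine_method s \<gamma> \<Psi> h u)"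
    and "k \<le> q \<Longrightarrow> dh k (\<lambda>h. affine_method s \<gamma> \<Psi> h u) 0 = X k u"
proof -
  have z: "0 \<in> I" using hs by simp
  let ?f = "\<lambda>m h. \<gamma> m *\<^sub>R (\<Psi> (1 / real m * h) ^^ m) u"
  have affine: "affine_method s \<gamma> \<Psi> h u = (\<Sum>m = 1..s. ?f m h)" for h
    by (simp add: affine_method_def)
  have it: "h_differentiable hs q (\<lambda>h. (\<Psi> h ^^ m) u)" for m
    by (rule scale_family_h_differentiable[OF scale_family_funpow[OF \<Psi>] u])
  have arg: "0 < 1 / real m" "1 / real m \<le> 1" if "m \<in> {1..s}" for m using that by auto
  note it' = h_deriv_scale_arg(1)[OF it arg]
  have f: "h_differentiable hs q (?f m)" if "m \<in> {1..s}" for m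
    by (rule h_deriv_scaleR(1)[OF it'[OF that that]])
  show "h_differentiable hs q (\<lambda>h. affine_method s \<gamma> \<Psi> h u)"
    unfolding affine by (rule h_deriv_sum(1)[OF f])
  assume k: "k \<le> q"
  have uk: "u \<in> Hs k" by (rule Hs_mem[OF u k])
  define P where "P m = dh k (\<lambda>h. (\<Psi> h ^^ m) u) 0" for m
  define a where "a r = fdiff r P 0" for r
  have fd: "a r = (if r = k then fact k *\<^sub>R X k u else 0)" if "k \<le> r" for r
    unfolding a_def P_def by (rule fdiff_h_deriv_funpow[OF X0 X uk that])
  \<comment> \<open>Newton's formula stops at \<open>m\<close>, the vanishing of the differences at
    \<open>k\<close>; both sums extend to \<open>max m k\<close> by zero terms.\<close>
  have newton: "P m = (\<Sum>r\<le>k. real (m choose r) *\<^sub>R a r)" for m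
  proof -
    have "P m = (\<Sum>r\<le>m. real (m choose r) *\<^sub>R a r)" unfolding a_def by (rule newton_forward)
    also have "\<dots> = (\<Sum>r\<le>max m k. real (m choose r) *\<^sub>R a r)"
      by (rule sum.mono_neutral_left) auto
    also have "\<dots> = (\<Sum>r\<le>k. real (m choose r) *\<^sub>R a r)"
      by (rule sum.mono_neutral_right) (auto simp: fd)
    finally show ?thesis .
  qed
  have "dh k (\<lambda>h. affine_method s \<gamma> \<Psi> h u) 0 = (\<Sum>m = 1..s. dh k (?f m) 0)"
    unfolding affine by (rule h_deriv_sum(2)[OF f k z])
  also have "\<dots> = (\<Sum>m = 1..s. (\<gamma> m * (1 / real m) ^ k) *\<^sub>R P m)"
  proof (rule sum.cong[OF refl])
    fix m assume m: "m \<in> {1..s}"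
    have "dh k (?f m) 0 = \<gamma> m *\<^sub>R dh k (\<lambda>h. (\<Psi> (1 / real m * h) ^^ m) u) 0"
      by (rule h_deriv_scaleR(2)[OF it'[OF m m] k z])
    also have "\<dots> = \<gamma> m *\<^sub>R (1 / real m) ^ k *\<^sub>R dh k (\<lambda>h. (\<Psi> h ^^ m) u) (1 / real m * 0)"
      by (simp only: h_deriv_scale_arg(2)[OF it arg[OF m] k z])
    finally show "dh k (?f m) 0 = (\<gamma> m * (1 / real m) ^ k) *\<^sub>R P m"
      by (simp only: P_def mult_zero_right scaleR_scaleR)
  qed
  also have "\<dots> = (\<Sum>r\<le>k. (\<Sum>m = 1..s. \<gamma> m * (1 / real m) ^ k * real (m choose r)) *\<^sub>R a r)"
    unfolding newton scaleR_sum_right scaleR_sum_left scaleR_scaleR by (rule sum.swap)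
  also have "\<dots> = X k u"
  proof (cases k)
    case 0
    then show ?thesis using one fd[of 0] by simp
  next
    case (Suc k')
    \<comment> \<open>\<open>sum_weights_binomial\<close> starts at \<open>r = 1\<close>. The term
      at \<open>r = 0\<close> is the coefficient for \<open>m = 0\<close>, a constant curve, which
      is 0 in positive order.\<close>
    have "a 0 = 0" unfolding a_def P_def using h_deriv_const[OF z] Suc by simp
    have "(\<Sum>r\<le>k. (\<Sum>m = 1..s. \<gamma> m * (1 / real m) ^ k * real (m choose r)) *\<^sub>R a r)
      = (\<Sum>r\<le>k. if r = k then (1 / fact k) *\<^sub>R a k else 0)"
    proof (intro sum.cong[OF refl])
      fix r assume "r \<in> {..k}"
      then show "(\<Sum>m = 1..s. \<gamma> m * (1 / real m) ^ k * real (m choose r)) *\<^sub>R a r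
        = (if r = k then (1 / fact k) *\<^sub>R a k else 0)"
        using sum_weights_binomial[OF one zero _ _ k, of r] Suc \<open>a 0 = 0\<close> by (cases "r = 0") auto
    qed
    also have "\<dots> = (1 / fact k) *\<^sub>R fact k *\<^sub>R X k u" using fd[of k] by (simp add: sum.delta)
    finally show ?thesis by simp
  qed
  finally show "dh k (\<lambda>h. affine_method s \<gamma> \<Psi> h u) 0 = X k u" .
qed

end

end

section \<open>Splitting for the semilinear evolution equation\<close>

theorem theorem3p1:
  fixes Hs :: "nat \<Rightarrow> 'a::{real_inner, banach} set"
    and ip :: "nat \<Rightarrow> 'a \<Rightarrow> 'a \<Rightarrow> real"
    and DA0 :: "'a set"
    and A0 A1 :: "'a \<Rightarrow> 'a"
    and S \<phi> \<phi>0 \<phi>1 \<Psi> :: "real \<Rightarrow> 'a \<Rightarrow> 'a"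
    and \<kappa>0 hs :: real
    and q s :: nat
    and \<gamma> :: "nat \<Rightarrow> real"
  assumes scale: "hilbert_scale Hs ip"
    and A0: "closed_densely_defined DA0 A0"
    and semigroup: "c0_semigroup S"
    and generator: "is_generator DA0 A0 S"
    and quasicontraction: "\<And>t u. 0 \<le> t \<Longrightarrow> norm (S t u) \<le> exp (\<kappa>0 * t) * norm u"
    and A1: "smooth_map A1" "A1 0 = 0"
    and hs: "0 < hs"
    and flow: "mild_flow hs S A1 \<phi>"
    and flow0: "mild_flow hs S (\<lambda>_. 0) \<phi>0"
    and flow1: "mild_flow hs (\<lambda>_. id) A1 \<phi>1"
    and compat: "compatible hs Hs ip \<phi>" "compatible hs Hs ip \<phi>0" "compatible hs Hs ip \<phi>1"
    and sum_gamma: "(\<Sum>m = 1..s. \<gamma> m) = 1"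
    and order_conds: "\<And>k. 1 \<le> k \<Longrightarrow> k \<le> q - 1 \<Longrightarrow> (\<Sum>m = 1..s. real m powi (- int k) * \<gamma> m) = 0"
    and sign: "\<Psi> = split_plus \<phi>0 \<phi>1 \<or> \<Psi> = split_minus \<phi>0 \<phi>1"
  shows "\<forall>u\<in>Hs q.
           h_differentiable hs q (\<lambda>h. affine_method s \<gamma> \<Psi> h u) \<and>
           h_differentiable hs q (\<lambda>h. \<phi> h u) \<and>
           (\<forall>k\<le>q. h_deriv hs k (\<lambda>h. affine_method s \<gamma> \<Psi> h u) 0 = h_deriv hs k (\<lambda>h. \<phi> h u) 0)"
proof -
  interpret scale_of_spaces Hs ip hs by unfold_locales (rule scale hs)+
  have z: "0 \<in> I" using hs by simp
  obtain E where E: "scale_tower \<phi> E" by (rule compatible_imp_scale_tower[OF compat(1)])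
  obtain E0 where E0: "scale_tower \<phi>0 E0" by (rule compatible_imp_scale_tower[OF compat(2)])
  obtain E1 where E1: "scale_tower \<phi>1 E1" by (rule compatible_imp_scale_tower[OF compat(3)])
  note fam = scale_tower_imp_scale_family[OF E] scale_tower_imp_scale_family[OF E0]
    scale_tower_imp_scale_family[OF E1]
  note id = mild_flow_0[OF flow] mild_flow_0[OF flow0] mild_flow_0[OF flow1]
  \<comment> \<open>The two times are interchanged so that the increment \<open>y\<close> belongs to
    the outer map.\<close>
  have add: "\<phi> (x + y) u = \<phi> y (\<phi> x u)" if "0 \<le> x" "0 \<le> y" "x + y < hs" for x y u
    using mild_flow_add[OF flow that(2,1), of u] that by (simp add: add.commute)
  have \<Psi>: "scale_family \<Psi>" "\<Psi> 0 = id"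
    using sign scale_family_comp[OF fam(3,2)] scale_family_comp[OF fam(2,3)]
    by (auto simp: split_plus_def[abs_def] split_minus_def[abs_def] id)
  \<comment> \<open>The common tangent is \<open>A1 u + b 0\<close>, where \<open>b 0\<close> is the
    derivative of \<open>\<phi>0\<close> at 0, which exists by compatibility for
    \<open>u \<in> Hs 1\<close>.\<close>
  have tangent: "\<exists>a. ((\<lambda>h. \<Psi> h u) has_vector_derivative a) (at 0 within I) \<and>
      ((\<lambda>h. \<phi> h u) has_vector_derivative a) (at 0 within I)" if u: "u \<in> Hs 1" for u
  proof -
    have "h_differentiable hs (Suc 0) (\<lambda>h. \<phi>0 h u)"
      using scale_family_h_differentiable[OF fam(2) u] by simp
    then obtain b where "\<And>h. h \<in> I \<Longrightarrow> ((\<lambda>h. \<phi>0 h u) has_vector_derivative b h) (at h within I)"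
      by (rule h_differentiable_SucE) (rule that)
    from this[OF z] have b: "((\<lambda>h. \<phi>0 h u) has_vector_derivative b 0) (at 0 within I)" .
    have "((\<lambda>t. \<phi> t u - \<phi>0 t u) has_vector_derivative A1 u) (at 0 within I)"
    proof (rule has_vector_derivative_transform[OF z])
      show "((\<lambda>t. \<phi> t u - S t u) has_vector_derivative A1 u) (at 0 within I)"
        by (rule mild_flow_deriv_0[OF hs semigroup quasicontraction smooth_map_isCont[OF A1(1)] flow])
    qed (simp only: mild_flow_zero[OF semigroup flow0])
    from has_vector_derivative_add[OF this b]
    have \<phi>: "((\<lambda>h. \<phi> h u) has_vector_derivative A1 u + b 0) (at 0 within I)" by simp
    \<comment> \<open>The flow of \<open>A1\<close> alone is a mild flow for the identity semigroup,
      with growth constant 0, so the Duhamel argument covers it too.\<close>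
    have "c0_semigroup (\<lambda>_. id :: 'a \<Rightarrow> 'a)"
      using bounded_linear_ident by (simp add: c0_semigroup_def id_def comp_def)
    then have "((\<lambda>t. \<phi>1 t u - id u) has_vector_derivative A1 u) (at 0 within I)"
      by (rule mild_flow_deriv_0[OF hs _ _ smooth_map_isCont[OF A1(1)] flow1, of 0]) simp
    from has_vector_derivative_add[OF this has_vector_derivative_const[of u]]
    have 1: "((\<lambda>h. \<phi>1 h u) has_vector_derivative A1 u) (at 0 within I)" by simp
    have "((\<lambda>h. \<phi>1 h (\<phi>0 h u)) has_vector_derivative A1 u + b 0) (at 0 within I)"
      by (rule scale_family_vector_derivative_comp[OF fam(3) id(3) 1 fam(2) id(2) b u])
    moreover have "((\<lambda>h. \<phi>0 h (\<phi>1 h u)) has_vector_derivative b 0 + A1 u) (at 0 within I)"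
      by (rule scale_family_vector_derivative_comp[OF fam(2) id(2) b fam(3) id(3) 1 u])
    ultimately have "((\<lambda>h. \<Psi> h u) has_vector_derivative A1 u + b 0) (at 0 within I)"
      using sign by (auto simp: split_plus_def split_minus_def add.commute)
    with \<phi> show ?thesis by blast
  qed
  \<comment> \<open>The time derivatives of \<phi> at 0 are the sequence asked for by
    \<open>h_deriv_affine_method\<close>; its recursion along \<Psi> is
    \<open>h_deriv_step\<close>.\<close>
  define X where "X k u = dh k (\<lambda>h. \<phi> h u) 0" for k u
  have X0: "X 0 u = u" for u by (simp add: X_def id)
  have X: "h_differentiable hs 1 (\<lambda>x. X k (\<Psi> x u)) \<and> dh 1 (\<lambda>x. X k (\<Psi> x u)) 0 = X (Suc k) u"
    if u: "u \<in> Hs (Suc k)" for k u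
  proof
    show "h_differentiable hs 1 (\<lambda>x. X k (\<Psi> x u))"
      unfolding X_def by (rule scale_family_h_differentiable_deriv[OF \<Psi>(1) fam(1)]) (use u in simp)
    obtain a where a: "((\<lambda>h. \<Psi> h u) has_vector_derivative a) (at 0 within I)"
      "((\<lambda>h. \<phi> h u) has_vector_derivative a) (at 0 within I)"
      using tangent[OF Hs_mem[OF u, of 1]] by auto
    show "dh 1 (\<lambda>x. X k (\<Psi> x u)) 0 = X (Suc k) u"
      unfolding X_def by (rule h_deriv_step[OF E id(1) add \<Psi> u a])
  qed
  show ?thesis
  proof (intro ballI conjI allI impI)
    fix u assume u: "u \<in> Hs q"
    show "h_differentiable hs q (\<lambda>h. affine_method s \<gamma> \<Psi> h u)"
      by (rule h_deriv_affine_method(1)[OF \<Psi> X0 X sum_gamma order_conds u])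
    show "h_differentiable hs q (\<lambda>h. \<phi> h u)"
      by (rule scale_family_h_differentiable[OF fam(1) u])
    show "dh k (\<lambda>h. affine_method s \<gamma> \<Psi> h u) 0 = dh k (\<lambda>h. \<phi> h u) 0" if "k \<le> q" for k
      using h_deriv_affine_method(2)[OF \<Psi> X0 X sum_gamma order_conds u that] by (simp only: X_def)
  qed
qed

end
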